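(* Let $\{P_i\}_i$ be a sequence of Delzant polytopes in $\mathbb{R}^n$ and let $P$ be a Delzant polytope in $\mathbb{R}^n$. Suppose that $d^H(P_i,P)\to0$ as $i\to\infty$ and that the limit as $i\to\infty$ of the number of facets of $P_i$ exists and equals the number of facets of $P$. Take a subsequence of the symplectic toric manifolds $\{M_{P_i}\}_i$ (with Guillemin metrics) which converges to $M_P$ in the $T^n$-equivariant Gromov-Hausdorff topology. Then, along this subsequence, $M_{P_i}$ is $T^n$-equivariantly diffeomorphic to $M_P$ for all sufficiently large $i$.
   Context: $d^H$ is the Hausdorff distance on compact subsets of $\mathbb{R}^n$. Delzant polytopes. An $n$-dimensional convex polytope $P\subset\mathbb{R}^n$ is a Delzant polytope if each vertex of $P$ lies on exactly $n$ edges, and at each vertex the directional vectors of the edges can be taken to be integral vectors forming a $\mathbb{Z}$-basis of $\mathbb{Z}^n$. Delzant construction and Guillemin metric. Let $P$ be a Delzant polytope with $N$ facets, written $P=\bigcap_{r=1}^N\{x\in\mathbb{R}^n \mid l^{(r)}(x)\ge 0\}$ with $l^{(r)}(x)=\langle x,\nu^{(r)}\rangle-\lambda^{(r)}$, where $\nu^{(r)}\in\mathbb{Z}^n$ is the primitive inward normal vector of the $r$-th facet. Let $T^k=\mathbb{R}^k/\mathbb{Z}^k$. The torus $T^N$ acts on $\mathbb{C}^N$ by $[\theta]\cdot z=(e^{2\pi\sqrt{-1}\theta_r}z_r)_r$. Equip $\mathbb{C}^N$ with the standard flat Kähler structure scaled by $1/\pi$ (metric $\frac1\pi\sum_r(du_r^2+dv_r^2)$,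 symplectic form $\frac1\pi\sum_r du_r\wedge dv_r$, $z_r=u_r+\sqrt{-1}v_r$). The linear map $\mathbb{R}^N\to\mathbb{R}^n$, $e_r\mapsto\nu^{(r)}$, induces a surjective homomorphism $T^N\to T^n$; let $H$ be its kernel, a subtorus of dimension $N-n$. Let $Z_P:=\{z\in\mathbb{C}^N \mid \exists x\in\mathbb{R}^n,\ |z_r|^2=l^{(r)}(x)\text{ for all } r\}$. It is a compact submanifold on which $H$ acts freely, and $M_P:=Z_P/H$ is a compact Kähler manifold of real dimension $2n$ (Kähler reduction), with an effective isometric Hamiltonian action of $T=T^n=T^N/H$. The Riemannian metric on $M_P$ induced from $\mathbb{C}^N$ (the quotient metric, making $Z_P\to M_P$ a Riemannian submersion) is called the Guillemin metric. $M_P$ is regarded as a metric space by its Riemannian distance. Equivariant Gromov-Hausdorff convergence. Let $(X,d)$ and $(X_i,d_i)$ be compact metric spaces on each of which a group $G$ acts effectively by isometries. $\{X_i\}_i$ converges to $X$ in the $G$-equivariant Gromov-Hausdorff topology if there exist maps $f_i:X_i\to X$, group automorphisms $\rho_i:G\to G$ and numbers $\epsilon_i>0$ with $\epsilon_i\to0$ such that for all large $i$: $|d_i(x,y)-d(f_i(x),f_i(y))|<\epsilon_i$ for all $x,y\in X_i$; for any $p\in X$ there is $x\in X_i$ with $d(p,f_i(x))<\epsilon_i$; and $d(f_i(gx),\rho_i(g)f_i(x))<\epsilon_i$ for all $x\in X_i$, $g\in G$. *)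

theory Defs
  imports "HOL-Analysis.Analysis" "HOL-Analysis.Finite_Function_Topology" "HOL-Algebra.Coset"
begin

section \<open>Lattice vectors and Delzant polytopes\<close>

definition int_lattice :: "(real^'n) set" where
  "int_lattice = {x. \<forall>i. x $ i \<in> \<int>}"

definition lattice_basis :: "(real^'n) set \<Rightarrow> bool" where
  "lattice_basis B \<longleftrightarrow> finite B \<and> B \<subseteq> int_lattice \<and>
     (\<forall>c :: real^'n \<Rightarrow> int. (\<Sum>b\<in>B. of_int (c b) *\<^sub>R b) = 0 \<longrightarrow> (\<forall>b\<in>B. c b = 0)) \<and>
     (\<forall>x\<in>int_lattice. \<exists>c :: real^'n \<Rightarrow> int. x = (\<Sum>b\<in>B. of_int (c b) *\<^sub>R b))"

definition edges_at :: "(real^'n) set \<Rightarrow> real^'n \<Rightarrow> (real^'n) set set" where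
  "edges_at P p = {e. e edge_of P \<and> p \<in> e}"

text \<open>The vector \<open>u e\<close> is a directional vector of the edge \<open>e\<close>, pointing away from
  the vertex \<open>p\<close>.\<close>

definition delzant :: "(real^'n) set \<Rightarrow> bool" where
  "delzant P \<longleftrightarrow> polytope P \<and> aff_dim P = int CARD('n) \<and>
     (\<forall>p. p extreme_point_of P \<longrightarrow>
        card (edges_at P p) = CARD('n) \<and>
        (\<exists>u. (\<forall>e\<in>edges_at P p. \<exists>t>0. e = closed_segment p (p + t *\<^sub>R u e)) \<and>
             lattice_basis (u ` edges_at P p)))"

definition hausdorff_dist :: "'a::metric_space set \<Rightarrow> 'a set \<Rightarrow> real" where
  "hausdorff_dist A B = max (SUP x\<in>A. infdist x B) (SUP y\<in>B. infdist y A)"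

text \<open>
  The facets of a full-dimensional polytope correspond bijectively to their primitive inward
  normal vectors, so these normal vectors serve as the labels \<open>r = 1, \<dots>, N\<close>
  of the facets.\<close>

definition primitive :: "real^'n \<Rightarrow> bool" where
  "primitive v \<longleftrightarrow> v \<in> int_lattice \<and>
     (\<forall>w\<in>int_lattice. \<forall>k::int. v = of_int k *\<^sub>R w \<longrightarrow> \<bar>k\<bar> = 1)"

definition cuts_facet :: "(real^'n) set \<Rightarrow> real^'n \<Rightarrow> real \<Rightarrow> bool" where
  "cuts_facet P v c \<longleftrightarrow> P \<subseteq> {x. c \<le> x \<bullet> v} \<and> (P \<inter> {x. x \<bullet> v = c}) facet_of P"

definition normals :: "(real^'n) set \<Rightarrow> (real^'n) set" where
  "normals P = {v. primitive v \<and> (\<exists>c. cuts_facet P v c)}"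

definition facet_fun :: "(real^'n) set \<Rightarrow> real^'n \<Rightarrow> real^'n \<Rightarrow> real" where
  "facet_fun P v x = x \<bullet> v - (THE c. cuts_facet P v c)"


section \<open>The Delzant construction\<close>

text \<open>
  \<open>\<complex>\<^sup>N\<close> is the space of finitely supported functions whose support lies in
  \<open>normals P\<close>. An element of the torus \<open>T\<^sup>N\<close> is given by a representative
  in \<open>\<real>\<^sup>N\<close>, that is by the values on \<open>normals P\<close> of a function
  \<open>\<theta>\<close>. The norm of the library on finitely supported functions is the
  \<open>l\<^sup>1\<close>-norm; it is used only for the topology and for derivatives.\<close>

type_synonym 'n coords = "(real^'n) \<Rightarrow>\<^sub>0 complex"

definition torus_rotate :: "(real^'n \<Rightarrow> real) \<Rightarrow> 'n coords \<Rightarrow> 'n coords" where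
  "torus_rotate \<theta> z = Poly_Mapping.mapp (\<lambda>v w. cis (2 * pi * \<theta> v) * w) z"

definition normal_map :: "(real^'n) set \<Rightarrow> (real^'n \<Rightarrow> real) \<Rightarrow> real^'n" where
  "normal_map P \<theta> = (\<Sum>v\<in>normals P. \<theta> v *\<^sub>R v)"

definition level_set :: "(real^'n) set \<Rightarrow> 'n coords set" where
  "level_set P = {z. Poly_Mapping.keys z \<subseteq> normals P \<and>
     (\<exists>x. \<forall>v\<in>normals P. (cmod (Poly_Mapping.lookup z v))\<^sup>2 = facet_fun P v x)}"

text \<open>The kernel \<open>H\<close> of \<open>T\<^sup>N \<rightarrow> T\<^sup>n\<close> consists of the classes of
  those \<open>\<theta>\<close> with \<open>normal_map P \<theta> \<in> int_lattice\<close>.\<close>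

definition H_orbit :: "(real^'n) set \<Rightarrow> 'n coords \<Rightarrow> 'n coords set" where
  "H_orbit P z = {torus_rotate \<theta> z |\<theta>. normal_map P \<theta> \<in> int_lattice}"

definition toric_manifold :: "(real^'n) set \<Rightarrow> 'n coords set set" where
  "toric_manifold P = H_orbit P ` level_set P"

definition torus :: "(real^'n) set monoid" where
  "torus = \<lparr>carrier = UNIV, mult = (+), one = 0\<rparr> Mod int_lattice"

text \<open>The elements of the torus are cosets \<open>A\<close> of the lattice. The rotations of an
  \<open>H\<close>-orbit \<open>m\<close> by all elements of \<open>T\<^sup>N\<close> lying over \<open>A\<close> form
  a single \<open>H\<close>-orbit; this is the action of \<open>T\<^sup>n = T\<^sup>N / H\<close>.\<close>

definition torus_action :: "(real^'n) set \<Rightarrow> (real^'n) set \<Rightarrow> 'n coords set \<Rightarrow> 'n coords set" where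
  "torus_action P A m = {torus_rotate \<theta> z |\<theta> z. normal_map P \<theta> \<in> A \<and> z \<in> m}"


section \<open>The Guillemin metric and its distance function\<close>

definition flat_metric :: "(real^'n) set \<Rightarrow> 'n coords \<Rightarrow> 'n coords \<Rightarrow> real" where
  "flat_metric P a b =
     (\<Sum>v\<in>normals P. Poly_Mapping.lookup a v \<bullet> Poly_Mapping.lookup b v) / pi"

text \<open>The tangent space at \<open>z\<close> of the \<open>H\<close>-orbit: velocities at time \<open>0\<close> of
  \<open>torus_rotate (\<lambda>v. t * \<xi> v) z\<close> for \<open>\<xi>\<close> in the Lie algebra of
  \<open>H\<close>.\<close>

definition vertical :: "(real^'n) set \<Rightarrow> 'n coords \<Rightarrow> 'n coords set" where
  "vertical P z =
     {Poly_Mapping.mapp (\<lambda>v w. \<i> * of_real (2 * pi * \<xi> v) * w) z |\<xi>. normal_map P \<xi> = 0}"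

definition horizontal_part :: "(real^'n) set \<Rightarrow> 'n coords \<Rightarrow> 'n coords \<Rightarrow> 'n coords" where
  "horizontal_part P z a =
     (THE b. a - b \<in> vertical P z \<and> (\<forall>u\<in>vertical P z. flat_metric P b u = 0))"

text \<open>The norm, in the quotient metric, of the image in the tangent space of
  \<open>toric_manifold P\<close> at \<open>H_orbit P z\<close> of a vector \<open>a\<close> tangent to
  \<open>level_set P\<close> at \<open>z\<close>.\<close>

definition guillemin_norm :: "(real^'n) set \<Rightarrow> 'n coords \<Rightarrow> 'n coords \<Rightarrow> real" where
  "guillemin_norm P z a =
     sqrt (flat_metric P (horizontal_part P z a) (horizontal_part P z a))"

text \<open>
  The \<open>C\<^sup>1\<close> curves in \<open>toric_manifold P\<close> are the projections of the
  \<open>C\<^sup>1\<close> curves \<open>\<gamma>\<close> in \<open>level_set P\<close>. The length below is the length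
  of the projected curve, not that of \<open>\<gamma>\<close> itself. Piecewise \<open>C\<^sup>1\<close> curves
  give the same infimum. They are avoided because \<^const>\<open>piecewise_C1_differentiable_on\<close>
  admits curves of infinite length, for which the integral would take the default
  value \<open>0\<close>.\<close>

definition guillemin_length :: "(real^'n) set \<Rightarrow> (real \<Rightarrow> 'n coords) \<Rightarrow> real" where
  "guillemin_length P \<gamma> =
     integral {0..1} (\<lambda>t. guillemin_norm P (\<gamma> t) (vector_derivative \<gamma> (at t)))"

definition guillemin_dist :: "(real^'n) set \<Rightarrow> 'n coords set \<Rightarrow> 'n coords set \<Rightarrow> real" where
  "guillemin_dist P m m' =
     Inf {guillemin_length P \<gamma> |\<gamma>. \<gamma> C1_differentiable_on {0..1} \<and>
            \<gamma> ` {0..1} \<subseteq> level_set P \<and> \<gamma> 0 \<in> m \<and> \<gamma> 1 \<in> m'}"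


section \<open>Smooth structure\<close>

text \<open>For open \<open>U\<close>, \<open>Ck_on k U f\<close> says that \<open>f\<close> is of class
  \<open>C\<^sup>k\<close> on \<open>U\<close>, with the derivative as a linear map treated through its values at
  all vectors. This is the usual notion as long as \<open>f\<close> depends on finitely many
  coordinates only; on \<open>\<complex>\<^sup>N\<close> this can always be arranged by composing with the
  coordinate projection.\<close>

primrec Ck_on :: "nat \<Rightarrow> 'a::real_normed_vector set \<Rightarrow> ('a \<Rightarrow> 'b::real_normed_vector) \<Rightarrow> bool" where
  "Ck_on 0 = (\<lambda>U f. continuous_on U f)"
| "Ck_on (Suc k) = (\<lambda>U f. (\<forall>x\<in>U. f differentiable (at x)) \<and>
     (\<forall>a. Ck_on k U (\<lambda>x. frechet_derivative f (at x) a)))"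

text \<open>Smoothness on an arbitrary subset: local extendability to a smooth map on an open
  set. For an embedded submanifold \<open>A\<close> this is smoothness in the submanifold structure.\<close>

definition smooth_on :: "'a::real_normed_vector set \<Rightarrow> ('a \<Rightarrow> 'b::real_normed_vector) \<Rightarrow> bool" where
  "smooth_on A f \<longleftrightarrow> (\<forall>x\<in>A. \<exists>U F. open U \<and> x \<in> U \<and> (\<forall>k. Ck_on k U F) \<and>
     (\<forall>y\<in>U \<inter> A. F y = f y))"

text \<open>The quotient topology; \<open>\<Union>V\<close> is the preimage of \<open>V\<close> in the level set.\<close>

definition toric_topology :: "(real^'n) set \<Rightarrow> 'n coords set topology" where
  "toric_topology P =
     topology (\<lambda>V. V \<subseteq> toric_manifold P \<and> openin (top_of_set (level_set P)) (\<Union>V))"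

text \<open>
  The charts of the quotient manifold, that is of the unique smooth structure for which
  \<open>H_orbit P : level_set P \<rightarrow> toric_manifold P\<close> is a submersion: \<open>\<kappa>\<close> is
  smooth because its pullback to the level set is, and its inverse is smooth because it lifts
  locally to smooth maps into the level set. Every point lies in the domain of such a chart.
  The model space \<open>\<complex>\<^sup>n\<close> is used as a real vector space of dimension \<open>2n\<close>.\<close>

definition toric_chart ::
  "(real^'n) set \<Rightarrow> 'n coords set set \<Rightarrow> ('n coords set \<Rightarrow> complex^'n) \<Rightarrow> bool" where
  "toric_chart P U \<kappa> \<longleftrightarrow>
     openin (toric_topology P) U \<and> inj_on \<kappa> U \<and> open (\<kappa> ` U) \<and>
     smooth_on {z \<in> level_set P. H_orbit P z \<in> U} (\<lambda>z. \<kappa> (H_orbit P z)) \<and>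
     (\<forall>y\<in>\<kappa> ` U. \<exists>W s. open W \<and> y \<in> W \<and> smooth_on W s \<and>
        (\<forall>x\<in>W. s x \<in> level_set P \<and> H_orbit P (s x) \<in> U \<and> \<kappa> (H_orbit P (s x)) = x))"

definition toric_smooth ::
  "(real^'n) set \<Rightarrow> (real^'n) set \<Rightarrow> ('n coords set \<Rightarrow> 'n coords set) \<Rightarrow> bool" where
  "toric_smooth P Q \<phi> \<longleftrightarrow>
     continuous_map (toric_topology P) (toric_topology Q) \<phi> \<and>
     (\<forall>U \<kappa> V \<kappa>'. toric_chart P U \<kappa> \<and> toric_chart Q V \<kappa>' \<longrightarrow>
        smooth_on (\<kappa> ` {m \<in> U. \<phi> m \<in> V}) (\<lambda>x. \<kappa>' (\<phi> (inv_into U \<kappa> x))))"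

definition equivariantly_diffeomorphic :: "(real^'n) set \<Rightarrow> (real^'n) set \<Rightarrow> bool" where
  "equivariantly_diffeomorphic P Q \<longleftrightarrow>
     (\<exists>\<phi>. bij_betw \<phi> (toric_manifold P) (toric_manifold Q) \<and>
          toric_smooth P Q \<phi> \<and>
          toric_smooth Q P (inv_into (toric_manifold P) \<phi>) \<and>
          (\<forall>A\<in>carrier torus. \<forall>m\<in>toric_manifold P.
             \<phi> (torus_action P A m) = torus_action Q A (\<phi> m)))"


section \<open>Equivariant Gromov--Hausdorff convergence\<close>

text \<open>To be read for compact metric spaces \<open>(X i, d i)\<close> and \<open>(Y, dY)\<close> with
  effective isometric actions \<open>act i\<close> and \<open>actY\<close> of the group \<open>G\<close>.\<close>

definition equivariant_GH_converges ::
  "('g, 'm) monoid_scheme \<Rightarrow>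
   (nat \<Rightarrow> 'a set) \<Rightarrow> (nat \<Rightarrow> 'a \<Rightarrow> 'a \<Rightarrow> real) \<Rightarrow> (nat \<Rightarrow> 'g \<Rightarrow> 'a \<Rightarrow> 'a) \<Rightarrow>
   'b set \<Rightarrow> ('b \<Rightarrow> 'b \<Rightarrow> real) \<Rightarrow> ('g \<Rightarrow> 'b \<Rightarrow> 'b) \<Rightarrow> bool" where
  "equivariant_GH_converges G X d act Y dY actY \<longleftrightarrow>
     (\<exists>f \<rho> \<epsilon>. (\<forall>i. f i \<in> X i \<rightarrow> Y) \<and> (\<forall>i. \<rho> i \<in> iso G G) \<and>
        (\<forall>i. \<epsilon> i > 0) \<and> \<epsilon> \<longlonglongrightarrow> (0::real) \<and>
        (\<forall>\<^sub>F i in sequentially.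
           (\<forall>x\<in>X i. \<forall>y\<in>X i. \<bar>d i x y - dY (f i x) (f i y)\<bar> < \<epsilon> i) \<and>
           (\<forall>p\<in>Y. \<exists>x\<in>X i. dY p (f i x) < \<epsilon> i) \<and>
           (\<forall>x\<in>X i. \<forall>g\<in>carrier G. dY (f i (act i g x)) (actY (\<rho> i g) (f i x)) < \<epsilon> i)))"

end

theory Submission
  imports Defs
begin

text \<open>
  Under the hypotheses every facet of \<open>P\<close> is approximated by a facet of \<open>P\<^sub>i\<close>, and because the
  numbers of facets agree these are all facets of \<open>P\<^sub>i\<close>. At a vertex of \<open>P\<^sub>i\<close> near a vertex of \<open>P\<close>
  the primitive normals form a lattice basis whose directions converge; this bounds their lengths,
  and as they are lattice vectors they are eventually equal to the normals of \<open>P\<close>. So for large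
  \<open>i\<close> the polytopes \<open>P\<close> and \<open>P\<^sub>i\<close> have the same normals and nearly the same facet offsets,
  so that their level sets are quotiented by the same group \<open>H\<close>.

  A diffeomorphism \<open>\<psi>\<close> from \<open>P\<close> to \<open>P\<^sub>i\<close> with \<open>l'\<^sub>r(\<psi>(x)) = g\<^sub>r(x)\<^sup>2 l\<^sub>r(x)\<close> for positive smooth
  functions \<open>g\<^sub>r\<close> lifts to the torus-equivariant diffeomorphism \<open>z\<^sub>r \<mapsto> g\<^sub>r(\<mu>(z)) z\<^sub>r\<close> of the level sets,
  where \<open>\<mu>\<close> is the moment map, and hence to the quotients. Such a \<open>\<psi>\<close> close to the identity is
  obtained by translating \<open>P\<close> near its vertices.\<close>

section \<open>Calculus with \<^const>\<open>Ck_on\<close> and \<^const>\<open>smooth_on\<close>\<close>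

text \<open>\<open>delzant\<close> speaks of edges, whereas the construction uses facets. The bridge
  is that a polytope lies in the cone spanned by its edges at a vertex; from it come the halfspace
  description and, at each vertex, n normals dual to the edge directions over the integers. The same
  duality gives the length bound: an edge direction b pairs to exactly 1 with its own normal, so a
  long normal would be nearly orthogonal to b; all other normals at the vertex are orthogonal to b,
  and this contradicts the independence of the limiting directions. A map of polytopes lifts by
  rescaling coordinates if each facet function pulls back to a smooth positive multiple of its
  counterpart, because the facet function is the squared modulus of the coordinate. With weights
  that are products of facet functions this factor is explicit, and nothing has to be divided at the
  boundary. The deformation is linear in the offset differences, so one small tolerance yields both
  injectivity and positivity of the factors.\<close>

lemma Ck_on_cong:
  assumes "open U" "\<And>x. x \<in> U \<Longrightarrow> f x = g x" "Ck_on k U f"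
  shows "Ck_on k U g"
  using assms(2,3)
proof (induction k arbitrary: f g)
  case 0
  then show ?case by (auto cong: continuous_on_cong)
next
  case (Suc k)
  have d: "g differentiable (at x) \<and> frechet_derivative g (at x) = frechet_derivative f (at x)"
    if "x \<in> U" for x
  proof -
    have "(f has_derivative frechet_derivative f (at x)) (at x)"
      using Suc.prems(2) that by (auto simp: frechet_derivative_works)
    then have "(g has_derivative frechet_derivative f (at x)) (at x)"
      by (rule has_derivative_transform_within_open[OF _ \<open>open U\<close> that]) (simp add: Suc.prems)
    then show ?thesis
      using frechet_derivative_at differentiable_def by metis
  qed
  show ?case
  proof (simp, intro conjI ballI allI)
    show "Ck_on k U (\<lambda>x. frechet_derivative g (at x) a)" for a
      by (rule Suc.IH[of "\<lambda>x. frechet_derivative f (at x) a"]) (use Suc.prems d in auto)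
  qed (use d in auto)
qed

text \<open>Admits a derivative in closed form in place of \<open>frechet_derivative\<close>, so
  that inductions on the order can follow the usual differentiation rules.\<close>

lemma Ck_on_SucI:
  assumes "open U" "\<And>x. x \<in> U \<Longrightarrow> (f has_derivative f' x) (at x)"
    "\<And>a. Ck_on k U (\<lambda>x. f' x a)"
  shows "Ck_on (Suc k) U f"
proof (simp, intro conjI ballI allI)
  fix x assume "x \<in> U" then show "f differentiable (at x)"
    using assms(2) differentiable_def by blast
next
  fix a show "Ck_on k U (\<lambda>x. frechet_derivative f (at x) a)"
    by (rule Ck_on_cong[OF assms(1) _ assms(3)[of a]]) (metis assms(2) frechet_derivative_at)
qed

lemma Ck_on_SucD:
  assumes "Ck_on (Suc k) U f"
  shows "\<And>x. x \<in> U \<Longrightarrow> (f has_derivative frechet_derivative f (at x)) (at x)"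
    "\<And>a. Ck_on k U (\<lambda>x. frechet_derivative f (at x) a)"
  using assms by (auto simp: frechet_derivative_works)

lemma Ck_on_subset: "Ck_on k U f \<Longrightarrow> V \<subseteq> U \<Longrightarrow> Ck_on k V f"
  by (induction k arbitrary: f) (auto intro: continuous_on_subset)

lemma Ck_on_Suc_imp: "Ck_on (Suc k) U f \<Longrightarrow> Ck_on k U f"
proof (induction k arbitrary: f)
  case 0
  then show ?case
    by (auto intro!: continuous_at_imp_continuous_on differentiable_imp_continuous_within)
next
  case (Suc k)
  then show ?case
    unfolding Ck_on.simps(2)[of "Suc k"] Ck_on.simps(2)[of k] by blast
qed

lemma Ck_on_const: "open U \<Longrightarrow> Ck_on k U (\<lambda>x. c)"
proof (induction k arbitrary: c)
  case (Suc k)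
  show ?case by (rule Ck_on_SucI[where f'="\<lambda>x a. 0"]) (use Suc in auto)
qed auto

lemma Ck_on_bounded_linear:
  assumes "open U" "bounded_linear L"
  shows "Ck_on k U f \<Longrightarrow> Ck_on k U (\<lambda>x. L (f x))"
proof (induction k arbitrary: f)
  case 0
  then show ?case using bounded_linear.continuous_on[OF assms(2)] by simp
next
  case (Suc k)
  show ?case
    by (rule Ck_on_SucI[OF assms(1) bounded_linear.has_derivative[OF assms(2)] Suc.IH],
        erule Ck_on_SucD[OF Suc.prems], rule Ck_on_SucD[OF Suc.prems])
qed

lemma Ck_on_id: "open U \<Longrightarrow> Ck_on k U (\<lambda>x. x)"
proof (induction k)
  case (Suc k)
  show ?case by (rule Ck_on_SucI[where f'="\<lambda>x a. a"]) (use Suc Ck_on_const in auto)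
qed auto

lemma Ck_on_add:
  assumes "open U"
  shows "Ck_on k U f \<Longrightarrow> Ck_on k U g \<Longrightarrow> Ck_on k U (\<lambda>x. f x + g x)"
proof (induction k arbitrary: f g)
  case 0
  then show ?case by (auto intro: continuous_intros)
next
  case (Suc k)
  show ?case
    by (rule Ck_on_SucI[OF assms(1) has_derivative_add Suc.IH],
        erule Ck_on_SucD[OF Suc.prems(1)], erule Ck_on_SucD[OF Suc.prems(2)],
        rule Ck_on_SucD[OF Suc.prems(1)], rule Ck_on_SucD[OF Suc.prems(2)])
qed

lemma Ck_on_sum:
  assumes "open U" "\<And>i. i \<in> I \<Longrightarrow> Ck_on k U (f i)"
  shows "Ck_on k U (\<lambda>x. \<Sum>i\<in>I. f i x)"
  using assms(2) by (induction I rule: infinite_finite_induct) (auto intro: Ck_on_const Ck_on_add assms(1))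

lemma Ck_on_bilinear:
  assumes "open U" "bounded_bilinear B"
  shows "Ck_on k U f \<Longrightarrow> Ck_on k U g \<Longrightarrow> Ck_on k U (\<lambda>x. B (f x) (g x))"
proof (induction k arbitrary: f g)
  case 0
  then show ?case using bounded_bilinear.continuous_on[OF assms(2)] by simp
next
  case (Suc k)
  show ?case
    by (rule Ck_on_SucI[OF assms(1) bounded_bilinear.FDERIV[OF assms(2)]],
        erule Ck_on_SucD[OF Suc.prems(1)], erule Ck_on_SucD[OF Suc.prems(2)],
        intro Ck_on_add assms(1) Suc.IH Ck_on_Suc_imp[OF Suc.prems(1)] Ck_on_Suc_imp[OF Suc.prems(2)]
          Ck_on_SucD(2)[OF Suc.prems(1)] Ck_on_SucD(2)[OF Suc.prems(2)])
qed

lemmas Ck_on_mult = Ck_on_bilinear[OF _ bounded_bilinear_mult]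
lemmas Ck_on_scaleR = Ck_on_bilinear[OF _ bounded_bilinear_scaleR]

lemma Ck_on_prod:
  fixes f :: "'i \<Rightarrow> 'a::real_normed_vector \<Rightarrow> real"
  assumes "open U" "\<And>i. i \<in> I \<Longrightarrow> Ck_on k U (f i)"
  shows "Ck_on k U (\<lambda>x. \<Prod>i\<in>I. f i x)"
  using assms(2) by (induction I rule: infinite_finite_induct) (auto intro: Ck_on_const Ck_on_mult assms(1))

lemma Ck_on_inverse:
  fixes f :: "'a::real_normed_vector \<Rightarrow> real"
  assumes "open U" "\<And>x. x \<in> U \<Longrightarrow> f x \<noteq> 0"
  shows "Ck_on k U f \<Longrightarrow> Ck_on k U (\<lambda>x. inverse (f x))"
proof (induction k)
  case 0
  then show ?case using assms by (auto intro: continuous_intros)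
next
  case (Suc k)
  have i: "Ck_on k U (\<lambda>x. inverse (f x))" by (rule Suc.IH[OF Ck_on_Suc_imp[OF Suc.prems]])
  show ?case
  proof (rule Ck_on_SucI[OF assms(1)])
    show "((\<lambda>x. inverse (f x)) has_derivative
       (\<lambda>a. (-1) * (inverse (f x) * frechet_derivative f (at x) a * inverse (f x)))) (at x)" if "x \<in> U" for x
      using Deriv.has_derivative_inverse[OF assms(2)[OF that] Ck_on_SucD(1)[OF Suc.prems that]] by simp
    show "Ck_on k U (\<lambda>x. (-1) * (inverse (f x) * frechet_derivative f (at x) a * inverse (f x)))" for a
      by (intro Ck_on_mult Ck_on_const assms(1) i Ck_on_SucD(2)[OF Suc.prems])
  qed
qed

lemma Ck_on_sqrt:
  assumes "open U" "\<And>x. x \<in> U \<Longrightarrow> f x > 0"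
  shows "Ck_on k U f \<Longrightarrow> Ck_on k U (\<lambda>x. sqrt (f x))"
proof (induction k)
  case 0
  then show ?case by (auto intro: continuous_intros)
next
  case (Suc k)
  have i: "Ck_on k U (\<lambda>x. sqrt (f x))" by (rule Suc.IH[OF Ck_on_Suc_imp[OF Suc.prems]])
  show ?case
  proof (rule Ck_on_SucI[OF assms(1)])
    show "((\<lambda>x. sqrt (f x)) has_derivative
       (\<lambda>a. frechet_derivative f (at x) a * (inverse (sqrt (f x)) * (1/2)))) (at x)" if "x \<in> U" for x
      using has_derivative_real_sqrt[OF assms(2)[OF that] Ck_on_SucD(1)[OF Suc.prems that]] 
      by (simp add: field_simps)
    show "Ck_on k U (\<lambda>x. frechet_derivative f (at x) a * (inverse (sqrt (f x)) * (1/2)))" for a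
      by (intro Ck_on_mult Ck_on_const Ck_on_inverse assms(1) i Ck_on_SucD(2)[OF Suc.prems])
        (use assms(2) in fastforce)
  qed
qed

text \<open>The chain rule for \<^const>\<open>Ck_on\<close> needs finitely many coordinates \<open>c j\<close> on
  the intermediate space, because \<^const>\<open>Ck_on\<close> only controls the derivative in each
  fixed direction.\<close>

lemma Ck_on_compose:
  assumes "open U" "open V" "f ` U \<subseteq> V" "finite J" "\<And>j. j \<in> J \<Longrightarrow> bounded_linear (c j)"
    "\<And>x. x \<in> U \<Longrightarrow> f x = (\<Sum>j\<in>J. c j (f x) *\<^sub>R b j)"
  shows "Ck_on k U f \<Longrightarrow> Ck_on k V g \<Longrightarrow> Ck_on k U (\<lambda>x. g (f x))"
proof (induction k arbitrary: g)
  case 0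
  then show ?case using assms(3) by (auto intro: continuous_on_compose2)
next
  case (Suc k)
  note f = Ck_on_SucD[OF Suc.prems(1)] and g = Ck_on_SucD[OF Suc.prems(2)]
  let ?f = "\<lambda>x. frechet_derivative f (at x)" and ?g = "\<lambda>x. frechet_derivative g (at x)"
  \<comment> \<open>Differentiating the coordinate expansion shows that the derivative of f stays in
    the span of the \<open>b j\<close>. The outer derivative is then needed only in the finitely
    many fixed directions \<open>b j\<close>.\<close>
  have fd: "?f x a = (\<Sum>j\<in>J. c j (?f x a) *\<^sub>R b j)" if "x \<in> U" for x a
  proof -
    have "((\<lambda>x. \<Sum>j\<in>J. c j (f x) *\<^sub>R b j) has_derivative (\<lambda>a. \<Sum>j\<in>J. c j (?f x a) *\<^sub>R b j)) (at x)"
      by (intro has_derivative_sum has_derivative_scaleR_left bounded_linear.has_derivative[OF assms(5)] f(1) that)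
    then have "(f has_derivative (\<lambda>a. \<Sum>j\<in>J. c j (?f x a) *\<^sub>R b j)) (at x)"
      by (rule has_derivative_transform_within_open[OF _ assms(1) that]) (simp add: assms(6)[symmetric])
    with f(1)[OF that] have "?f x = (\<lambda>a. \<Sum>j\<in>J. c j (?f x a) *\<^sub>R b j)"
      by (rule has_derivative_unique)
    then show ?thesis by metis
  qed
  show ?case
  proof (rule Ck_on_SucI[OF assms(1)])
    fix x assume x: "x \<in> U"
    then have fx: "f x \<in> V" using assms(3) by auto
    have lin: "linear (?g (f x))"
      using g(1)[OF fx] has_derivative_linear by blast
    have "((\<lambda>x. g (f x)) has_derivative (\<lambda>a. ?g (f x) (?f x a))) (at x)"
      by (rule has_derivative_compose[OF f(1)[OF x] g(1)[OF fx]])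
    moreover have "?g (f x) (?f x a) = (\<Sum>j\<in>J. c j (?f x a) *\<^sub>R ?g (f x) (b j))" for a
      by (subst fd[OF x]) (simp add: linear_sum[OF lin] linear_scale[OF lin])
    ultimately show "((\<lambda>x. g (f x)) has_derivative (\<lambda>a. \<Sum>j\<in>J. c j (?f x a) *\<^sub>R ?g (f x) (b j))) (at x)"
      by simp
  next
    show "Ck_on k U (\<lambda>x. \<Sum>j\<in>J. c j (?f x a) *\<^sub>R ?g (f x) (b j))" for a
      by (intro Ck_on_sum Ck_on_scaleR Ck_on_bounded_linear[OF _ assms(5)] f(2) assms(1)
          Suc.IH g(2) Ck_on_Suc_imp[OF Suc.prems(1)])
  qed
qed

lemma Ck_on_compose_euclidean:
  fixes f :: "'a::real_normed_vector \<Rightarrow> 'b::euclidean_space"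
  assumes "open U" "open V" "f ` U \<subseteq> V" "Ck_on k U f" "Ck_on k V g"
  shows "Ck_on k U (\<lambda>x. g (f x))"
  by (rule Ck_on_compose[OF assms(1-3) finite_Basis, where c="\<lambda>j y. y \<bullet> j" and b="\<lambda>j. j"])
    (auto simp: assms euclidean_representation bounded_linear_inner_left)

lemma Ck_on_det:
  fixes M :: "'a::real_normed_vector \<Rightarrow> real^'n^'n"
  assumes "open U" "\<And>i j. Ck_on k U (\<lambda>x. M x $ i $ j)"
  shows "Ck_on k U (\<lambda>x. det (M x))"
  unfolding det_def
  by (intro Ck_on_sum Ck_on_mult Ck_on_const Ck_on_prod assms)

lemma Ck_on_vec:
  fixes f :: "'a::real_normed_vector \<Rightarrow> real^'n"
  assumes "open U" "\<And>i. Ck_on k U (\<lambda>x. f x $ i)"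
  shows "Ck_on k U f"
proof (rule Ck_on_cong[OF assms(1)])
  show "(\<Sum>i\<in>UNIV. (f x $ i) *\<^sub>R axis i 1) = f x" for x
    by (metis basis_expansion[of "f x"] scalar_mult_eq_scaleR)
  show "Ck_on k U (\<lambda>x. \<Sum>i\<in>UNIV. (f x $ i) *\<^sub>R axis i (1::real))"
    by (intro Ck_on_sum Ck_on_scaleR Ck_on_const assms)
qed

text \<open>Cramer's rule writes each component of \<open>u\<close> as a quotient of determinants of
  known entries, so matrix inversion need not be treated as a map of its own.\<close>

lemma Ck_on_solve:
  fixes M :: "'a::real_normed_vector \<Rightarrow> real^'n^'n"
  assumes "open U" "\<And>i j. Ck_on k U (\<lambda>x. M x $ i $ j)" "\<And>i. Ck_on k U (\<lambda>x. b x $ i)"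
    "\<And>x. x \<in> U \<Longrightarrow> det (M x) \<noteq> 0" "\<And>x. x \<in> U \<Longrightarrow> M x *v u x = b x"
  shows "Ck_on k U u"
proof (rule Ck_on_vec[OF assms(1)])
  fix l
  show "Ck_on k U (\<lambda>x. u x $ l)"
  proof (rule Ck_on_cong[OF assms(1)])
    show "det (\<chi> i j. if j = l then b x $ i else M x $ i $ j) * inverse (det (M x)) = u x $ l" if "x \<in> U" for x
      using assms(5)[OF that] unfolding cramer[OF assms(4)[OF that]] by (simp add: divide_inverse)
    show "Ck_on k U (\<lambda>x. det (\<chi> i j. if j = l then b x $ i else M x $ i $ j) * inverse (det (M x)))"
    proof (intro Ck_on_mult Ck_on_inverse Ck_on_det assms(1,2,4))
      show "Ck_on k U (\<lambda>x. (\<chi> i j. if j = l then b x $ i else M x $ i $ j) $ i $ j)" for i j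
        by (cases "j = l") (auto simp: assms)
    qed auto
  qed
qed

text \<open>Injectivity is assumed, so the inverse is global and only its regularity is at stake.
  Its derivative applied to a fixed vector solves a linear system whose matrix is the Jacobian of f
  at the inverse image; if the inverse is C^k, so are the entries and hence the solution, which
  gains one order.\<close>

lemma Ck_on_inverse_function:
  fixes f :: "real^'n \<Rightarrow> real^'n"
  assumes "open U" "\<And>k. Ck_on k U f" "inj_on f U"
    "\<And>x a. x \<in> U \<Longrightarrow> frechet_derivative f (at x) a = 0 \<Longrightarrow> a = 0"
  shows "open (f ` U) \<and> (\<forall>k. Ck_on k (f ` U) (inv_into U f))"
proof -
  let ?f = "\<lambda>x. frechet_derivative f (at x)" and ?g = "inv_into U f"
  have cf: "continuous_on U f" using assms(2)[of 0] by simp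
  have op: "open (f ` U)" by (rule invariance_of_domain[OF cf assms(1,3)])
  have fd: "(f has_derivative ?f x) (at x)" if "x \<in> U" for x
    using Ck_on_SucD(1)[OF assms(2)] that by blast
  have gU: "?g y \<in> U" "f (?g y) = y" if "y \<in> f ` U" for y
    using that by (auto simp: inv_into_into f_inv_into_f)
  have gd: "\<exists>g'. (?g has_derivative g') (at y) \<and> (\<forall>a. ?f (?g y) (g' a) = a)" if y: "y \<in> f ` U" for y
  proof -
    have lin: "linear (?f (?g y))" using fd[OF gU(1)[OF y]] has_derivative_linear by blast
    have "inj (?f (?g y))"
      unfolding linear_injective_0[OF lin] using assms(4)[OF gU(1)[OF y]] by blast
    then obtain g' where g': "linear g'" "g' \<circ> ?f (?g y) = id" "?f (?g y) \<circ> g' = id"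
      using linear_injective_isomorphism[OF lin] by (auto simp: o_def id_def fun_eq_iff)
    have "(?g has_derivative g') (at (f (?g y)))"
      by (rule has_derivative_inverse_strong[OF assms(1) gU(1)[OF y] cf _ fd[OF gU(1)[OF y]] g'(3)])
        (simp add: assms(3))
    then show ?thesis using g'(3) gU(2)[OF y] by (auto simp: fun_eq_iff)
  qed
  define G where "G y = (SOME g'. (?g has_derivative g') (at y) \<and> (\<forall>a. ?f (?g y) (g' a) = a))" for y
  have G: "(?g has_derivative G y) (at y)" "\<And>a. ?f (?g y) (G y a) = a" if "y \<in> f ` U" for y
    using someI_ex[OF gd[OF that]] unfolding G_def by blast+
  have "Ck_on k (f ` U) ?g" for k
  proof (induction k)
    case 0
    then show ?case
      unfolding Ck_on.simps
      by (intro continuous_at_imp_continuous_on ballI has_derivative_continuous[OF G(1)])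
  next
    case (Suc k)
    show ?case
    proof (rule Ck_on_SucI[OF op G(1)])
      fix a
      show "Ck_on k (f ` U) (\<lambda>y. G y a)"
      proof (rule Ck_on_solve[OF op, where M="\<lambda>y. matrix (?f (?g y))" and b="\<lambda>y. a"])
        fix i j
        have "Ck_on k (f ` U) (\<lambda>y. ?f (?g y) (axis j 1))"
          by (rule Ck_on_compose_euclidean[OF op assms(1) _ Suc.IH Ck_on_SucD(2)[OF assms(2)]])
            (auto simp: inv_into_into)
        then have "Ck_on k (f ` U) (\<lambda>y. ?f (?g y) (axis j 1) $ i)"
          by (rule Ck_on_bounded_linear[OF op bounded_linear_vec_nth])
        then show "Ck_on k (f ` U) (\<lambda>y. matrix (?f (?g y)) $ i $ j)"
          by (simp add: matrix_def)
      next
        fix y assume y: "y \<in> f ` U"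
        have lin: "linear (?f (?g y))" using fd[OF gU(1)[OF y]] has_derivative_linear by blast
        have mw: "matrix (?f (?g y)) *v b = ?f (?g y) b" for b
          using matrix_works lin by (simp add: linear_matrix_vector_mul_eq)
        show "matrix (?f (?g y)) *v G y a = a"
          by (simp add: mw G(2)[OF y])
        have "inj (?f (?g y))"
          unfolding linear_injective_0[OF lin] using assms(4)[OF gU(1)[OF y]] by blast
        then have "inj ((*v) (matrix (?f (?g y))))" by (simp add: mw inj_def)
        then have "invertible (matrix (?f (?g y)))"
          using matrix_left_invertible_injective invertible_left_inverse by blast
        then show "det (matrix (?f (?g y))) \<noteq> 0" by (simp add: invertible_det_nz)
      qed (auto intro: Ck_on_const op)
    qed
  qed
  with op show ?thesis by blast
qed

section \<open>Smoothness on arbitrary subsets\<close>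

lemma smooth_onI_global:
  assumes "open U" "A \<subseteq> U" "\<And>k. Ck_on k U F" "\<And>x. x \<in> A \<Longrightarrow> F x = f x"
  shows "smooth_on A f"
  unfolding smooth_on_def
proof
  fix x assume "x \<in> A"
  then show "\<exists>U F. open U \<and> x \<in> U \<and> (\<forall>k. Ck_on k U F) \<and> (\<forall>y\<in>U \<inter> A. F y = f y)"
    using assms by (intro exI[of _ U] exI[of _ F]) auto
qed

lemma smooth_onE:
  assumes "smooth_on A f" "x \<in> A"
  obtains U F where "open U" "x \<in> U" "\<forall>k. Ck_on k U F" "\<forall>y\<in>U \<inter> A. F y = f y"
  using assms unfolding smooth_on_def by (meson that)

lemma smooth_on_continuous_on:
  assumes "smooth_on A f" shows "continuous_on A f"
  unfolding continuous_on_eq_continuous_within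
proof
  fix x assume x: "x \<in> A"
  obtain U F where U: "open U" "x \<in> U" "\<forall>k. Ck_on k U F" "\<forall>y\<in>U \<inter> A. F y = f y"
    using assms x by (rule smooth_onE)
  note U = U(1,2) U(3)[rule_format] U(4)[rule_format, OF IntI]
  have "continuous_on U F" using U(3)[of 0] by simp
  then have "continuous (at x within A) F"
    using U(1,2) by (meson continuous_at_imp_continuous_at_within continuous_on_eq_continuous_at)
  then show "continuous (at x within A) f"
    by (rule continuous_transform_within_openin[where T=A and S="U \<inter> A"])
      (use U x in \<open>auto simp: Int_commute[of U] openin_open_Int\<close>)
qed

lemma smooth_on_cong:
  assumes "smooth_on A f" "\<And>x. x \<in> A \<Longrightarrow> f x = g x"
  shows "smooth_on A g"
  using assms unfolding smooth_on_def by (metis IntE)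

lemma smooth_on_subset: "smooth_on A f \<Longrightarrow> B \<subseteq> A \<Longrightarrow> smooth_on B f"
  unfolding smooth_on_def by (meson Int_mono order_refl subsetD)

lemma smooth_on_locally:
  assumes "\<And>x. x \<in> A \<Longrightarrow> \<exists>W. open W \<and> x \<in> W \<and> smooth_on (A \<inter> W) f"
  shows "smooth_on A f"
  unfolding smooth_on_def
proof
  fix x assume x: "x \<in> A"
  then obtain W where W: "open W" "x \<in> W" "smooth_on (A \<inter> W) f" using assms by blast
  have "x \<in> A \<inter> W" using x W by auto
  with W(3) obtain U F where U: "open U" "x \<in> U" "\<forall>k. Ck_on k U F" "\<forall>y\<in>U \<inter> (A \<inter> W). F y = f y"
    by (rule smooth_onE)
  note U = U(1,2) U(3)[rule_format] U(4)[rule_format, OF IntI]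
  have "Ck_on k (U \<inter> W) F" for k using U(3) Ck_on_subset by blast
  then show "\<exists>U F. open U \<and> x \<in> U \<and> (\<forall>k. Ck_on k U F) \<and> (\<forall>y\<in>U \<inter> A. F y = f y)"
    using U W by (intro exI[of _ "U \<inter> W"] exI[of _ F]) auto
qed

text \<open>A local extension F of f may leave the span of the \<open>b j\<close> outside A, and
  then the chain rule does not apply to it. It is replaced by its projection F' to this span, which
  agrees with f on A. Duality of \<open>c\<close> and \<open>b\<close> shows that F' satisfies the
  coordinate expansion that the chain rule asks for.\<close>

lemma smooth_on_compose:
  assumes f: "smooth_on A f" and g: "smooth_on B g" and AB: "f ` A \<subseteq> B"
    and J: "finite J" "\<And>j. j \<in> J \<Longrightarrow> bounded_linear (c j)"
      "\<And>x. x \<in> A \<Longrightarrow> f x = (\<Sum>j\<in>J. c j (f x) *\<^sub>R b j)"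
      "\<And>i j. i \<in> J \<Longrightarrow> j \<in> J \<Longrightarrow> c i (b j) = (if i = j then 1 else 0)"
  shows "smooth_on A (\<lambda>x. g (f x))"
  unfolding smooth_on_def
proof
  fix x assume x: "x \<in> A"
  obtain U F where U: "open U" "x \<in> U" "\<forall>k. Ck_on k U F" "\<forall>y\<in>U \<inter> A. F y = f y"
    using f x by (rule smooth_onE)
  note U = U(1,2) U(3)[rule_format] U(4)[rule_format, OF IntI]
  have "f x \<in> B" using x AB by auto
  with g obtain V G where V: "open V" "f x \<in> V" "\<forall>k. Ck_on k V G" "\<forall>y\<in>V \<inter> B. G y = g y"
    by (rule smooth_onE)
  note V = V(1,2) V(3)[rule_format] V(4)[rule_format, OF IntI]
  define F' where "F' y = (\<Sum>j\<in>J. c j (F y) *\<^sub>R b j)" for y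
  have F': "Ck_on k U F'" for k
    unfolding F'_def
    by (intro Ck_on_sum Ck_on_scaleR Ck_on_const Ck_on_bounded_linear[OF _ J(2)] U)
  have F'A: "F' y = f y" if "y \<in> U" "y \<in> A" for y
    unfolding F'_def using U(4)[OF that] J(3)[OF that(2)] by simp
  have cont: "continuous_on U F'" using F'[of 0] by simp
  define W where "W = U \<inter> F' -` V"
  have W: "open W" "x \<in> W" "W \<subseteq> U" "F' ` W \<subseteq> V"
    using continuous_open_preimage[OF cont U(1) V(1)] U(2) V(2) F'A[OF U(2) x] by (auto simp: W_def)
  have cF: "F' y = (\<Sum>j\<in>J. c j (F' y) *\<^sub>R b j)" for y
  proof -
    have "c i (F' y) = c i (F y)" if "i \<in> J" for i
    proof -
      interpret bounded_linear "c i" by (rule J(2)[OF that])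
      have "c i (F' y) = (\<Sum>j\<in>J. c j (F y) * (if i = j then 1 else 0))"
        unfolding F'_def by (simp add: sum scaleR J(4)[OF that] cong: sum.cong)
      also have "\<dots> = c i (F y)" using that J(1) by (simp add: sum.delta' if_distrib cong: if_cong)
      finally show ?thesis .
    qed
    then show ?thesis unfolding F'_def by (intro sum.cong) auto
  qed
  have "Ck_on k W (\<lambda>y. G (F' y))" for k
    by (rule Ck_on_compose[OF W(1) V(1) W(4) J(1,2) cF Ck_on_subset[OF F' W(3)] V(3)])
  moreover have "G (F' y) = g (f y)" if "y \<in> W \<inter> A" for y
  proof -
    have y: "y \<in> U" "y \<in> A" "F' y \<in> V" "f y \<in> B" using that W AB by auto
    show ?thesis using F'A[OF y(1,2)] V(4)[of "f y"] y(3,4) by simp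
  qed
  ultimately show "\<exists>U F. open U \<and> x \<in> U \<and> (\<forall>k. Ck_on k U F) \<and> (\<forall>y\<in>U \<inter> A. F y = g (f y))"
    using W by (intro exI[of _ W] exI[of _ "\<lambda>y. G (F' y)"]) auto
qed

lemma smooth_on_compose_euclidean:
  fixes f :: "'a::real_normed_vector \<Rightarrow> 'b::euclidean_space"
  assumes "smooth_on A f" "smooth_on B g" "f ` A \<subseteq> B"
  shows "smooth_on A (\<lambda>x. g (f x))"
proof (rule smooth_on_compose[OF assms finite_Basis])
  show "bounded_linear (\<lambda>y::'b. y \<bullet> j)" for j by (rule bounded_linear_inner_left)
  show "f x = (\<Sum>j\<in>Basis. (f x \<bullet> j) *\<^sub>R j)" for x by (rule euclidean_representation[symmetric])
qed (auto simp: inner_Basis)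

section \<open>The cone of a polytope at a vertex\<close>

text \<open>A point outside the relative interior lies on a facet, whose dimension is smaller; the
  descent through facets ends at the face sought.\<close>

lemma face_with_rel_interior_point:
  fixes S :: "'a::euclidean_space set"
  assumes "polytope S" "x \<in> S"
  obtains F where "F face_of S" "x \<in> rel_interior F"
  using assms
proof (induction "nat (aff_dim S + 1)" arbitrary: S thesis rule: less_induct)
  case less
  show thesis
  proof (cases "x \<in> rel_interior S")
    case True
    then show ?thesis
      using less.prems face_of_refl polytope_imp_convex by blast
  next
    case False
    then have "x \<in> \<Union> {F. F facet_of S}"
      using rel_boundary_of_polyhedron[OF polytope_imp_polyhedron[OF less.prems(2)]] less.prems(3) by blast
    then obtain F where F: "F facet_of S" "x \<in> F" by blast
    then have FS: "F face_of S" "aff_dim F = aff_dim S - 1" "F \<noteq> {}" by (auto simp: facet_of_def)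
    have "nat (aff_dim F + 1) < nat (aff_dim S + 1)"
      using FS(2,3) aff_dim_geq[of F] aff_dim_empty[of F] by linarith
    then obtain F' where F': "F' face_of F" "x \<in> rel_interior F'"
      using less.hyps[OF _ _ face_of_polytope_polytope[OF less.prems(2) FS(1)] F(2)] by metis
    show ?thesis by (rule less.prems(1)[OF face_of_trans[OF F'(1) FS(1)] F'(2)])
  qed
qed

text \<open>The directions of F form a space of dimension at least two, so the functional given by
  \<open>a\<close> has a nontrivial kernel on it.\<close>

lemma direction_in_hyperplane:
  fixes F :: "'a::euclidean_space set"
  assumes "aff_dim F \<ge> 2" "k \<in> F"
  obtains d where "d \<noteq> 0" "a \<bullet> d = 0" "\<And>s. k + s *\<^sub>R d \<in> affine hull F"
proof -
  have "F \<noteq> {k}" using assms by auto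
  then obtain x where x: "x \<in> F" "x \<noteq> k" using assms by blast
  have aff: "k + s *\<^sub>R (x - k) + t *\<^sub>R (y - k) \<in> affine hull F" if "y \<in> F" for s t y
  proof -
    have kF: "k \<in> affine hull F" using assms(2) hull_inc by fast
    have "x - k \<in> {y - k |y. y \<in> affine hull F}" "y - k \<in> {y - k |y. y \<in> affine hull F}"
      using x that hull_inc by fastforce+
    moreover have "subspace {y - k |y. y \<in> affine hull F}"
      using affine_diffs_subspace_subtract[OF affine_affine_hull kF]
      by (simp add: image_def Setcompr_eq_image)
    ultimately have "s *\<^sub>R (x - k) + t *\<^sub>R (y - k) \<in> {y - k |y. y \<in> affine hull F}"
      by (meson subspace_add subspace_scale)
    then obtain z where z: "z \<in> affine hull F" "s *\<^sub>R (x - k) + t *\<^sub>R (y - k) = z - k" by blast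
    have "k + s *\<^sub>R (x - k) + t *\<^sub>R (y - k) = z" using z(2) by (metis add.assoc add_diff_cancel_left' diff_add_cancel add.commute)
    with z(1) show ?thesis by simp
  qed
  show thesis
  proof (cases "a \<bullet> (x - k) = 0")
    case True
    show ?thesis
      by (rule that[of "x - k"]) (use True x aff[OF x(1), of _ 0] in auto)
  next
    case False
    have "\<not> F \<subseteq> affine hull {k, x}"
    proof
      assume "F \<subseteq> affine hull {k, x}"
      then have "aff_dim F \<le> 1"
        using aff_dim_subset[of F "affine hull {k, x}"] aff_dim_2[of k x] by (simp split: if_splits)
      with assms show False by simp
    qed
    then obtain y where y: "y \<in> F" "y \<notin> affine hull {k, x}" by blast
    \<comment> \<open>The combination of x - k and y - k that \<open>a\<close> annihilates. It is
      nonzero because y is off the line through k and x.\<close>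
    define d where "d = (a \<bullet> (x - k)) *\<^sub>R (y - k) - (a \<bullet> (y - k)) *\<^sub>R (x - k)"
    show ?thesis
    proof (rule that[of d])
      show "a \<bullet> d = 0" by (simp add: d_def inner_diff_right algebra_simps)
      show "k + s *\<^sub>R d \<in> affine hull F" for s
        using aff[OF y(1), of "- (s * (a \<bullet> (y - k)))" "s * (a \<bullet> (x - k))"]
        by (simp add: d_def algebra_simps)
      show "d \<noteq> 0"
      proof
        assume "d = 0"
        then have "(a \<bullet> (x - k)) *\<^sub>R (y - k) = (a \<bullet> (y - k)) *\<^sub>R (x - k)" by (simp add: d_def)
        then have "y - k = ((a \<bullet> (y - k)) / (a \<bullet> (x - k))) *\<^sub>R (x - k)"
          using False by (metis scaleR_one scaleR_scaleR divide_inverse_commute left_inverse)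
        then have "y = k + ((a \<bullet> (y - k)) / (a \<bullet> (x - k))) *\<^sub>R (x - k)"
          by (metis add_diff_cancel_left' diff_add_cancel add.commute)
        then show False using y(2) unfolding affine_hull_2_alt by blast
      qed
    qed
  qed
qed

text \<open>The vertex figure: a hyperplane separating \<open>q\<close> from the other vertices cuts \<open>Q\<close>
  in a polytope all of whose vertices lie on edges through \<open>q\<close>.\<close>

lemma polytope_subset_edge_cone:
  fixes Q :: "(real^'n) set"
  assumes Q: "polytope Q" and q: "q extreme_point_of Q"
    and u: "\<And>e. e \<in> edges_at Q q \<Longrightarrow> \<exists>t>0. e = closed_segment q (q + t *\<^sub>R u e)"
    and C: "convex C" "0 \<in> C" "\<And>x t. x \<in> C \<Longrightarrow> t \<ge> 0 \<Longrightarrow> t *\<^sub>R x \<in> C" "\<And>e. e \<in> edges_at Q q \<Longrightarrow> u e \<in> C"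
    and x: "x \<in> Q"
  shows "x - q \<in> C"
proof -
  have ph: "polyhedron Q" and co: "compact Q" and cv: "convex Q"
    using Q by (auto simp: polytope_imp_polyhedron polytope_imp_compact polytope_imp_convex)
  let ?V = "{x. x extreme_point_of Q}"
  have finV: "finite ?V" by (rule finite_polyhedron_extreme_points[OF ph])
  have hull: "Q = convex hull ?V" by (rule Krein_Milman_Minkowski[OF co cv])
  have qQ: "q \<in> Q" using q by (simp add: extreme_point_of_def)
  have "{q} exposed_face_of Q"
    using q exposed_face_of_polyhedron[OF ph] face_of_singleton by blast
  then obtain a b where ab: "\<And>y. y \<in> Q \<Longrightarrow> a \<bullet> y \<le> b" "{q} = Q \<inter> {y. a \<bullet> y = b}"
    unfolding exposed_face_of_def by blast
  have aq: "a \<bullet> q = b" using ab(2) by blast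
  have lt: "a \<bullet> y < b" if "y \<in> Q" "y \<noteq> q" for y
  proof -
    have "a \<bullet> y \<noteq> b" using ab(2) that by blast
    then show ?thesis using ab(1)[OF that(1)] by simp
  qed
  \<comment> \<open>A level strictly between the value b at q and the values at the other vertices;
    if there are none, any level below b serves.\<close>
  obtain \<beta> where \<beta>: "\<beta> < b" "\<And>y. y extreme_point_of Q \<Longrightarrow> y \<noteq> q \<Longrightarrow> a \<bullet> y < \<beta>"
  proof (cases "?V - {q} = {}")
    case True
    then show ?thesis using that[of "b - 1"] by auto
  next
    case False
    let ?m = "Max ((\<bullet>) a ` (?V - {q}))"
    have fi: "finite ((\<bullet>) a ` (?V - {q}))" "(\<bullet>) a ` (?V - {q}) \<noteq> {}" using finV False by auto
    have "?m \<in> (\<bullet>) a ` (?V - {q})" by (rule Max_in[OF fi])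
    then obtain m where m: "m extreme_point_of Q" "m \<noteq> q" "?m = a \<bullet> m" by blast
    then have "?m < b" using lt[of m] by (simp add: extreme_point_of_def)
    moreover have "a \<bullet> y \<le> ?m" if "y extreme_point_of Q" "y \<noteq> q" for y
      using that fi by (intro Max_ge) auto
    ultimately show ?thesis using that[of "(?m + b) / 2"] by fastforce
  qed
  define K where "K = Q \<inter> {y. a \<bullet> y = \<beta>}"
  have K: "compact K" "convex K"
    unfolding K_def using co cv by (auto intro: compact_Int_closed closed_hyperplane convex_Int convex_hyperplane)
  \<comment> \<open>The face F carrying k in its relative interior must be an edge through q. In
    dimension 2 or more k could move both ways inside the slice; in dimension 0 it would be a vertex
    on the level \<beta>, where there is none; and a face missing q has all its vertices below
    \<beta>.\<close>
  have Kext: "k - q \<in> C" if k: "k extreme_point_of K" for k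
  proof -
    have kK: "k \<in> Q" "a \<bullet> k = \<beta>" using k by (auto simp: extreme_point_of_def K_def)
    obtain F where F: "F face_of Q" "k \<in> rel_interior F"
      using face_with_rel_interior_point[OF Q kK(1)] by blast
    have kF: "k \<in> F" using F(2) rel_interior_subset by blast
    have FQ: "F \<subseteq> Q" using F(1) face_of_imp_subset by blast
    have "\<not> aff_dim F \<ge> 2"
    proof
      assume "aff_dim F \<ge> 2"
      then obtain d where d: "d \<noteq> 0" "a \<bullet> d = 0" "\<And>s. k + s *\<^sub>R d \<in> affine hull F"
        using direction_in_hyperplane[OF _ kF] by blast
      obtain r where r: "r > 0" "cball k r \<inter> affine hull F \<subseteq> F"
        using F(2) by (auto simp: mem_rel_interior_cball)
      let ?s = "r / norm d"
      have mem: "k + s *\<^sub>R d \<in> K" if "\<bar>s\<bar> \<le> ?s" for s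
      proof -
        have "\<bar>s\<bar> * norm d \<le> r" using that d(1) by (simp add: field_simps)
        then have "k + s *\<^sub>R d \<in> cball k r" by (simp add: dist_norm)
        then have "k + s *\<^sub>R d \<in> F" using r d(3) by blast
        then show ?thesis using FQ d(2) kK(2) by (auto simp: K_def inner_add_right)
      qed
      have s: "?s > 0" using r d by simp
      have "(k + (-?s) *\<^sub>R d) + (k + ?s *\<^sub>R d) = 2 *\<^sub>R k" by (simp add: scaleR_2)
      then have "midpoint (k + (-?s) *\<^sub>R d) (k + ?s *\<^sub>R d) = k" by (simp add: midpoint_def)
      moreover have "k + (-?s) *\<^sub>R d \<noteq> k + ?s *\<^sub>R d"
      proof
        assume "k + (-?s) *\<^sub>R d = k + ?s *\<^sub>R d"
        then have "-?s = ?s" using d(1) by (metis add_left_cancel scaleR_cancel_right)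
        then show False using r(1) d(1) by auto
      qed
      ultimately have "k \<in> open_segment (k + (-?s) *\<^sub>R d) (k + ?s *\<^sub>R d)"
        using midpoint_in_open_segment by metis
      moreover have "k + (-?s) *\<^sub>R d \<in> K" "k + ?s *\<^sub>R d \<in> K" by (rule mem, use r(1) in simp)+
      ultimately show False using k by (auto simp: extreme_point_of_def)
    qed
    moreover have "aff_dim F \<noteq> 0"
    proof
      assume "aff_dim F = 0"
      then obtain k' where "F = {k'}" unfolding aff_dim_eq_0 by blast
      then have "F = {k}" using kF by simp
      then have "k extreme_point_of Q" using F(1) face_of_singleton by blast
      then show False using \<beta>(1) \<beta>(2)[of k] kK(2) aq by (cases "k = q") auto
    qed
    moreover have "aff_dim F \<ge> 0" using kF by (metis aff_dim_negative_iff empty_iff not_less)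
    ultimately have dim1: "aff_dim F = 1" by linarith
    have "q \<in> F"
    proof (rule ccontr)
      assume qF: "q \<notin> F"
      have pF: "polytope F" using Q F(1) by (rule face_of_polytope_polytope)
      have hF: "F = convex hull {y. y extreme_point_of F}"
        by (rule Krein_Milman_Minkowski) (use pF polytope_imp_compact polytope_imp_convex in auto)
      have "{y. y extreme_point_of F} \<subseteq> {y. a \<bullet> y < \<beta>}"
      proof
        fix y assume "y \<in> {y. y extreme_point_of F}"
        then have "y extreme_point_of Q" "y \<in> F" using extreme_point_of_face[OF F(1)] by auto
        then show "y \<in> {y. a \<bullet> y < \<beta>}" using \<beta>(2) qF by auto
      qed
      then have "F \<subseteq> {y. a \<bullet> y < \<beta>}"
        using hull_minimal[of "{y. y extreme_point_of F}" "{y. a \<bullet> y < \<beta>}" convex]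
          convex_halfspace_lt[of a \<beta>] hF by auto
      then show False using kF kK(2) by auto
    qed
    then have e: "F \<in> edges_at Q q" using F(1) dim1 by (simp add: edges_at_def edge_of_def)
    then obtain t w where t: "t > 0" "F = closed_segment q (q + t *\<^sub>R w)" and w: "w = u F"
      using u by blast
    have "k \<in> closed_segment q (q + t *\<^sub>R w)" using kF t(2) by simp
    then obtain s where s: "s \<ge> 0" "k = (1 - s) *\<^sub>R q + s *\<^sub>R (q + t *\<^sub>R w)"
      by (auto simp: in_segment)
    have "k - q = (s * t) *\<^sub>R w" unfolding s(2) by (simp add: algebra_simps)
    then show ?thesis using C(3)[OF C(4)[OF e], of "s * t"] s(1) t(1) w by simp
  qed
  have "{y. y - q \<in> C} = (+) q ` C" by (auto simp: image_iff algebra_simps intro!: bexI[of _ "_ - q"])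
  then have cC: "convex {y. y - q \<in> C}" using C(1) convex_translation by metis
  have Ksub: "K \<subseteq> {y. y - q \<in> C}"
  proof -
    have "convex hull {k. k extreme_point_of K} \<subseteq> {y. y - q \<in> C}"
      by (intro hull_minimal) (use Kext cC in auto)
    then show ?thesis using Krein_Milman_Minkowski[OF K] by simp
  qed
  have ext: "y - q \<in> C" if y: "y extreme_point_of Q" for y
  proof (cases "y = q")
    case True then show ?thesis using C(2) by simp
  next
    case False
    have yQ: "y \<in> Q" using y by (simp add: extreme_point_of_def)
    have ay: "a \<bullet> y < \<beta>" using \<beta>(2) y False by blast
    \<comment> \<open>The parameter at which the segment from q to y crosses the slice K.\<close>
    define t where "t = (b - \<beta>) / (b - a \<bullet> y)"
    have t: "0 < t" "t < 1" using ay \<beta>(1) by (auto simp: t_def field_simps)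
    have at: "t * (b - a \<bullet> y) = b - \<beta>" using ay \<beta>(1) by (simp add: t_def)
    have "(1 - t) *\<^sub>R q + t *\<^sub>R y \<in> Q" by (rule convexD_alt[OF cv qQ yQ]) (use t in auto)
    moreover have "a \<bullet> ((1 - t) *\<^sub>R q + t *\<^sub>R y) = \<beta>"
      using at by (simp add: inner_add_right aq algebra_simps)
    ultimately have "(1 - t) *\<^sub>R q + t *\<^sub>R y - q \<in> C" using Ksub by (auto simp: K_def)
    then have "t *\<^sub>R (y - q) \<in> C" by (simp add: algebra_simps)
    from C(3)[OF this, of "inverse t"] show ?thesis using t by simp
  qed
  have "convex hull ?V \<subseteq> {y. y - q \<in> C}"
    by (intro hull_minimal) (use ext cC in auto)
  then show ?thesis using x hull by blast
qed

section \<open>Facets and vertices of Delzant polytopes\<close>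

lemma int_lattice_inner: "x \<in> int_lattice \<Longrightarrow> y \<in> int_lattice \<Longrightarrow> x \<bullet> y \<in> \<int>"
  by (auto simp: int_lattice_def inner_vec_def intro!: Ints_sum Ints_mult)

lemma axis_int_lattice: "axis i 1 \<in> int_lattice"
  by (auto simp: int_lattice_def axis_def)

lemma lattice_basis_coeffs:
  fixes B :: "(real^'n) set"
  assumes "lattice_basis B" "x \<in> int_lattice"
  obtains c :: "real^'n \<Rightarrow> int" where "x = (\<Sum>b\<in>B. of_int (c b) *\<^sub>R b)"
proof -
  have "\<forall>x\<in>int_lattice. \<exists>c :: real^'n \<Rightarrow> int. x = (\<Sum>b\<in>B. of_int (c b) *\<^sub>R b)"
    using assms(1) by (simp add: lattice_basis_def)
  from bspec[OF this assms(2)] that show thesis by blast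
qed

lemma lattice_basis_span:
  assumes "lattice_basis B" shows "span B = (UNIV :: (real^'n) set)"
proof -
  have ax: "axis i 1 \<in> span B" for i
  proof -
    obtain c :: "real^'n \<Rightarrow> int" where c: "axis i 1 = (\<Sum>b\<in>B. of_int (c b) *\<^sub>R b)"
      using lattice_basis_coeffs[OF assms axis_int_lattice] .
    show ?thesis unfolding c by (intro span_sum span_scale span_base)
  qed
  have "x \<in> span B" for x :: "real^'n"
  proof -
    have "x = (\<Sum>i\<in>UNIV. x $ i *\<^sub>R axis i 1)"
      using basis_expansion[of x] by (simp add: scalar_mult_eq_scaleR)
    moreover have "(\<Sum>i\<in>UNIV. x $ i *\<^sub>R axis i 1) \<in> span B"
      by (intro span_sum span_scale ax)
    ultimately show ?thesis by metis
  qed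
  then show ?thesis by blast
qed

text \<open>Edge directions \<open>B\<close> at the vertex \<open>q\<close> together with their dual basis \<open>d\<close>.\<close>

definition vertex_frame :: "(real^'n) set \<Rightarrow> real^'n \<Rightarrow> (real^'n) set \<Rightarrow> (real^'n \<Rightarrow> real^'n) \<Rightarrow> bool" where
  "vertex_frame Q q B d \<longleftrightarrow> finite B \<and> card B = CARD('n) \<and> B \<subseteq> int_lattice \<and> d ` B \<subseteq> int_lattice \<and>
     (\<forall>b\<in>B. \<forall>b'\<in>B. b \<bullet> d b' = (if b = b' then 1 else 0)) \<and>
     (\<forall>x. x = (\<Sum>b\<in>B. (x \<bullet> d b) *\<^sub>R b)) \<and>
     (\<forall>x\<in>Q. \<forall>b\<in>B. 0 \<le> (x - q) \<bullet> d b) \<and> (\<forall>b\<in>B. \<exists>t>0. q + t *\<^sub>R b \<in> Q)"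

text \<open>A spanning set of n vectors is a basis, so a dual basis exists. Its components are the
  coefficients of the unit vectors in the lattice basis, hence integers. The inequalities for Q hold
  because the edge directions satisfy them and Q lies in the edge cone.\<close>

lemma delzant_vertex_frame:
  fixes Q :: "(real^'n) set"
  assumes "delzant Q" "q extreme_point_of Q"
  obtains B d where "vertex_frame Q q B d"
proof -
  obtain u where Q: "polytope Q" and cE: "card (edges_at Q q) = CARD('n)"
    and u: "\<And>e. e \<in> edges_at Q q \<Longrightarrow> \<exists>t>0. e = closed_segment q (q + t *\<^sub>R u e)"
    and lb: "lattice_basis (u ` edges_at Q q)"
    using assms unfolding delzant_def by blast
  define B where "B = u ` edges_at Q q"
  have fE: "finite (edges_at Q q)" using cE by (metis card.infinite zero_less_card_finite less_irrefl)
  have fB: "finite B" using fE by (simp add: B_def)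
  have BI: "B \<subseteq> int_lattice" using lb by (simp add: B_def lattice_basis_def)
  have sp: "span B = UNIV" using lattice_basis_span lb by (simp add: B_def)
  have "card B \<le> CARD('n)" using card_image_le[OF fE, of u] cE by (simp add: B_def)
  moreover have "CARD('n) \<le> card B"
    using dim_le_card[OF _ fB, of UNIV] sp by (simp add: dim_UNIV)
  ultimately have cB: "card B = CARD('n)" by simp
  have ind: "independent B"
    by (rule card_le_dim_spanning[of B UNIV]) (use sp fB cB in \<open>auto simp: dim_UNIV\<close>)
  have "\<exists>a. \<forall>b'\<in>B. b' \<bullet> a = (if b' = b then 1 else 0)" for b
  proof -
    obtain g :: "real^'n \<Rightarrow> real" where g: "linear g" "\<And>b'. b' \<in> B \<Longrightarrow> g b' = (if b' = b then 1 else 0)"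
      using linear_independent_extend[OF ind, of "\<lambda>b'. if b' = b then 1 else 0"] by blast
    have "x \<bullet> adjoint g 1 = g x" for x using adjoint_works[OF g(1), of x 1] by simp
    then have "\<forall>b'\<in>B. b' \<bullet> adjoint g 1 = (if b' = b then 1 else 0)" using g(2) by simp
    then show ?thesis by blast
  qed
  then obtain d where d: "\<And>b b'. b' \<in> B \<Longrightarrow> b' \<bullet> d b = (if b' = b then 1 else 0)" by metis
  have coef: "(\<Sum>b'\<in>B. c b' *\<^sub>R b') \<bullet> d b = c b" if "b \<in> B" for c b
  proof -
    have "(\<Sum>b'\<in>B. c b' *\<^sub>R b') \<bullet> d b = (\<Sum>b'\<in>B. if b' = b then c b' else 0)"
      unfolding inner_sum_left by (intro sum.cong) (auto simp: d)
    then show ?thesis using fB that by simp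
  qed
  have dI: "d b \<in> int_lattice" if b: "b \<in> B" for b
    unfolding int_lattice_def
  proof (intro CollectI allI)
    fix i
    obtain c :: "real^'n \<Rightarrow> int" where c: "axis i 1 = (\<Sum>b\<in>B. of_int (c b) *\<^sub>R b)"
      using lattice_basis_coeffs[OF lb axis_int_lattice] unfolding B_def .
    have "d b $ i = axis i 1 \<bullet> d b" by (simp add: inner_axis')
    also have "\<dots> = of_int (c b)" unfolding c by (rule coef[OF b])
    finally show "d b $ i \<in> \<int>" by simp
  qed
  have ex: "x = (\<Sum>b\<in>B. (x \<bullet> d b) *\<^sub>R b)" for x
  proof -
    have "x \<in> span B" using sp by simp
    then obtain c where c: "x = (\<Sum>b\<in>B. c b *\<^sub>R b)" using span_finite[OF fB] by auto
    have "x \<bullet> d b = c b" if "b \<in> B" for b unfolding c by (rule coef[OF that])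
    then have "(\<Sum>b\<in>B. (x \<bullet> d b) *\<^sub>R b) = (\<Sum>b\<in>B. c b *\<^sub>R b)" by (intro sum.cong) auto
    then show ?thesis using c by simp
  qed
  have cone: "x - q \<in> {y. \<forall>b\<in>B. 0 \<le> y \<bullet> d b}" if "x \<in> Q" for x
  proof (rule polytope_subset_edge_cone[OF Q assms(2) u _ _ _ _ that])
    show "convex {y. \<forall>b\<in>B. 0 \<le> y \<bullet> d b}"
      by (auto simp: convex_def inner_add_left)
    show "u e \<in> {y. \<forall>b\<in>B. 0 \<le> y \<bullet> d b}" if "e \<in> edges_at Q q" for e
    proof -
      have "u e \<in> B" using that by (simp add: B_def)
      then show ?thesis by (auto simp: d)
    qed
  qed auto
  have edge: "\<exists>t>0. q + t *\<^sub>R b \<in> Q" if b: "b \<in> B" for b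
  proof -
    obtain e where e: "e \<in> edges_at Q q" "b = u e" using b by (auto simp: B_def)
    obtain t where t: "t > 0" "e = closed_segment q (q + t *\<^sub>R b)" using u[OF e(1)] e(2) by blast
    have "e \<subseteq> Q" using e(1) by (auto simp: edges_at_def dest: edge_of_imp_subset)
    then have "q + t *\<^sub>R b \<in> Q" using t(2) by auto
    then show ?thesis using t(1) by blast
  qed
  have "vertex_frame Q q B d"
    unfolding vertex_frame_def using fB cB BI dI d ex cone edge by auto
  then show thesis by (rule that)
qed

lemma vertex_frameD:
  fixes Q :: "(real^'n) set"
  assumes "vertex_frame Q q B d"
  shows "finite B" "card B = CARD('n)" "B \<subseteq> int_lattice" "\<And>b. b \<in> B \<Longrightarrow> d b \<in> int_lattice"
    "\<And>b b'. b \<in> B \<Longrightarrow> b' \<in> B \<Longrightarrow> b \<bullet> d b' = (if b = b' then 1 else 0)"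
    "\<And>x. (\<Sum>b\<in>B. (x \<bullet> d b) *\<^sub>R b) = x"
    "\<And>x b. x \<in> Q \<Longrightarrow> b \<in> B \<Longrightarrow> q \<bullet> d b \<le> x \<bullet> d b"
    "\<And>b. b \<in> B \<Longrightarrow> \<exists>t>0. q + t *\<^sub>R b \<in> Q"
    "inj_on d B"
proof -
  show "inj_on d B"
    using assms unfolding vertex_frame_def by (intro inj_onI) (metis zero_neq_one)
qed (use assms in \<open>auto simp: vertex_frame_def inner_diff_left image_subset_iff\<close>)

lemma vertex_frame_dual_expansion:
  assumes "vertex_frame Q q B d"
  shows "(\<Sum>b\<in>B. (b \<bullet> a) *\<^sub>R d b) = a"
proof -
  have "y \<bullet> (\<Sum>b\<in>B. (b \<bullet> a) *\<^sub>R d b) = y \<bullet> a" for y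
  proof -
    have "y \<bullet> (\<Sum>b\<in>B. (b \<bullet> a) *\<^sub>R d b) = (\<Sum>b\<in>B. (y \<bullet> d b) *\<^sub>R b) \<bullet> a"
      by (simp add: inner_sum_left inner_sum_right mult.commute)
    then show ?thesis by (simp add: vertex_frameD(6)[OF assms])
  qed
  then show ?thesis by (metis vector_eq_ldot)
qed

text \<open>Pairing with b turns d b = k w into 1 = k (b . w), an equation between integers.\<close>

lemma vertex_frame_primitive:
  assumes "vertex_frame Q q B d" "b \<in> B"
  shows "primitive (d b)"
  unfolding primitive_def
proof (intro conjI ballI allI impI)
  show "d b \<in> int_lattice" by (rule vertex_frameD(4)[OF assms])
next
  fix w and k :: int
  assume w: "w \<in> int_lattice" "d b = of_int k *\<^sub>R w"
  have "b \<in> int_lattice" using vertex_frameD(3)[OF assms(1)] assms(2) by blast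
  then obtain m :: int where m: "b \<bullet> w = of_int m" using int_lattice_inner[OF _ w(1)] Ints_cases by metis
  have "1 = b \<bullet> d b" using vertex_frameD(5)[OF assms(1) assms(2) assms(2)] by simp
  also have "\<dots> = of_int (k * m)" by (simp add: w(2) m)
  finally have "k * m = 1" by (metis of_int_eq_1_iff)
  then show "\<bar>k\<bar> = 1" using zmult_eq_1_iff by auto
qed

text \<open>The vectors of Z are independent by duality, and up to scaling they are differences of
  points of F.\<close>

lemma vertex_frame_aff_dim_ge:
  fixes Q :: "(real^'n) set"
  assumes vf: "vertex_frame Q q B d" and "q \<in> F" "Z \<subseteq> B" "\<And>b. b \<in> Z \<Longrightarrow> \<exists>t>0. q + t *\<^sub>R b \<in> F"
  shows "int (card Z) \<le> aff_dim F"
proof -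
  let ?S = "(+) (- q) ` F"
  have fZ: "finite Z" using vertex_frameD(1)[OF vf] assms(3) finite_subset by blast
  have "b \<in> span ?S" if "b \<in> Z" for b
  proof -
    obtain t where t: "t > 0" "q + t *\<^sub>R b \<in> F" using assms(4) \<open>b \<in> Z\<close> by blast
    have "t *\<^sub>R b \<in> ?S" using t(2) by (force intro: image_eqI[of _ _ "q + t *\<^sub>R b"])
    then have "inverse t *\<^sub>R (t *\<^sub>R b) \<in> span ?S" by (intro span_scale span_base)
    then show ?thesis using t(1) by simp
  qed
  then have sub: "Z \<subseteq> span ?S" by blast
  have ind: "independent Z"
    unfolding independent_explicit_finite_subsets
  proof (intro allI impI ballI)
    fix A c b assume A: "A \<subseteq> Z" "finite A" "(\<Sum>v\<in>A. c v *\<^sub>R v) = 0" "b \<in> A"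
    have dual: "v \<bullet> d b = (if v = b then 1 else 0)" if "v \<in> A" for v
      by (rule vertex_frameD(5)[OF vf]) (use that A assms(3) in auto)
    have "0 = (\<Sum>v\<in>A. c v *\<^sub>R v) \<bullet> d b" using A(3) by simp
    also have "\<dots> = (\<Sum>v\<in>A. if v = b then c v else 0)"
      unfolding inner_sum_left
      by (intro sum.cong refl) (simp add: dual)
    also have "\<dots> = c b" using A by simp
    finally show "c b = 0" by simp
  qed
  have "card Z = dim Z" using ind by (simp add: dim_eq_card_independent)
  also have "\<dots> \<le> dim ?S" using dim_subset[OF sub] by (simp add: dim_span)
  finally have "card Z \<le> dim ?S" .
  moreover have "aff_dim F = int (dim ?S)"
    by (rule aff_dim_eq_dim) (use assms(2) hull_inc in fast)
  ultimately show ?thesis by simp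
qed

lemma delzantD:
  fixes Q :: "(real^'n) set"
  assumes "delzant Q"
  shows "polytope Q" "polyhedron Q" "compact Q" "convex Q" "closed Q" "aff_dim Q = int CARD('n)" "Q \<noteq> {}"
  using assms polytope_imp_polyhedron polytope_imp_compact polytope_imp_convex polytope_imp_closed
  by (auto simp: delzant_def)

text \<open>The supporting hyperplane contains q and an initial piece of each of the n - 1 edges
  other than b, which forces dimension at least n - 1; the edge along b leaves it, so the face is
  proper.\<close>

lemma vertex_frame_cuts_facet:
  fixes Q :: "(real^'n) set"
  assumes Q: "delzant Q" and q: "q \<in> Q" and vf: "vertex_frame Q q B d" and b: "b \<in> B"
  shows "cuts_facet Q (d b) (q \<bullet> d b)"
proof -
  let ?F = "Q \<inter> {x. x \<bullet> d b = q \<bullet> d b}"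
  have ge: "q \<bullet> d b \<le> x \<bullet> d b" if "x \<in> Q" for x using vertex_frameD(7)[OF vf that b] .
  have F: "?F face_of Q"
    using face_of_Int_supporting_hyperplane_ge[OF delzantD(4)[OF Q], of "q \<bullet> d b" "d b"] ge
    by (simp add: inner_commute)
  obtain t where t: "t > 0" "q + t *\<^sub>R b \<in> Q" using vertex_frameD(8)[OF vf b] by blast
  have "q + t *\<^sub>R b \<notin> ?F" using t vertex_frameD(5)[OF vf b b] by (simp add: inner_add_left)
  then have "?F \<noteq> Q" using t by blast
  then have lt: "aff_dim ?F < aff_dim Q" by (rule face_of_aff_dim_lt[OF delzantD(4)[OF Q] F])
  have "int (card (B - {b})) \<le> aff_dim ?F"
  proof (rule vertex_frame_aff_dim_ge[OF vf])
    fix b' assume b': "b' \<in> B - {b}"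
    then obtain t where t: "t > 0" "q + t *\<^sub>R b' \<in> Q" using vertex_frameD(8)[OF vf] by blast
    moreover have "b' \<bullet> d b = 0" using vertex_frameD(5)[OF vf _ b, of b'] b' by auto
    ultimately show "\<exists>t>0. q + t *\<^sub>R b' \<in> ?F" by (auto simp: inner_add_left)
  qed (use q in auto)
  moreover have "int (card (B - {b})) = int CARD('n) - 1"
  proof -
    have "card (B - {b}) + 1 = card B"
      using card_Suc_Diff1[OF vertex_frameD(1)[OF vf] b] by simp
    then show ?thesis using vertex_frameD(2)[OF vf] by linarith
  qed
  ultimately have "aff_dim ?F = aff_dim Q - 1" using lt delzantD(6)[OF Q] by linarith
  then show ?thesis
    unfolding cuts_facet_def facet_of_def using F q ge by auto
qed

text \<open>On the facet a sum of nonnegative terms (y . d b)(b . a) vanishes, so its directions lie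
  in the span of the edge directions orthogonal to \<open>a\<close>. The dimension n - 1 leaves
  exactly one b with positive pairing, and the dual expansion of \<open>a\<close> collapses to one
  term.\<close>

lemma vertex_frame_facet_normal:
  fixes Q :: "(real^'n) set"
  assumes Q: "delzant Q" and vf: "vertex_frame Q q B d" and cut: "cuts_facet Q a (q \<bullet> a)" and q: "q \<in> Q"
  obtains b s where "b \<in> B" "s > 0" "a = s *\<^sub>R d b"
proof -
  let ?F = "Q \<inter> {x. x \<bullet> a = q \<bullet> a}"
  have ge: "q \<bullet> a \<le> x \<bullet> a" if "x \<in> Q" for x using cut that by (auto simp: cuts_facet_def)
  have dimF: "aff_dim ?F = int CARD('n) - 1"
    using cut delzantD(6)[OF Q] by (auto simp: cuts_facet_def facet_of_def)
  have nn: "b \<bullet> a \<ge> 0" if "b \<in> B" for b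
  proof -
    obtain t where t: "t > 0" "q + t *\<^sub>R b \<in> Q" using vertex_frameD(8)[OF vf \<open>b \<in> B\<close>] by blast
    then have "0 \<le> t * (b \<bullet> a)" using ge[OF t(2)] by (simp add: inner_add_left)
    then show ?thesis using t(1) by (simp add: zero_le_mult_iff)
  qed
  define Z where "Z = {b \<in> B. b \<bullet> a = 0}"
  have fZ: "finite Z" "Z \<subseteq> B" using vertex_frameD(1)[OF vf] by (auto simp: Z_def)
  have qF: "q \<in> ?F" using q by simp
  have "(+) (- q) ` ?F \<subseteq> span Z"
  proof
    fix y assume "y \<in> (+) (- q) ` ?F"
    then have y: "q + y \<in> Q" "(q + y) \<bullet> a = q \<bullet> a" by auto
    have "0 = y \<bullet> a" using y(2) by (simp add: inner_add_left)
    also have "y \<bullet> a = (\<Sum>b\<in>B. (y \<bullet> d b) * (b \<bullet> a))"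
      by (subst vertex_frameD(6)[OF vf, of y, symmetric]) (simp add: inner_sum_left)
    finally have sum0: "(\<Sum>b\<in>B. (y \<bullet> d b) * (b \<bullet> a)) = 0" by simp
    have yd: "y \<bullet> d b \<ge> 0" if "b \<in> B" for b
      using vertex_frameD(7)[OF vf y(1) that] by (simp add: inner_add_left)
    have nnz: "0 \<le> (y \<bullet> d b) * (b \<bullet> a)" if "b \<in> B" for b using yd nn that by simp
    have z: "(y \<bullet> d b) * (b \<bullet> a) = 0" if "b \<in> B" for b
      using iffD1[OF sum_nonneg_eq_0_iff[OF vertex_frameD(1)[OF vf] nnz] sum0] that by blast
    have "(y \<bullet> d b) *\<^sub>R b \<in> span Z" if "b \<in> B" for b
    proof (cases "b \<bullet> a = 0")
      case True
      then have "b \<in> Z" using that by (simp add: Z_def)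
      then show ?thesis by (intro span_scale span_base)
    next
      case False
      then have "y \<bullet> d b = 0" using z[OF that] by simp
      then show ?thesis by (simp add: span_zero)
    qed
    then have "(\<Sum>b\<in>B. (y \<bullet> d b) *\<^sub>R b) \<in> span Z" by (intro span_sum)
    then show "y \<in> span Z" by (simp add: vertex_frameD(6)[OF vf])
  qed
  then have "dim ((+) (- q) ` ?F) \<le> card Z" by (rule dim_le_card[OF _ fZ(1)])
  moreover have "aff_dim ?F = int (dim ((+) (- q) ` ?F))"
    by (rule aff_dim_eq_dim[OF hull_inc[OF qF]])
  ultimately have cZ: "int (card Z) \<ge> int CARD('n) - 1" using dimF by linarith
  have "Z \<noteq> B"
  proof
    assume "Z = B"
    then have "b \<bullet> a = 0" if "b \<in> B" for b using that by (auto simp: Z_def)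
    then have "(\<Sum>b\<in>B. (b \<bullet> a) *\<^sub>R d b) = 0" by simp
    then have "a = 0" using vertex_frame_dual_expansion[OF vf, of a] by simp
    then have "?F = Q" by auto
    then show False using dimF delzantD(6)[OF Q] by simp
  qed
  then have "card Z < card B" using fZ psubset_card_mono vertex_frameD(1)[OF vf] by blast
  then have "card (B - Z) = 1"
    using cZ vertex_frameD(2)[OF vf] card_Diff_subset[OF fZ] by linarith
  then obtain b where b: "B - Z = {b}" using card_1_singletonE by blast
  have "(\<Sum>b'\<in>B. (b' \<bullet> a) *\<^sub>R d b') = (\<Sum>b'\<in>{b}. (b' \<bullet> a) *\<^sub>R d b')"
    by (rule sum.mono_neutral_right) (use vertex_frameD(1)[OF vf] b in \<open>auto simp: Z_def\<close>)
  then have "a = (b \<bullet> a) *\<^sub>R d b" using vertex_frame_dual_expansion[OF vf, of a] by simp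
  moreover have "b \<in> B - Z" using b by blast
  then have "b \<in> B" "b \<bullet> a \<noteq> 0" by (auto simp: Z_def)
  with nn[of b] have "b \<in> B" "b \<bullet> a > 0" by auto
  ultimately show thesis using that by blast
qed

lemma cuts_facet_unique:
  assumes "cuts_facet Q v c" "cuts_facet Q v c'" shows "c = c'"
proof -
  have "c \<le> c'" if c: "cuts_facet Q v c" "cuts_facet Q v c'" for c c'
  proof -
    have "Q \<inter> {x. x \<bullet> v = c'} \<noteq> {}" using c(2) by (auto simp: cuts_facet_def facet_of_def)
    then show ?thesis using c(1) by (auto simp: cuts_facet_def)
  qed
  then show ?thesis using assms by (simp add: antisym)
qed

definition offset :: "(real^'n) set \<Rightarrow> real^'n \<Rightarrow> real" where
  "offset Q v = (THE c. cuts_facet Q v c)"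

lemma facet_fun_offset: "facet_fun Q v x = x \<bullet> v - offset Q v"
  by (simp add: facet_fun_def offset_def)

lemma offset_eq: "cuts_facet Q v c \<Longrightarrow> offset Q v = c"
  unfolding offset_def by (rule the_equality) (auto intro: cuts_facet_unique)

lemma normals_cuts_facet: "v \<in> normals Q \<Longrightarrow> cuts_facet Q v (offset Q v)"
  using offset_eq by (auto simp: normals_def)

lemma facet_fun_nonneg: "v \<in> normals Q \<Longrightarrow> x \<in> Q \<Longrightarrow> 0 \<le> facet_fun Q v x"
  using normals_cuts_facet[of v Q] by (auto simp: facet_fun_offset cuts_facet_def)

definition normals_at :: "(real^'n) set \<Rightarrow> real^'n \<Rightarrow> (real^'n) set" where
  "normals_at Q q = {v \<in> normals Q. facet_fun Q v q = 0}"

text \<open>A facet normal at q is s times some d b with s > 0. Pairing with b shows that s is an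
  integer, and primitivity gives s = 1.\<close>

lemma vertex_frame_normals_at:
  assumes Q: "delzant Q" and q: "q \<in> Q" and vf: "vertex_frame Q q B d"
  shows "normals_at Q q = d ` B"
proof (intro equalityI subsetI)
  fix v assume v: "v \<in> normals_at Q q"
  then have vn: "v \<in> normals Q" "offset Q v = q \<bullet> v" by (auto simp: normals_at_def facet_fun_offset)
  then have cut: "cuts_facet Q v (q \<bullet> v)" using normals_cuts_facet by metis
  obtain b s where b: "b \<in> B" "s > 0" "v = s *\<^sub>R d b"
    using vertex_frame_facet_normal[OF Q vf cut q] by blast
  have "v \<in> int_lattice" using vn(1) by (auto simp: normals_def primitive_def)
  moreover have "b \<in> int_lattice" using b(1) vertex_frameD(3)[OF vf] by blast
  ultimately obtain k :: int where k: "b \<bullet> v = of_int k" using int_lattice_inner Ints_cases by metis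
  have "b \<bullet> v = s" using b vertex_frameD(5)[OF vf b(1) b(1)] by simp
  then have s: "s = of_int k" using k by simp
  have "\<bar>k\<bar> = 1"
    using vn(1) vertex_frameD(4)[OF vf b(1)] b(3) s unfolding normals_def primitive_def by blast
  then have "v = d b" using b s by auto
  then show "v \<in> d ` B" using b(1) by blast
next
  fix v assume "v \<in> d ` B"
  then obtain b where b: "b \<in> B" "v = d b" by blast
  have cut: "cuts_facet Q v (q \<bullet> v)" using vertex_frame_cuts_facet[OF Q q vf b(1)] b(2) by simp
  then show "v \<in> normals_at Q q"
    using vertex_frame_primitive[OF vf b(1)] b(2) offset_eq[OF cut]
    by (auto simp: normals_at_def normals_def facet_fun_offset)
qed

definition facet_at :: "(real^'n) set \<Rightarrow> real^'n \<Rightarrow> (real^'n) set" where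
  "facet_at Q v = Q \<inter> {x. x \<bullet> v = offset Q v}"

lemma facet_at_facet_of: "v \<in> normals Q \<Longrightarrow> facet_at Q v facet_of Q"
  using normals_cuts_facet by (auto simp: facet_at_def cuts_facet_def)

lemma face_has_vertex:
  fixes Q :: "(real^'n) set"
  assumes "compact Q" "convex Q" "F face_of Q" "F \<noteq> {}"
  obtains q where "q extreme_point_of Q" "q \<in> F" "q \<in> Q"
proof -
  have "compact F" "convex F" using assms face_of_imp_compact face_of_imp_convex by blast+
  then obtain q where "q extreme_point_of F" using extreme_point_exists_convex assms(4) by blast
  then have "q extreme_point_of Q" "q \<in> F" using extreme_point_of_face[OF assms(3)] by auto
  then show thesis using that assms(3) face_of_imp_subset by blast
qed

lemma normals_vertex:
  assumes "delzant Q" "v \<in> normals Q"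
  obtains q where "q extreme_point_of Q" "q \<in> Q" "v \<in> normals_at Q q"
proof -
  have F: "facet_at Q v facet_of Q" by (rule facet_at_facet_of[OF assms(2)])
  obtain q where "q extreme_point_of Q" "q \<in> facet_at Q v" "q \<in> Q"
    using F face_has_vertex[OF delzantD(3,4)[OF assms(1)], of "facet_at Q v"] by (auto simp: facet_of_def)
  then show thesis using that assms(2) by (auto simp: facet_at_def normals_at_def facet_fun_offset)
qed

text \<open>The facet comes with a real normal vector only. At a vertex of the facet this is a
  multiple of a dual basis vector, which is primitive and cuts the same facet.\<close>

lemma facet_of_delzant:
  assumes Q: "delzant Q" and F: "F facet_of Q"
  obtains v where "v \<in> normals Q" "F = facet_at Q v"
proof -
  obtain a c where ac: "Q \<subseteq> {x. a \<bullet> x \<le> c}" "F = Q \<inter> {x. a \<bullet> x = c}"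
    using facet_of_polyhedron[OF delzantD(2)[OF Q] F] by metis
  obtain q where q: "q extreme_point_of Q" "q \<in> F" "q \<in> Q"
    using F face_has_vertex[OF delzantD(3,4)[OF Q], of F] by (auto simp: facet_of_def)
  obtain B d where vf: "vertex_frame Q q B d" using delzant_vertex_frame[OF Q q(1)] by blast
  have qa: "a \<bullet> q = c" using q ac by auto
  have F': "F = Q \<inter> {x. x \<bullet> (- a) = q \<bullet> (- a)}" using ac(2) qa by (auto simp: inner_commute)
  have "cuts_facet Q (- a) (q \<bullet> (- a))"
    unfolding cuts_facet_def F'[symmetric] using F ac(1) qa by (auto simp: inner_commute)
  then obtain b s where b: "b \<in> B" "s > 0" "- a = s *\<^sub>R d b"
    using vertex_frame_facet_normal[OF Q vf _ q(3)] by blast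
  have cut: "cuts_facet Q (d b) (q \<bullet> d b)" by (rule vertex_frame_cuts_facet[OF Q q(3) vf b(1)])
  have "d b \<in> normals Q" using vertex_frame_normals_at[OF Q q(3) vf] b(1) by (auto simp: normals_at_def)
  moreover have "F = facet_at Q (d b)"
    using F' b(2) unfolding facet_at_def offset_eq[OF cut] b(3) by auto
  ultimately show thesis by (rule that)
qed

lemma facet_at_bij:
  assumes Q: "delzant Q"
  shows "bij_betw (facet_at Q) (normals Q) {F. F facet_of Q}"
proof -
  have "inj_on (facet_at Q) (normals Q)"
  proof (rule inj_onI, rule ccontr)
    fix v v' assume v: "v \<in> normals Q" "v' \<in> normals Q" "facet_at Q v = facet_at Q v'" "v \<noteq> v'"
    obtain q where q: "q extreme_point_of Q" "q \<in> Q" "v \<in> normals_at Q q"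
      using normals_vertex[OF Q v(1)] by blast
    have "q \<in> facet_at Q v'" unfolding v(3)[symmetric] using q by (auto simp: facet_at_def normals_at_def facet_fun_offset)
    then have v'q: "v' \<in> normals_at Q q" using v(2) by (auto simp: facet_at_def normals_at_def facet_fun_offset)
    obtain B d where vf: "vertex_frame Q q B d" using delzant_vertex_frame[OF Q q(1)] by blast
    obtain b b' where b: "b \<in> B" "v = d b" "b' \<in> B" "v' = d b'"
      using q(3) v'q vertex_frame_normals_at[OF Q q(2) vf] by auto
    have ne: "b' \<noteq> b" using v(4) b by auto
    \<comment> \<open>The edge dual to v' stays on the facet of v but leaves that of v'.\<close>
    obtain t where t: "t > 0" "q + t *\<^sub>R b' \<in> Q" using vertex_frameD(8)[OF vf b(3)] by blast
    have "q \<bullet> v = offset Q v" "q \<bullet> v' = offset Q v'"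
      using q(3) v'q by (auto simp: normals_at_def facet_fun_offset)
    moreover have "b' \<bullet> v = 0" "b' \<bullet> v' = 1" using vertex_frameD(5)[OF vf] b ne by auto
    ultimately have "q + t *\<^sub>R b' \<in> facet_at Q v" "q + t *\<^sub>R b' \<notin> facet_at Q v'"
      using t by (auto simp: facet_at_def inner_add_left)
    then show False using v(3) by blast
  qed
  moreover have "facet_at Q ` normals Q = {F. F facet_of Q}"
    using facet_at_facet_of facet_of_delzant[OF Q] by blast
  ultimately show ?thesis by (simp add: bij_betw_def)
qed

lemma finite_normals: "delzant Q \<Longrightarrow> finite (normals Q)"
  using bij_betw_finite[OF facet_at_bij] finite_polytope_facets delzantD(1) by blast

lemma card_normals: "delzant Q \<Longrightarrow> card (normals Q) = card {F. F facet_of Q}"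
  using bij_betw_same_card[OF facet_at_bij] .

lemma delzant_interior:
  fixes Q :: "(real^'n) set"
  assumes "delzant Q" shows "rel_interior Q = interior Q" "interior Q \<noteq> {}"
proof -
  have "affine hull Q = UNIV"
    using delzantD(6)[OF assms] aff_dim_eq_full[of Q] by simp
  then show "rel_interior Q = interior Q" by (rule rel_interior_interior)
  then show "interior Q \<noteq> {}" using rel_interior_eq_empty[OF delzantD(4)[OF assms]] delzantD(7)[OF assms] by simp
qed

lemma delzant_interior_pos:
  fixes Q :: "(real^'n) set"
  assumes Q: "delzant Q" and v: "v \<in> normals Q" and x: "x \<in> interior Q"
  shows "0 < facet_fun Q v x"
proof -
  have "x \<notin> facet_at Q v"
    using rel_boundary_of_polyhedron[OF delzantD(2)[OF Q]] facet_at_facet_of[OF v] x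
    unfolding delzant_interior(1)[OF Q] by blast
  moreover have "x \<in> Q" using x interior_subset by blast
  ultimately have "facet_fun Q v x \<noteq> 0" by (auto simp: facet_at_def facet_fun_offset)
  then show ?thesis using facet_fun_nonneg[OF v \<open>x \<in> Q\<close>] by simp
qed

lemma delzant_eq_halfspaces:
  fixes Q :: "(real^'n) set"
  assumes Q: "delzant Q"
  shows "Q = {x. \<forall>v\<in>normals Q. 0 \<le> facet_fun Q v x}"
proof (intro equalityI subsetI CollectI ballI)
  fix y assume "y \<in> {x. \<forall>v\<in>normals Q. 0 \<le> facet_fun Q v x}"
  then have y: "\<And>v. v \<in> normals Q \<Longrightarrow> 0 \<le> facet_fun Q v y" by blast
  show "y \<in> Q"
  proof (rule ccontr)
    assume yQ: "y \<notin> Q"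
    obtain x where x: "x \<in> interior Q" using delzant_interior(2)[OF Q] by blast
    then have xQ: "x \<in> Q" using interior_subset by blast
    \<comment> \<open>The segment from an interior point to y leaves Q through some facet. The
      affine function of that facet is positive at x and nonnegative at y, so it can vanish at the
      crossing point only if this point is y, which lies outside Q.\<close>
    have "closed_segment x y \<inter> frontier Q \<noteq> {}"
      by (rule connected_Int_frontier) (use xQ yQ in auto)
    then obtain z where z: "z \<in> closed_segment x y" "z \<in> frontier Q" by blast
    have zQ: "z \<in> Q" "z \<notin> interior Q" using z(2) delzantD(5)[OF Q] by (auto simp: frontier_def)
    then have "z \<in> \<Union> {F. F facet_of Q}"
      using rel_boundary_of_polyhedron[OF delzantD(2)[OF Q]] unfolding delzant_interior(1)[OF Q] by blast
    then obtain v where v: "v \<in> normals Q" "z \<in> facet_at Q v" using facet_of_delzant[OF Q] by blast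
    obtain t where t: "0 \<le> t" "t \<le> 1" "z = (1 - t) *\<^sub>R x + t *\<^sub>R y"
      using z(1) by (auto simp: in_segment)
    have "0 = facet_fun Q v z" using v(2) by (simp add: facet_at_def facet_fun_offset)
    also have "\<dots> = (1 - t) * facet_fun Q v x + t * facet_fun Q v y"
      unfolding t(3) by (simp add: facet_fun_offset inner_add_left algebra_simps)
    finally have "(1 - t) * facet_fun Q v x + t * facet_fun Q v y = 0" by simp
    moreover have "0 \<le> (1 - t) * facet_fun Q v x" "0 \<le> t * facet_fun Q v y"
      using t y[OF v(1)] delzant_interior_pos[OF Q v(1) x] by auto
    ultimately have "(1 - t) * facet_fun Q v x = 0" by linarith
    then have "t = 1" using delzant_interior_pos[OF Q v(1) x] by simp
    then show False using t(3) zQ yQ by simp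
  qed
qed (rule facet_fun_nonneg)

section \<open>Stability of the normal vectors\<close>

lemma finite_positive_lower_bound:
  assumes "finite S" "\<And>s. s \<in> S \<Longrightarrow> 0 < f s"
  shows "\<exists>e>0. \<forall>s\<in>S. (e :: real) \<le> f s"
proof -
  \<comment> \<open>The element 1 keeps the minimum meaningful when S is empty.\<close>
  have fi: "finite (insert 1 (f ` S))" using assms(1) by simp
  have "Min (insert 1 (f ` S)) > 0" using fi assms(2) by (subst Min_gr_iff) auto
  moreover have "Min (insert 1 (f ` S)) \<le> f s" if "s \<in> S" for s
    using fi that by (intro Min_le) auto
  ultimately show ?thesis by blast
qed

definition hausdorff_close :: "real \<Rightarrow> 'a::metric_space set \<Rightarrow> 'a set \<Rightarrow> bool" where
  "hausdorff_close e A B \<longleftrightarrow> (\<forall>x\<in>A. \<exists>y\<in>B. dist x y < e) \<and> (\<forall>y\<in>B. \<exists>x\<in>A. dist x y < e)"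

text \<open>Compactness bounds the distances, so that the real supremum is an upper bound, and lets
  the infimum be attained.\<close>

lemma infdist_less_SUP:
  fixes A B :: "'a::heine_borel set"
  assumes "compact A" "compact B" "B \<noteq> {}" "x \<in> A" "(SUP x\<in>A. infdist x B) < e"
  shows "\<exists>y\<in>B. dist x y < e"
proof -
  have "compact ((\<lambda>x. infdist x B) ` A)"
    by (intro compact_continuous_image continuous_on_infdist continuous_on_id assms)
  then have "bdd_above ((\<lambda>x. infdist x B) ` A)"
    by (intro bounded_imp_bdd_above compact_imp_bounded)
  then have "infdist x B \<le> (SUP x\<in>A. infdist x B)" by (rule cSUP_upper[OF assms(4)])
  moreover obtain y where "y \<in> B" "infdist x B = dist x y"
    using infdist_attains_inf[OF compact_imp_closed[OF assms(2)] assms(3), of x] by blast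
  ultimately have "y \<in> B" "dist x y < e" using assms(5) by simp_all
  then show ?thesis by blast
qed

lemma hausdorff_dist_less_imp_close:
  fixes A B :: "'a::heine_borel set"
  assumes "compact A" "compact B" "A \<noteq> {}" "B \<noteq> {}" "hausdorff_dist A B < e"
  shows "hausdorff_close e A B"
  unfolding hausdorff_close_def
proof (intro conjI ballI)
  show "\<exists>y\<in>B. dist x y < e" if "x \<in> A" for x
    by (rule infdist_less_SUP) (use assms that in \<open>auto simp: hausdorff_dist_def\<close>)
  show "\<exists>x\<in>A. dist x y < e" if "y \<in> B" for y
    using infdist_less_SUP[of B A y e] assms that by (auto simp: hausdorff_dist_def dist_commute)
qed

lemma hausdorff_close_mono: "hausdorff_close e A B \<Longrightarrow> e \<le> e' \<Longrightarrow> hausdorff_close e' A B"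
  unfolding hausdorff_close_def by (meson less_le_trans)

lemma normals_nonzero: "v \<in> normals Q \<Longrightarrow> v \<noteq> 0"
proof
  assume "v \<in> normals Q" "v = 0"
  then have "primitive v" by (simp add: normals_def)
  moreover have "v \<in> int_lattice" using \<open>v = 0\<close> by (simp add: int_lattice_def)
  moreover have "v = of_int 0 *\<^sub>R v" using \<open>v = 0\<close> by simp
  ultimately have "\<bar>0::int\<bar> = 1" unfolding primitive_def by blast
  then show False by simp
qed

lemma lattice_norm_ge_1:
  fixes x :: "real^'n"
  assumes "x \<in> int_lattice" "x \<noteq> 0" shows "1 \<le> norm x"
proof -
  obtain i where i: "x $ i \<noteq> 0" using assms(2) by (metis vec_eq_iff zero_index)
  have "x $ i \<in> \<int>" using assms(1) by (simp add: int_lattice_def)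
  then have "1 \<le> \<bar>x $ i\<bar>" using i by (rule Ints_nonzero_abs_ge1)
  then show ?thesis using component_le_norm_cart[of x i] by linarith
qed

lemma finite_lattice_bounded: "finite {x \<in> (int_lattice :: (real^'n) set). norm x \<le> R}"
proof -
  let ?I = "{z :: real. z \<in> \<int> \<and> \<bar>z\<bar> \<le> R}"
  have "finite (vec_lambda ` (UNIV \<rightarrow>\<^sub>E ?I) :: (real^'n) set)"
    by (intro finite_imageI finite_PiE finite_abs_int_segment) simp
  moreover have "{x \<in> (int_lattice :: (real^'n) set). norm x \<le> R} \<subseteq> vec_lambda ` (UNIV \<rightarrow>\<^sub>E ?I)"
  proof
    fix x :: "real^'n" assume x: "x \<in> {x \<in> int_lattice. norm x \<le> R}"
    have "x $ i \<in> ?I" for i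
      using x component_le_norm_cart[of x i] by (auto simp: int_lattice_def)
    then have "(\<lambda>i. x $ i) \<in> UNIV \<rightarrow>\<^sub>E ?I" by auto
    then show "x \<in> vec_lambda ` (UNIV \<rightarrow>\<^sub>E ?I)" by (intro image_eqI[where x="\<lambda>i. x $ i"]) (simp_all add: vec_nth_inverse)
  qed
  ultimately show ?thesis by (rule rev_finite_subset)
qed

lemma sgn_norm: "norm v *\<^sub>R sgn v = (v :: 'a::real_normed_vector)"
  by (cases "v = 0") (auto simp: sgn_div_norm)

text \<open>The ratio of the two vectors is an integer, since some edge direction pairs to 1 with v
  and integrally with w. Primitivity of w and the common direction leave only the ratio 1.\<close>

lemma normals_sgn_eq:
  assumes P: "delzant P" and v: "v \<in> normals P" and w: "primitive w" and eq: "sgn w = sgn v"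
  shows "w = v"
proof -
  obtain q where q: "q extreme_point_of P" "q \<in> P" "v \<in> normals_at P q"
    using normals_vertex[OF P v] by blast
  obtain B d where vf: "vertex_frame P q B d" using delzant_vertex_frame[OF P q(1)] by blast
  obtain b where b: "b \<in> B" "v = d b" using q(3) vertex_frame_normals_at[OF P q(2) vf] by auto
  have vn: "norm v > 0" using normals_nonzero[OF v] by simp
  define t where "t = norm w / norm v"
  have "w = norm w *\<^sub>R sgn v" using sgn_norm[of w] eq by simp
  also have "\<dots> = t *\<^sub>R v" by (simp add: t_def sgn_div_norm divide_inverse)
  finally have wt: "w = t *\<^sub>R v" .
  have "w \<in> int_lattice" using w by (simp add: primitive_def)
  moreover have "b \<in> int_lattice" using b(1) vertex_frameD(3)[OF vf] by blast
  ultimately obtain k :: int where k: "b \<bullet> w = of_int k" using int_lattice_inner Ints_cases by metis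
  have "b \<bullet> w = t" unfolding wt b(2) using vertex_frameD(5)[OF vf b(1) b(1)] by simp
  then have tk: "t = of_int k" using k by simp
  have "v \<in> int_lattice" using v by (simp add: normals_def primitive_def)
  then have "\<bar>k\<bar> = 1" using w wt tk unfolding primitive_def by blast
  moreover have "t \<ge> 0" by (simp add: t_def)
  ultimately have "t = 1" using tk by (cases "k = 1") auto
  then show ?thesis using wt by simp
qed

lemma open_facet_fun_pos: "finite S \<Longrightarrow> open {x. \<forall>w\<in>S. 0 < facet_fun P w x}"
proof -
  assume "finite S"
  have "{x. \<forall>w\<in>S. 0 < facet_fun P w x} = (\<Inter>w\<in>S. {x. 0 < facet_fun P w x})" by auto
  moreover have "open {x. 0 < facet_fun P w x}" for w
    unfolding facet_fun_offset by (intro open_Collect_less continuous_intros)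
  ultimately show ?thesis using \<open>finite S\<close> by auto
qed

text \<open>Supplies a half ball of P resting on the facet. A vertex q of the facet is moved by a
  small multiple of D, the sum of the edge directions at q except the one leaving the facet: this
  stays on the facet of v, moves off the other facets at q, and is too short to reach the remaining
  ones.\<close>

lemma facet_inner_point:
  fixes P :: "(real^'n) set"
  assumes P: "delzant P" and v: "v \<in> normals P"
  shows "\<exists>x r. 0 < r \<and> x \<bullet> v = offset P v \<and> x \<in> P \<and>
    (\<forall>y. dist y x \<le> r \<longrightarrow> offset P v \<le> y \<bullet> v \<longrightarrow> y \<in> P)"
proof -
  obtain q where q: "q extreme_point_of P" "q \<in> P" "v \<in> normals_at P q"
    using normals_vertex[OF P v] by blast
  obtain B d where vf: "vertex_frame P q B d" using delzant_vertex_frame[OF P q(1)] by blast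
  have Nq: "normals_at P q = d ` B" by (rule vertex_frame_normals_at[OF P q(2) vf])
  obtain b where b: "b \<in> B" "v = d b" using q(3) Nq by auto
  note fB = vertex_frameD(1)[OF vf]
  let ?S = "{x. \<forall>w\<in>normals P - normals_at P q. 0 < facet_fun P w x}"
  have oS: "open ?S" using finite_normals[OF P] by (intro open_facet_fun_pos) simp
  have "0 < facet_fun P w q" if "w \<in> normals P - normals_at P q" for w
    using facet_fun_nonneg[of w P q] q(2) that by (fastforce simp: normals_at_def)
  then have "q \<in> ?S" by blast
  then obtain e where e: "e > 0" "ball q e \<subseteq> ?S" using oS open_contains_ball by blast
  define D where "D = (\<Sum>b'\<in>B - {b}. b')"
  \<comment> \<open>The summand 1 covers D = 0, which occurs for n = 1.\<close>
  define s where "s = e / (2 * (norm D + 1))"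
  have s: "s > 0" using e by (simp add: s_def add_nonneg_pos)
  have "s * norm D < e"
  proof -
    have "s * norm D \<le> s * (norm D + 1)" using s by simp
    also have "\<dots> = e / 2"
    proof -
      have "norm D + 1 \<noteq> 0" using norm_ge_zero[of D] by linarith
      then show ?thesis by (simp add: s_def field_simps)
    qed
    finally show ?thesis using e by simp
  qed
  define x where "x = q + s *\<^sub>R D"
  have "x \<in> ball q e" using \<open>s * norm D < e\<close> s by (simp add: x_def dist_norm)
  then have xS: "x \<in> ?S" using e by blast
  have Dd: "D \<bullet> d b' = (if b' = b then 0 else 1)" if "b' \<in> B" for b'
  proof -
    have "D \<bullet> d b' = (\<Sum>a\<in>B - {b}. if a = b' then 1 else 0)"
      unfolding D_def inner_sum_left
      by (intro sum.cong refl) (use vertex_frameD(5)[OF vf] that in auto)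
    also have "\<dots> = (if b' = b then 0 else 1)" using fB that by simp
    finally show ?thesis .
  qed
  have qv: "q \<bullet> w = offset P w" if "w \<in> normals_at P q" for w
    using that by (simp add: normals_at_def facet_fun_offset)
  have xv: "x \<bullet> v = offset P v"
    using Dd[OF b(1)] qv[OF q(3)] b(2) by (simp add: x_def inner_add_left)
  have xw: "0 < facet_fun P w x" if "w \<in> normals P - {v}" for w
  proof (cases "w \<in> normals_at P q")
    case True
    then obtain b' where b': "b' \<in> B" "w = d b'" using Nq by auto
    then have "b' \<noteq> b" using that b(2) by auto
    then show ?thesis using Dd[OF b'(1)] qv[OF True] b'(2) s by (simp add: x_def facet_fun_offset inner_add_left)
  next
    case False
    then show ?thesis using xS that by blast
  qed
  have "open {x. \<forall>w\<in>normals P - {v}. 0 < facet_fun P w x}"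
    using finite_normals[OF P] by (intro open_facet_fun_pos) simp
  then obtain r where r: "r > 0" "cball x r \<subseteq> {x. \<forall>w\<in>normals P - {v}. 0 < facet_fun P w x}"
    using xw open_contains_cball_eq[of "{x. \<forall>w\<in>normals P - {v}. 0 < facet_fun P w x}"] by blast
  moreover have inP: "y \<in> P" if "dist y x \<le> r" "offset P v \<le> y \<bullet> v" for y
  proof -
    have "y \<in> cball x r" using that by (simp add: dist_commute)
    then have "\<forall>w\<in>normals P - {v}. 0 < facet_fun P w y" using r by blast
    moreover have "0 \<le> facet_fun P v y" using that by (simp add: facet_fun_offset)
    ultimately have "\<forall>w\<in>normals P. 0 \<le> facet_fun P w y"
      by (metis Diff_iff less_imp_le singletonD)
    then show ?thesis by (subst delzant_eq_halfspaces[OF P]) simp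
  qed
  moreover have "x \<in> P" using inP[of x] xv r(1) by simp
  ultimately show ?thesis using r(1) xv by blast
qed

text \<open>A point just outside \<open>P\<close> beyond an inner point of a facet is cut off from \<open>Q\<close> by some
  facet of \<open>Q\<close>; the corresponding halfspace nearly contains a half ball of \<open>P\<close>, so its unit
  normal is close to that of the facet of \<open>P\<close>.\<close>

lemma facet_approximation:
  fixes P Q :: "(real^'n) set"
  assumes P: "delzant P" and v: "v \<in> normals P" and x: "x \<bullet> v = offset P v" "x \<in> P" and r: "0 < r"
    and inP: "\<And>y. dist y x \<le> r \<Longrightarrow> offset P v \<le> y \<bullet> v \<Longrightarrow> y \<in> P"
    and Q: "delzant Q" and close: "hausdorff_close \<delta> Q P" and \<delta>: "0 < \<delta>" "4 * \<delta> \<le> r"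
  obtains \<nu> where "\<nu> \<in> normals Q" "norm (sgn \<nu> - sgn v) \<le> 4 * \<delta> / r"
    "\<bar>offset Q \<nu> / norm \<nu> - offset P v / norm v\<bar> \<le> \<delta> + norm x * (4 * \<delta> / r)"
proof -
  define u where "u = sgn v"
  have vn: "norm v > 0" using normals_nonzero[OF v] by simp
  have nu: "norm u = 1" using vn by (simp add: u_def norm_sgn)
  have uu: "u \<bullet> u = 1" using nu by (simp add: norm_eq_sqrt_inner)
  have yu: "y \<bullet> v = norm v * (y \<bullet> u)" for y
    by (metis inner_scaleR_right sgn_norm u_def)
  \<comment> \<open>All of P lies on the inner side of the facet, hence at distance at least
    \<delta> from z; so z cannot belong to Q.\<close>
  define z where "z = x - \<delta> *\<^sub>R u"
  have "z \<notin> Q"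
  proof
    assume "z \<in> Q"
    then obtain y where y: "y \<in> P" "dist z y < \<delta>" using close unfolding hausdorff_close_def by blast
    have "x \<bullet> v \<le> y \<bullet> v" using facet_fun_nonneg[OF v y(1)] x(1) by (simp add: facet_fun_offset)
    then have "x \<bullet> u \<le> y \<bullet> u" using vn by (simp add: yu)
    then have "\<delta> \<le> (y - z) \<bullet> u" by (simp add: z_def inner_diff_left uu)
    also have "\<dots> \<le> norm (y - z) * norm u" by (rule norm_cauchy_schwarz)
    also have "\<dots> < \<delta>" using y(2) nu by (simp add: dist_norm norm_minus_commute)
    finally show False by simp
  qed
  then obtain \<nu> where \<nu>: "\<nu> \<in> normals Q" "facet_fun Q \<nu> z < 0"
    by (subst (asm) delzant_eq_halfspaces[OF Q]) (auto simp: not_le)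
  define a c where "a = sgn \<nu>" and "c = offset Q \<nu> / norm \<nu>"
  have \<nu>n: "norm \<nu> > 0" using normals_nonzero[OF \<nu>(1)] by simp
  have na: "norm a = 1" using \<nu>n by (simp add: a_def norm_sgn)
  have aa: "a \<bullet> a = 1" using na by (simp add: norm_eq_sqrt_inner)
  have ya: "y \<bullet> \<nu> = norm \<nu> * (y \<bullet> a)" for y
    by (metis inner_scaleR_right sgn_norm a_def)
  have oc: "offset Q \<nu> = norm \<nu> * c" using \<nu>n by (simp add: c_def)
  have za: "z \<bullet> a < c" using \<nu>(2) \<nu>n by (simp add: facet_fun_offset ya oc)
  have Qa: "c \<le> y \<bullet> a" if "y \<in> Q" for y
    using facet_fun_nonneg[OF \<nu>(1) that] \<nu>n by (simp add: facet_fun_offset ya oc)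
  \<comment> \<open>\<open>a\<close> is split into its component along u and an orthogonal part.
    Testing with vectors w of the half ball bounds both: w opposite to \<beta> gives norm \<beta>
    \<le> \<tau>, and w = r u gives \<alpha> \<ge> -\<tau>.\<close>
  define \<alpha> \<beta> where "\<alpha> = u \<bullet> a" and "\<beta> = a - \<alpha> *\<^sub>R u"
  have \<alpha>1: "\<bar>\<alpha>\<bar> \<le> 1" using Cauchy_Schwarz_ineq2[of u a] nu na by (simp add: \<alpha>_def)
  have close': "\<exists>y'\<in>Q. dist y' y < \<delta>" if "y \<in> P" for y
    using close that by (simp add: hausdorff_close_def)
  have Pa: "c - \<delta> \<le> y \<bullet> a" if "y \<in> P" for y
  proof -
    obtain y' where y': "y' \<in> Q" "dist y' y < \<delta>" using close'[OF \<open>y \<in> P\<close>] by blast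
    have "(y' - y) \<bullet> a \<le> norm (y' - y) * norm a" by (rule norm_cauchy_schwarz)
    then have "(y' - y) \<bullet> a \<le> \<delta>" using y'(2) na by (simp add: dist_norm)
    then show ?thesis using Qa[OF y'(1)] by (simp add: inner_diff_left)
  qed
  have \<delta>\<alpha>: "\<delta> * \<alpha> \<le> \<delta>" using \<alpha>1 \<delta>(1) by (simp add: abs_le_iff)
  have zx: "z \<bullet> a = x \<bullet> a - \<delta> * \<alpha>" by (simp add: z_def inner_diff_left \<alpha>_def)
  have dir: "- 2 * \<delta> \<le> w \<bullet> a" if "norm w \<le> r" "0 \<le> w \<bullet> u" for w
  proof -
    have "x + w \<in> P"
    proof (rule inP)
      show "dist (x + w) x \<le> r" using that by (simp add: dist_norm)
      have "w \<bullet> v \<ge> 0" using that vn by (simp add: yu)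
      then show "offset P v \<le> (x + w) \<bullet> v" using x(1) by (simp add: inner_add_left)
    qed
    then have "c - \<delta> \<le> (x + w) \<bullet> a" by (rule Pa)
    then show ?thesis using za zx \<delta>\<alpha> by (simp add: inner_add_left)
  qed
  have \<beta>u: "\<beta> \<bullet> u = 0" by (simp add: \<beta>_def \<alpha>_def inner_diff_left uu inner_commute[of u a])
  have \<beta>a: "\<beta> \<bullet> a = (norm \<beta>)\<^sup>2"
  proof -
    have "a = \<beta> + \<alpha> *\<^sub>R u" by (simp add: \<beta>_def)
    then have "\<beta> \<bullet> a = \<beta> \<bullet> \<beta>" using \<beta>u by (metis add.right_neutral inner_add_right inner_scaleR_right mult_zero_right)
    then show ?thesis by (simp add: power2_norm_eq_inner)
  qed
  have \<beta>sq: "(norm \<beta>)\<^sup>2 = 1 - \<alpha>\<^sup>2"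
    unfolding \<beta>a[symmetric] by (simp add: \<beta>_def \<alpha>_def inner_diff_left aa power2_eq_square)
  define \<tau> where "\<tau> = 2 * \<delta> / r"
  have \<tau>: "0 < \<tau>" "\<tau> \<le> 1 / 2" using \<delta> r by (auto simp: \<tau>_def field_simps)
  have \<beta>\<tau>: "norm \<beta> \<le> \<tau>"
  proof (cases "\<beta> = 0")
    case False
    let ?w = "- (r *\<^sub>R sgn \<beta>)"
    have "- 2 * \<delta> \<le> ?w \<bullet> a"
      by (rule dir) (use r \<beta>u False in \<open>auto simp: norm_sgn sgn_div_norm\<close>)
    moreover have "?w \<bullet> a = - (r * norm \<beta>)"
      using False by (simp add: sgn_div_norm \<beta>a power2_eq_square)
    ultimately show ?thesis using r by (simp add: \<tau>_def field_simps)
  qed (use \<tau> in simp)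
  have "- 2 * \<delta> \<le> (r *\<^sub>R u) \<bullet> a"
    by (rule dir) (use r nu uu in auto)
  then have \<alpha>\<tau>: "- \<tau> \<le> \<alpha>" using r by (simp add: \<tau>_def \<alpha>_def field_simps)
  have b2: "(norm \<beta>)\<^sup>2 \<le> norm \<beta>"
    using mult_right_le_one_le[of "norm \<beta>" "norm \<beta>"] \<beta>\<tau> \<tau> by (simp add: power2_eq_square)
  \<comment> \<open>Excludes that \<open>a\<close> points nearly opposite to u. Here \<tau> \<le>
    1/2, which comes from 4 \<delta> \<le> r, is essential: a negative \<alpha> would force the
    square of norm \<beta> up to 3/4, while it is at most 1/2.\<close>
  have \<alpha>0: "0 \<le> \<alpha>"
  proof (rule ccontr)
    assume "\<not> 0 \<le> \<alpha>"
    then have "\<bar>\<alpha>\<bar> \<le> 1 / 2" using \<alpha>\<tau> \<tau> by auto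
    then have "\<bar>\<alpha>\<bar>\<^sup>2 \<le> (1 / 2)\<^sup>2" by (intro power_mono) auto
    then have "3 / 4 \<le> (norm \<beta>)\<^sup>2" unfolding \<beta>sq by (simp add: power2_eq_square)
    moreover have "(norm \<beta>)\<^sup>2 \<le> 1 / 2" using b2 \<beta>\<tau> \<tau> by linarith
    ultimately show False by simp
  qed
  have "\<alpha>\<^sup>2 \<le> \<alpha>" using \<alpha>0 \<alpha>1 mult_right_le_one_le[of \<alpha> \<alpha>] by (simp add: power2_eq_square)
  then have "1 - \<alpha> \<le> norm \<beta>" using b2 \<beta>sq by linarith
  have "a - u = \<beta> - (1 - \<alpha>) *\<^sub>R u" by (simp add: \<beta>_def algebra_simps)
  then have "norm (a - u) \<le> norm \<beta> + norm ((1 - \<alpha>) *\<^sub>R u)" by (metis norm_triangle_ineq4)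
  also have "\<dots> \<le> 2 * norm \<beta>" using nu \<alpha>1 \<open>1 - \<alpha> \<le> norm \<beta>\<close> by simp
  also have "\<dots> \<le> 4 * \<delta> / r" using \<beta>\<tau> by (simp add: \<tau>_def)
  finally have au: "norm (a - u) \<le> 4 * \<delta> / r" .
  have "\<bar>c - x \<bullet> a\<bar> \<le> \<delta>"
  proof -
    have "c - \<delta> \<le> x \<bullet> a" by (rule Pa[OF x(2)])
    then show ?thesis using za zx \<delta>\<alpha> by auto
  qed
  moreover have "\<bar>x \<bullet> a - x \<bullet> u\<bar> \<le> norm x * (4 * \<delta> / r)"
  proof -
    have "\<bar>x \<bullet> (a - u)\<bar> \<le> norm x * norm (a - u)" by (rule Cauchy_Schwarz_ineq2)
    also have "\<dots> \<le> norm x * (4 * \<delta> / r)" using au by (intro mult_left_mono) auto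
    finally show ?thesis by (simp add: inner_diff_right)
  qed
  moreover have "offset P v / norm v = x \<bullet> u" using vn yu[of x] unfolding x(1) by simp
  ultimately have "\<bar>c - offset P v / norm v\<bar> \<le> \<delta> + norm x * (4 * \<delta> / r)" by linarith
  then show thesis using that[OF \<nu>(1)] au by (simp add: a_def c_def u_def)
qed

lemma facet_approximation_eps:
  fixes P :: "(real^'n) set"
  assumes P: "delzant P" and v: "v \<in> normals P" and e: "0 < e"
  obtains h where "0 < h" "\<And>Q. delzant Q \<Longrightarrow> hausdorff_close h Q P \<Longrightarrow>
    \<exists>\<nu>\<in>normals Q. norm (sgn \<nu> - sgn v) < e \<and> \<bar>offset Q \<nu> / norm \<nu> - offset P v / norm v\<bar> < e"
proof -
  obtain x r where x: "0 < r" "x \<bullet> v = offset P v" "x \<in> P"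
    "\<And>y. dist y x \<le> r \<Longrightarrow> offset P v \<le> y \<bullet> v \<Longrightarrow> y \<in> P"
    using facet_inner_point[OF P v] by blast
  \<comment> \<open>Collects the coefficients of h in the two error bounds, so that h K < e controls
    both.\<close>
  define K where "K = 1 + 4 / r + norm x * (4 / r)"
  have K: "K > 0" using x(1) by (simp add: K_def add_pos_nonneg)
  define h where "h = min (r / 4) (e / (2 * K))"
  have h: "0 < h" "4 * h \<le> r" using x(1) e K by (auto simp: h_def)
  have "h * K \<le> e / (2 * K) * K" using K by (intro mult_right_mono) (auto simp: h_def)
  also have "\<dots> < e" using K e by simp
  finally have hK: "h * K < e" .
  have split: "h * K = h + 4 * h / r + norm x * (4 * h / r)" by (simp add: K_def algebra_simps)
  have pos: "0 \<le> 4 * h / r" "0 \<le> norm x * (4 * h / r)" using h x(1) by auto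
  show thesis
  proof (rule that[OF h(1)])
    fix Q :: "(real^'n) set" assume Q: "delzant Q" "hausdorff_close h Q P"
    obtain \<nu> where "\<nu> \<in> normals Q" "norm (sgn \<nu> - sgn v) \<le> 4 * h / r"
      "\<bar>offset Q \<nu> / norm \<nu> - offset P v / norm v\<bar> \<le> h + norm x * (4 * h / r)"
      using facet_approximation[OF P v x(2,3,1,4) Q h] by blast
    then show "\<exists>\<nu>\<in>normals Q. norm (sgn \<nu> - sgn v) < e \<and> \<bar>offset Q \<nu> / norm \<nu> - offset P v / norm v\<bar> < e"
      using hK split pos h(1) by (intro bexI[of _ \<nu>]) auto
  qed
qed

text \<open>Independence of the normals at a vertex in quantitative form. The expansion in B bounds
  the norm of x by K times its largest pairing with a unit normal.\<close>

lemma vertex_frame_lower_bound: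
  assumes vf: "vertex_frame P p B d"
  obtains \<kappa> where "0 < \<kappa>" "\<And>x. \<exists>b\<in>B. \<kappa> * norm x \<le> \<bar>x \<bullet> sgn (d b)\<bar>"
proof -
  note fB = vertex_frameD(1)[OF vf]
  have B0: "B \<noteq> {}" using vertex_frameD(2)[OF vf] by auto
  define K where "K = (\<Sum>b\<in>B. norm (d b) * norm b)"
  have K0: "0 \<le> K" by (auto simp: K_def intro: sum_nonneg)
  have bound: "norm x \<le> m * K" if m: "\<And>b. b \<in> B \<Longrightarrow> \<bar>x \<bullet> sgn (d b)\<bar> \<le> m" for x m
  proof -
    have "norm x = norm (\<Sum>b\<in>B. (x \<bullet> d b) *\<^sub>R b)" by (simp add: vertex_frameD(6)[OF vf])
    also have "\<dots> \<le> (\<Sum>b\<in>B. \<bar>x \<bullet> d b\<bar> * norm b)" by (rule sum_norm_le) simp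
    also have "\<dots> \<le> (\<Sum>b\<in>B. m * (norm (d b) * norm b))"
    proof (rule sum_mono)
      fix b assume "b \<in> B"
      have "\<bar>x \<bullet> d b\<bar> = norm (d b) * \<bar>x \<bullet> sgn (d b)\<bar>"
        by (metis abs_mult abs_norm_cancel inner_scaleR_right sgn_norm)
      also have "\<dots> \<le> norm (d b) * m" using m[OF \<open>b \<in> B\<close>] by (intro mult_left_mono) auto
      finally show "\<bar>x \<bullet> d b\<bar> * norm b \<le> m * (norm (d b) * norm b)"
        using mult_right_mono[of "\<bar>x \<bullet> d b\<bar>" "norm (d b) * m" "norm b"] by (simp add: mult_ac)
    qed
    finally show ?thesis by (simp add: K_def sum_distrib_left)
  qed
  \<comment> \<open>The denominator K + 1 instead of K makes the final contradiction strict.\<close>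
  define \<kappa> where "\<kappa> = 1 / (K + 1)"
  have \<kappa>: "0 < \<kappa>" using K0 by (simp add: \<kappa>_def)
  show thesis
  proof (rule that[OF \<kappa>], rule ccontr)
    fix x assume "\<not> (\<exists>b\<in>B. \<kappa> * norm x \<le> \<bar>x \<bullet> sgn (d b)\<bar>)"
    then have lt: "\<And>b. b \<in> B \<Longrightarrow> \<bar>x \<bullet> sgn (d b)\<bar> < \<kappa> * norm x" by force
    then have "norm x \<le> (\<kappa> * norm x) * K" by (intro bound) (auto intro: less_imp_le)
    moreover have "(\<kappa> * norm x) * K = norm x * (K / (K + 1))" by (simp add: \<kappa>_def)
    moreover have "x \<noteq> 0" using lt B0 by force
    then have "norm x * (K / (K + 1)) < norm x * 1" using K0 by (intro mult_strict_left_mono) auto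
    ultimately show False by simp
  qed
qed

lemma minimizing_vertex:
  fixes Q :: "(real^'n) set"
  assumes "delzant Q"
  obtains q where "q extreme_point_of Q" "q \<in> Q" "\<And>x. x \<in> Q \<Longrightarrow> q \<bullet> g \<le> x \<bullet> g"
proof -
  have "continuous_on Q (\<lambda>x. x \<bullet> g)" by (intro continuous_intros)
  then obtain m where m: "m \<in> Q" "\<And>x. x \<in> Q \<Longrightarrow> m \<bullet> g \<le> x \<bullet> g"
    using continuous_attains_inf[of Q "\<lambda>x. x \<bullet> g"] delzantD(3,7)[OF assms] by blast
  have "(Q \<inter> {x. g \<bullet> x = m \<bullet> g}) face_of Q"
    by (rule face_of_Int_supporting_hyperplane_ge[OF delzantD(4)[OF assms]]) (use m in \<open>auto simp: inner_commute\<close>)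
  moreover have "Q \<inter> {x. g \<bullet> x = m \<bullet> g} \<noteq> {}" using m by (auto simp: inner_commute)
  ultimately obtain q where q: "q extreme_point_of Q" "q \<in> Q \<inter> {x. g \<bullet> x = m \<bullet> g}"
    using face_has_vertex[OF delzantD(3,4)[OF assms]] by metis
  show thesis by (rule that[OF q(1)]) (use q m in \<open>auto simp: inner_commute\<close>)
qed

text \<open>Near a vertex \<open>p\<close> of \<open>P\<close> the polytope \<open>Q\<close> has a vertex \<open>q\<close> on the corresponding facets. If
  \<open>b\<close> is an edge direction of \<open>Q\<close> at \<open>q\<close> and \<open>d b\<close> the facet normal dual to it, then \<open>b \<bullet> d b = 1\<close>
  while all other normals at \<open>q\<close> are orthogonal to \<open>b\<close>. This bounds \<open>d b\<close>, so that only finitely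
  many lattice vectors are possible.\<close>

lemma normals_stable_at_vertex:
  fixes P :: "(real^'n) set"
  assumes P: "delzant P" and p: "p extreme_point_of P"
  obtains e where "0 < e"
    "\<And>Q f. delzant Q \<Longrightarrow> hausdorff_close e Q P \<Longrightarrow> bij_betw f (normals P) (normals Q) \<Longrightarrow>
      (\<And>v. v \<in> normals P \<Longrightarrow> norm (sgn (f v) - sgn v) < e) \<Longrightarrow>
      (\<And>v. v \<in> normals P \<Longrightarrow> \<bar>offset Q (f v) / norm (f v) - offset P v / norm v\<bar> < e) \<Longrightarrow>
      (\<And>w. w \<in> normals_at P p \<Longrightarrow> f w = w)"
proof -
  have pP: "p \<in> P" using p by (simp add: extreme_point_of_def)
  obtain B d where vf: "vertex_frame P p B d" using delzant_vertex_frame[OF P p] by blast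
  have Np: "normals_at P p = d ` B" by (rule vertex_frame_normals_at[OF P pP vf])
  note fB = vertex_frameD(1)[OF vf]
  have NpP: "normals_at P p \<subseteq> normals P" by (auto simp: normals_at_def)
  have cN: "card (normals_at P p) = CARD('n)"
    unfolding Np using card_image[OF vertex_frameD(9)[OF vf]] vertex_frameD(2)[OF vf] by simp
  obtain \<kappa> where \<kappa>: "0 < \<kappa>" and \<kappa>B: "\<And>x. \<exists>b\<in>B. \<kappa> * norm x \<le> \<bar>x \<bullet> sgn (d b)\<bar>"
    using vertex_frame_lower_bound[OF vf] by blast
  have \<kappa>N: "\<exists>w\<in>normals_at P p. \<kappa> * norm x \<le> \<bar>x \<bullet> sgn w\<bar>" for x
    using \<kappa>B[of x] unfolding Np by blast
  \<comment> \<open>\<mu> is a lower bound for the distance of p from the hyperplanes of the facets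
    not through it.\<close>
  have "\<exists>\<mu>>0. \<forall>w\<in>normals P - normals_at P p. \<mu> \<le> facet_fun P w p / norm w"
  proof (rule finite_positive_lower_bound)
    show "finite (normals P - normals_at P p)" using finite_normals[OF P] by simp
    show "0 < facet_fun P w p / norm w" if "w \<in> normals P - normals_at P p" for w
    proof -
      have "w \<in> normals P" "facet_fun P w p \<noteq> 0" using that by (auto simp: normals_at_def)
      then show ?thesis using facet_fun_nonneg[of w P p] pP normals_nonzero[of w P] by auto
    qed
  qed
  then obtain \<mu> where \<mu>: "0 < \<mu>" "\<And>w. w \<in> normals P - normals_at P p \<Longrightarrow> \<mu> \<le> facet_fun P w p / norm w"
    by blast
  \<comment> \<open>The candidates for f w, whose norm will turn out to be at most 2 / \<kappa>.
    They are finitely many, so those that do not share the direction of a given normal of P differ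
    from that direction by at least some \<sigma>.\<close>
  let ?L = "{x \<in> (int_lattice :: (real^'n) set). norm x \<le> 2 / \<kappa>}"
  let ?S = "{(x, w) \<in> ?L \<times> normals P. sgn x \<noteq> sgn w}"
  have "\<exists>\<sigma>>0. \<forall>xw\<in>?S. \<sigma> \<le> norm (sgn (fst xw) - sgn (snd xw))"
  proof (rule finite_positive_lower_bound)
    have "finite (?L \<times> normals P)" using finite_normals[OF P] finite_lattice_bounded by blast
    then show "finite ?S" by (rule rev_finite_subset) auto
    show "0 < norm (sgn (fst xw) - sgn (snd xw))" if "xw \<in> ?S" for xw using that by auto
  qed
  then obtain \<sigma> where \<sigma>: "0 < \<sigma>" "\<And>xw. xw \<in> ?S \<Longrightarrow> \<sigma> \<le> norm (sgn (fst xw) - sgn (snd xw))"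
    by blast
  let ?n = "real CARD('n)"
  \<comment> \<open>The coefficients of e in the errors met in \<open>far\<close>: the displacement
    of q from p, the turning of the normal evaluated at p, and the shift of the offset.\<close>
  define K where "K = 2 + 2 * ?n / \<kappa> + norm p"
  have K: "K > 0" using \<kappa> by (simp add: K_def add_pos_nonneg)
  define e where "e = min (\<mu> / (2 * K)) (min (\<kappa> / 2) \<sigma>)"
  have e: "0 < e" "e \<le> \<kappa> / 2" "e \<le> \<sigma>" using K \<mu> \<kappa> \<sigma> by (auto simp: e_def)
  have "e * K \<le> \<mu> / (2 * K) * K" using K by (intro mult_right_mono) (auto simp: e_def)
  also have "\<dots> < \<mu>" using K \<mu> by simp
  finally have eK: "e * K < \<mu>" .
  show thesis
  proof (rule that[OF e(1)])
    fix Q :: "(real^'n) set" and f w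
    assume Q: "delzant Q" and close: "hausdorff_close e Q P" and f: "bij_betw f (normals P) (normals Q)"
      and fs: "\<And>v. v \<in> normals P \<Longrightarrow> norm (sgn (f v) - sgn v) < e"
      and fo: "\<And>v. v \<in> normals P \<Longrightarrow> \<bar>offset Q (f v) / norm (f v) - offset P v / norm v\<bar> < e"
      and w: "w \<in> normals_at P p"
    have finj: "inj_on f (normals P)" and fQ: "f ` normals P = normals Q" using f by (auto simp: bij_betw_def)
    have sgn1: "norm (sgn v) = 1" if "v \<in> normals P" for v using normals_nonzero[OF that] by (simp add: norm_sgn)
    have sgn1Q: "norm (sgn v) = 1" if "v \<in> normals Q" for v using normals_nonzero[OF that] by (simp add: norm_sgn)
    \<comment> \<open>A sum of inward unit normals: on P this functional grows away from p at least
      by \<kappa> times the distance. A vertex q of Q minimizing it must therefore be close to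
      p.\<close>
    define g where "g = (\<Sum>w\<in>normals_at P p. sgn w)"
    have "norm g \<le> (\<Sum>w\<in>normals_at P p. 1)"
      unfolding g_def by (rule sum_norm_le) (use sgn1 NpP in auto)
    then have ng: "norm g \<le> ?n" using cN by simp
    obtain q where q: "q extreme_point_of Q" "q \<in> Q" "\<And>x. x \<in> Q \<Longrightarrow> q \<bullet> g \<le> x \<bullet> g"
      using minimizing_vertex[OF Q] by blast
    have near: "\<bar>x \<bullet> g - y \<bullet> g\<bar> \<le> e * ?n" if "dist x y < e" for x y
    proof -
      have "\<bar>(x - y) \<bullet> g\<bar> \<le> norm (x - y) * norm g" by (rule Cauchy_Schwarz_ineq2)
      also have "\<dots> \<le> e * ?n" using that ng e(1) by (intro mult_mono) (auto simp: dist_norm)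
      finally show ?thesis by (simp add: inner_diff_left)
    qed
    obtain y where y: "y \<in> Q" "dist y p < e" using close pP unfolding hausdorff_close_def by blast
    obtain x where x: "x \<in> P" "dist q x < e" using close q(2) unfolding hausdorff_close_def by blast
    have xg: "x \<bullet> g \<le> p \<bullet> g + 2 * (e * ?n)"
      using near[OF y(2)] near[OF x(2)] q(3)[OF y(1)] by linarith
    have pos: "0 \<le> (x - p) \<bullet> sgn w" if "w \<in> normals_at P p" for w
    proof -
      have "0 \<le> facet_fun P w x" "facet_fun P w p = 0"
        using that facet_fun_nonneg[OF _ x(1)] by (auto simp: normals_at_def)
      then have "0 \<le> (x - p) \<bullet> w" by (simp add: facet_fun_offset inner_diff_left)
      then show ?thesis by (simp add: sgn_div_norm)
    qed
    obtain w0 where w0: "w0 \<in> normals_at P p" "\<kappa> * norm (x - p) \<le> \<bar>(x - p) \<bullet> sgn w0\<bar>"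
      using \<kappa>N by blast
    have fN: "finite (normals_at P p)" using finite_subset[OF NpP finite_normals[OF P]] .
    have "(x - p) \<bullet> sgn w0 \<le> (\<Sum>w\<in>normals_at P p. (x - p) \<bullet> sgn w)"
      by (rule member_le_sum[OF w0(1) _ fN]) (use pos in auto)
    also have "\<dots> = (x - p) \<bullet> g" by (simp add: g_def inner_sum_right)
    also have "\<dots> \<le> 2 * (e * ?n)" using xg by (simp add: inner_diff_left)
    finally have "\<kappa> * norm (x - p) \<le> 2 * (e * ?n)" using w0(2) pos[OF w0(1)] by simp
    then have "norm (x - p) \<le> e * (2 * ?n / \<kappa>)" using \<kappa> by (simp add: field_simps)
    moreover have "norm (q - p) \<le> norm (q - x) + norm (x - p)" using norm_triangle_ineq[of "q - x" "x - p"] by simp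
    ultimately have qp: "norm (q - p) \<le> e + e * (2 * ?n / \<kappa>)" using x(2) by (simp add: dist_norm)
    have far: "0 < facet_fun Q (f v) q" if v: "v \<in> normals P - normals_at P p" for v
    proof -
      have vP: "v \<in> normals P" using v by simp
      have fvQ: "f v \<in> normals Q" using fQ vP by blast
      have n: "norm v > 0" "norm (f v) > 0" using normals_nonzero[OF vP] normals_nonzero[OF fvQ] by auto
      have "\<mu> \<le> facet_fun P v p / norm v" by (rule \<mu>(2)[OF v])
      also have "\<dots> = p \<bullet> sgn v - offset P v / norm v" by (simp add: facet_fun_offset sgn_div_norm divide_inverse algebra_simps)
      finally have 1: "\<mu> \<le> p \<bullet> sgn v - offset P v / norm v" .
      have "\<bar>(q - p) \<bullet> sgn (f v)\<bar> \<le> norm (q - p) * norm (sgn (f v))" by (rule Cauchy_Schwarz_ineq2)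
      then have 2: "\<bar>q \<bullet> sgn (f v) - p \<bullet> sgn (f v)\<bar> \<le> e + e * (2 * ?n / \<kappa>)"
        using qp sgn1Q[OF fvQ] by (simp add: inner_diff_left)
      have "\<bar>p \<bullet> (sgn (f v) - sgn v)\<bar> \<le> norm p * norm (sgn (f v) - sgn v)" by (rule Cauchy_Schwarz_ineq2)
      also have "\<dots> \<le> norm p * e" using fs[OF vP] by (intro mult_left_mono) auto
      finally have 3: "\<bar>p \<bullet> sgn (f v) - p \<bullet> sgn v\<bar> \<le> norm p * e" by (simp add: inner_diff_right)
      have "e * K = e + e * (2 * ?n / \<kappa>) + norm p * e + e" by (simp add: K_def algebra_simps)
      then have "0 < q \<bullet> sgn (f v) - offset Q (f v) / norm (f v)"
        using 1 2 3 fo[OF vP] eK by linarith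
      also have "\<dots> = facet_fun Q (f v) q / norm (f v)"
        by (simp add: facet_fun_offset sgn_div_norm divide_inverse algebra_simps)
      finally show ?thesis using n by (simp add: zero_less_divide_iff)
    qed
    \<comment> \<open>By \<open>far\<close>, a facet of Q through q can only come from a facet of P
      through p. There are n normals at q and at most n images, so the two sets coincide.\<close>
    have sub: "normals_at Q q \<subseteq> f ` normals_at P p"
    proof
      fix \<nu> assume "\<nu> \<in> normals_at Q q"
      then have "\<nu> \<in> normals Q" "facet_fun Q \<nu> q = 0" by (auto simp: normals_at_def)
      then obtain v where "v \<in> normals P" "\<nu> = f v" using fQ by blast
      then show "\<nu> \<in> f ` normals_at P p" using far[of v] \<open>facet_fun Q \<nu> q = 0\<close> by fastforce
    qed
    obtain B' d' where vf': "vertex_frame Q q B' d'" using delzant_vertex_frame[OF Q q(1)] by blast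
    have Nq: "normals_at Q q = d' ` B'" by (rule vertex_frame_normals_at[OF Q q(2) vf'])
    have "card (normals_at Q q) = CARD('n)"
      unfolding Nq using card_image[OF vertex_frameD(9)[OF vf']] vertex_frameD(2)[OF vf'] by simp
    moreover have "card (f ` normals_at P p) \<le> CARD('n)" using card_image_le[OF fN] cN by metis
    ultimately have eqN: "normals_at Q q = f ` normals_at P p"
      using card_subset_eq[OF _ sub] card_mono[OF _ sub] fN by (metis finite_imageI le_antisym)
    then obtain b where b: "b \<in> B'" "f w = d' b" using w Nq by blast
    have bL: "b \<in> int_lattice" using vertex_frameD(3)[OF vf'] b(1) by blast
    have bd: "b \<bullet> d' b = 1" using vertex_frameD(5)[OF vf' b(1) b(1)] by simp
    then have "b \<noteq> 0" by auto
    then have b1: "1 \<le> norm b" using lattice_norm_ge_1[OF bL] by simp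
    have diff: "\<bar>b \<bullet> sgn (f v) - b \<bullet> sgn v\<bar> < norm b * e" if "v \<in> normals P" for v
    proof -
      have "\<bar>b \<bullet> (sgn (f v) - sgn v)\<bar> \<le> norm b * norm (sgn (f v) - sgn v)" by (rule Cauchy_Schwarz_ineq2)
      also have "\<dots> < norm b * e" using fs[OF that] b1 by (intro mult_strict_left_mono) auto
      finally show ?thesis by (simp add: inner_diff_right)
    qed
    obtain w1 where w1: "w1 \<in> normals_at P p" "\<kappa> * norm b \<le> \<bar>b \<bullet> sgn w1\<bar>" using \<kappa>N by blast
    have w1P: "w1 \<in> normals P" and wP: "w \<in> normals P" using w1 w NpP by auto
    have eb: "norm b * e \<le> \<kappa> * norm b / 2" using mult_left_mono[OF e(2), of "norm b"] by (simp add: mult_ac)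
    have kb: "0 < \<kappa> * norm b" using \<kappa> b1 by (intro mult_pos_pos) auto
    \<comment> \<open>Some normal w1 at p has a definite pairing with b. Images of normals other
      than w are orthogonal to b, and a turning of at most \<kappa> / 2 cannot reduce that pairing
      to zero. So w1 is w, and the same estimate bounds 1 / norm (f w) from below.\<close>
    have ww: "w1 = w"
    proof (rule ccontr)
      assume "w1 \<noteq> w"
      then have "f w1 \<noteq> f w" using finj w1P wP by (auto dest: inj_onD)
      moreover obtain b' where b': "b' \<in> B'" "f w1 = d' b'" using w1(1) eqN Nq by blast
      ultimately have "b \<bullet> f w1 = 0" using vertex_frameD(5)[OF vf' b(1) b'(1)] b by auto
      then have "b \<bullet> sgn (f w1) = 0" by (simp add: sgn_div_norm)
      then show False using diff[OF w1P] w1(2) eb kb by linarith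
    qed
    have "\<kappa> * norm b / 2 \<le> \<bar>b \<bullet> sgn (f w)\<bar>"
      using diff[OF wP] w1(2)[unfolded ww] eb by linarith
    also have "\<dots> = 1 / norm (f w)" using bd b(2) by (simp add: sgn_div_norm divide_inverse)
    finally have "\<kappa> * norm b / 2 \<le> 1 / norm (f w)" .
    moreover have "\<kappa> / 2 \<le> \<kappa> * norm b / 2" using b1 \<kappa> by simp
    ultimately have k2: "\<kappa> / 2 \<le> 1 / norm (f w)" by linarith
    have fwQ: "f w \<in> normals Q" using fQ wP by blast
    have "norm (f w) > 0" using normals_nonzero[OF fwQ] by simp
    then have "norm (f w) \<le> 2 / \<kappa>" using k2 \<kappa> by (simp add: field_simps)
    moreover have prim: "primitive (f w)" using fwQ by (simp add: normals_def)
    ultimately have "f w \<in> ?L" by (simp add: primitive_def)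
    have "sgn (f w) = sgn w"
    proof (rule ccontr)
      assume "sgn (f w) \<noteq> sgn w"
      then have "\<sigma> \<le> norm (sgn (f w) - sgn w)" using \<sigma>(2)[of "(f w, w)"] \<open>f w \<in> ?L\<close> wP by simp
      then show False using fs[OF wP] e(3) by simp
    qed
    then show "f w = w" by (rule normals_sgn_eq[OF P wP prim])
  qed
qed

text \<open>Each normal of P selects a nearby normal of Q. The directions of distinct normals of P
  are separated, so the choice is injective, and equal cardinalities make it bijective. Every normal
  belongs to some vertex, where the vertex result shows that it is fixed.\<close>

lemma normals_stable:
  fixes P :: "(real^'n) set"
  assumes P: "delzant P" and e: "0 < e"
  obtains h where "0 < h"
    "\<And>Q. delzant Q \<Longrightarrow> hausdorff_close h Q P \<Longrightarrow> card (normals Q) = card (normals P) \<Longrightarrow>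
      normals Q = normals P \<and> (\<forall>v\<in>normals P. \<bar>offset Q v - offset P v\<bar> < e)"
proof -
  let ?V = "{p. p extreme_point_of P}" and ?N = "normals P"
  have fV: "finite ?V" by (rule finite_polyhedron_extreme_points[OF delzantD(2)[OF P]])
  have fN: "finite ?N" by (rule finite_normals[OF P])
  have "\<forall>p\<in>?V. \<exists>e>0. \<forall>Q f. delzant Q \<longrightarrow> hausdorff_close e Q P \<longrightarrow> bij_betw f ?N (normals Q) \<longrightarrow>
      (\<forall>v\<in>?N. norm (sgn (f v) - sgn v) < e) \<longrightarrow>
      (\<forall>v\<in>?N. \<bar>offset Q (f v) / norm (f v) - offset P v / norm v\<bar> < e) \<longrightarrow>
      (\<forall>w\<in>normals_at P p. f w = w)"
  proof
    fix p assume "p \<in> ?V"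
    then have p: "p extreme_point_of P" by simp
    show "\<exists>e>0. \<forall>Q f. delzant Q \<longrightarrow> hausdorff_close e Q P \<longrightarrow> bij_betw f ?N (normals Q) \<longrightarrow>
      (\<forall>v\<in>?N. norm (sgn (f v) - sgn v) < e) \<longrightarrow>
      (\<forall>v\<in>?N. \<bar>offset Q (f v) / norm (f v) - offset P v / norm v\<bar> < e) \<longrightarrow>
      (\<forall>w\<in>normals_at P p. f w = w)"
      by (rule normals_stable_at_vertex[OF P p]) blast
  qed
  then obtain E where E: "\<And>p. p \<in> ?V \<Longrightarrow> 0 < E p"
    "\<And>p Q f w. p \<in> ?V \<Longrightarrow> delzant Q \<Longrightarrow> hausdorff_close (E p) Q P \<Longrightarrow> bij_betw f ?N (normals Q) \<Longrightarrow>
      (\<forall>v\<in>?N. norm (sgn (f v) - sgn v) < E p) \<Longrightarrow>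
      (\<forall>v\<in>?N. \<bar>offset Q (f v) / norm (f v) - offset P v / norm v\<bar> < E p) \<Longrightarrow>
      w \<in> normals_at P p \<Longrightarrow> f w = w"
    unfolding bchoice_iff by blast
  obtain e1 where e1: "0 < e1" "\<And>p. p \<in> ?V \<Longrightarrow> e1 \<le> E p"
    using finite_positive_lower_bound[OF fV, of E] E(1) by blast
  let ?S = "{(v, w) \<in> ?N \<times> ?N. v \<noteq> w}"
  have "\<exists>e>0. \<forall>vw\<in>?S. e \<le> norm (sgn (fst vw) - sgn (snd vw)) / 2"
  proof (rule finite_positive_lower_bound)
    show "finite ?S" by (rule finite_subset[of _ "?N \<times> ?N"]) (use fN in auto)
    show "0 < norm (sgn (fst vw) - sgn (snd vw)) / 2" if "vw \<in> ?S" for vw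
    proof -
      have "fst vw \<in> ?N" "snd vw \<in> ?N" "fst vw \<noteq> snd vw" using that by auto
      moreover have "primitive (fst vw)" using \<open>fst vw \<in> ?N\<close> by (simp add: normals_def)
      ultimately have "sgn (fst vw) \<noteq> sgn (snd vw)" using normals_sgn_eq[OF P] by blast
      then show ?thesis by simp
    qed
  qed
  then obtain e2 where e2: "0 < e2" "\<And>vw. vw \<in> ?S \<Longrightarrow> e2 \<le> norm (sgn (fst vw) - sgn (snd vw)) / 2"
    by blast
  \<comment> \<open>Facet approximation compares offsets divided by the norms of the normals; e3
    translates the bound back to the offsets.\<close>
  obtain e3 where e3: "0 < e3" "\<And>v. v \<in> ?N \<Longrightarrow> e3 \<le> e / norm v"
  proof -
    have "\<exists>e'>0. \<forall>v\<in>?N. e' \<le> e / norm v"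
    proof (rule finite_positive_lower_bound[OF fN])
      show "0 < e / norm v" if "v \<in> ?N" for v using e normals_nonzero[OF that] by simp
    qed
    then show thesis using that by blast
  qed
  define e0 where "e0 = min e1 (min e2 e3)"
  have e0: "0 < e0" "e0 \<le> e1" "e0 \<le> e2" "e0 \<le> e3" using e1 e2 e3 by (auto simp: e0_def)
  have "\<forall>v\<in>?N. \<exists>h>0. \<forall>Q. delzant Q \<longrightarrow> hausdorff_close h Q P \<longrightarrow>
    (\<exists>\<nu>\<in>normals Q. norm (sgn \<nu> - sgn v) < e0 \<and> \<bar>offset Q \<nu> / norm \<nu> - offset P v / norm v\<bar> < e0)"
  proof
    fix v assume v: "v \<in> ?N"
    show "\<exists>h>0. \<forall>Q. delzant Q \<longrightarrow> hausdorff_close h Q P \<longrightarrow>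
      (\<exists>\<nu>\<in>normals Q. norm (sgn \<nu> - sgn v) < e0 \<and> \<bar>offset Q \<nu> / norm \<nu> - offset P v / norm v\<bar> < e0)"
      by (rule facet_approximation_eps[OF P v e0(1)]) blast
  qed
  then obtain H where H: "\<And>v. v \<in> ?N \<Longrightarrow> 0 < H v"
    "\<And>v Q. v \<in> ?N \<Longrightarrow> delzant Q \<Longrightarrow> hausdorff_close (H v) Q P \<Longrightarrow>
    \<exists>\<nu>\<in>normals Q. norm (sgn \<nu> - sgn v) < e0 \<and> \<bar>offset Q \<nu> / norm \<nu> - offset P v / norm v\<bar> < e0"
    unfolding bchoice_iff by blast
  obtain h1 where h1: "0 < h1" "\<And>v. v \<in> ?N \<Longrightarrow> h1 \<le> H v"
    using finite_positive_lower_bound[OF fN, of H] H(1) by blast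
  show thesis
  proof (rule that[of "min h1 e1"])
    show "0 < min h1 e1" using h1 e1 by simp
    fix Q :: "(real^'n) set"
    assume Q: "delzant Q" and close: "hausdorff_close (min h1 e1) Q P" and card: "card (normals Q) = card ?N"
    have "\<forall>v\<in>?N. \<exists>\<nu>\<in>normals Q. norm (sgn \<nu> - sgn v) < e0 \<and> \<bar>offset Q \<nu> / norm \<nu> - offset P v / norm v\<bar> < e0"
    proof
      fix v assume v: "v \<in> ?N"
      have "min h1 e1 \<le> H v" using h1(2)[OF v] by simp
      then have "hausdorff_close (H v) Q P" by (rule hausdorff_close_mono[OF close])
      then show "\<exists>\<nu>\<in>normals Q. norm (sgn \<nu> - sgn v) < e0 \<and> \<bar>offset Q \<nu> / norm \<nu> - offset P v / norm v\<bar> < e0"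
        by (rule H(2)[OF v Q])
    qed
    then obtain f where f: "\<And>v. v \<in> ?N \<Longrightarrow> f v \<in> normals Q" "\<And>v. v \<in> ?N \<Longrightarrow> norm (sgn (f v) - sgn v) < e0"
      "\<And>v. v \<in> ?N \<Longrightarrow> \<bar>offset Q (f v) / norm (f v) - offset P v / norm v\<bar> < e0"
      by metis
    have inj: "inj_on f ?N"
    proof (rule inj_onI, rule ccontr)
      fix v w assume vw: "v \<in> ?N" "w \<in> ?N" "f v = f w" "v \<noteq> w"
      have "sgn v - sgn w = (sgn (f w) - sgn w) - (sgn (f v) - sgn v)" using vw(3) by simp
      then have "norm (sgn v - sgn w) \<le> norm (sgn (f w) - sgn w) + norm (sgn (f v) - sgn v)"
        by (metis norm_triangle_ineq4)
      also have "\<dots> < 2 * e0" using f(2)[OF vw(1)] f(2)[OF vw(2)] by simp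
      finally have "norm (sgn v - sgn w) / 2 < e2" using e0(3) by simp
      then show False using e2(2)[of "(v, w)"] vw by simp
    qed
    have "f ` ?N = normals Q"
      by (rule card_subset_eq[OF finite_normals[OF Q]]) (use f(1) card card_image[OF inj] in auto)
    then have bij: "bij_betw f ?N (normals Q)" using inj by (simp add: bij_betw_def)
    have fw: "f w = w" if w: "w \<in> ?N" for w
    proof -
      obtain p where p: "p extreme_point_of P" "w \<in> normals_at P p" using normals_vertex[OF P w] by blast
      have pV: "p \<in> ?V" using p by simp
      have "hausdorff_close (E p) Q P" by (rule hausdorff_close_mono[OF close]) (use e1(2)[OF pV] in simp)
      moreover have "\<forall>v\<in>?N. norm (sgn (f v) - sgn v) < E p"
        "\<forall>v\<in>?N. \<bar>offset Q (f v) / norm (f v) - offset P v / norm v\<bar> < E p"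
        using f(2,3) e1(2)[OF pV] e0(2) by (meson less_le_trans)+
      ultimately show ?thesis using E(2)[OF pV Q _ bij _ _ p(2)] by blast
    qed
    have NQ: "normals Q = ?N" using \<open>f ` ?N = normals Q\<close> fw by force
    moreover have "\<bar>offset Q v - offset P v\<bar> < e" if v: "v \<in> ?N" for v
    proof -
      have n: "norm v > 0" using normals_nonzero[OF v] by simp
      have "\<bar>offset Q v / norm v - offset P v / norm v\<bar> < e / norm v"
        using f(3)[OF v] fw[OF v] e0(4) e3(2)[OF v] by simp
      then have "\<bar>offset Q v - offset P v\<bar> / norm v < e / norm v"
        using n by (simp add: diff_divide_distrib[symmetric])
      then show ?thesis using n by (simp add: divide_less_cancel)
    qed
    ultimately show "normals Q = ?N \<and> (\<forall>v\<in>?N. \<bar>offset Q v - offset P v\<bar> < e)" by blast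
  qed
qed

section \<open>Deforming a Delzant polytope\<close>

text \<open>The edge directions are reindexed by their dual normals: among the facet functions at p,
  moving along E v changes only that of v.\<close>

lemma dual_edges:
  fixes P :: "(real^'n) set"
  assumes "delzant P" "p extreme_point_of P"
  shows "\<exists>E. (\<forall>v\<in>normals_at P p. \<forall>w\<in>normals_at P p. E v \<bullet> w = (if v = w then 1 else 0)) \<and>
    (\<forall>x. (\<Sum>v\<in>normals_at P p. (x \<bullet> v) *\<^sub>R E v) = x)"
proof -
  have pP: "p \<in> P" using assms(2) by (simp add: extreme_point_of_def)
  obtain B d where vf: "vertex_frame P p B d" using delzant_vertex_frame[OF assms] by blast
  have Np: "normals_at P p = d ` B" by (rule vertex_frame_normals_at[OF assms(1) pP vf])
  note inj = vertex_frameD(9)[OF vf]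
  have inv: "inv_into B d (d b) = b" if "b \<in> B" for b using inj that by simp
  have "inv_into B d v \<bullet> w = (if v = w then 1 else 0)" if v: "v \<in> normals_at P p" and w: "w \<in> normals_at P p" for v w
  proof -
    obtain b b' where "b \<in> B" "b' \<in> B" "v = d b" "w = d b'" using v w Np by auto
    then show ?thesis using vertex_frameD(5)[OF vf] inj by (auto simp: inv inj_on_def)
  qed
  moreover have "(\<Sum>v\<in>normals_at P p. (x \<bullet> v) *\<^sub>R inv_into B d v) = x" for x
  proof -
    have "(\<Sum>v\<in>normals_at P p. (x \<bullet> v) *\<^sub>R inv_into B d v) = (\<Sum>b\<in>B. (x \<bullet> d b) *\<^sub>R b)"
      unfolding Np using inj by (simp add: sum.reindex inv)
    then show ?thesis using vertex_frameD(6)[OF vf] by simp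
  qed
  ultimately show ?thesis by blast
qed

section \<open>Polynomial weights attached to the vertices\<close>

definition vertices :: "(real^'n) set \<Rightarrow> (real^'n) set" where
  "vertices P = {p. p extreme_point_of P}"

lemma finite_vertices: "delzant P \<Longrightarrow> finite (vertices P)"
  unfolding vertices_def by (rule finite_polyhedron_extreme_points[OF delzantD(2)])

text \<open>Takes the place of a bump function at p. Every facet missing p contributes its facet
  function as an explicit factor, which can later be split off.\<close>

definition vertex_weight :: "(real^'n) set \<Rightarrow> real^'n \<Rightarrow> real^'n \<Rightarrow> real" where
  "vertex_weight P p x = (\<Prod>w\<in>normals P - normals_at P p. facet_fun P w x)"

text \<open>For a facet missing p this is the weight divided by the facet function, written without
  division and hence meaningful on the facet itself.\<close>

definition vertex_cofactor :: "(real^'n) set \<Rightarrow> real^'n \<Rightarrow> real^'n \<Rightarrow> real^'n \<Rightarrow> real" where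
  "vertex_cofactor P p v x = (\<Prod>w\<in>normals P - normals_at P p - {v}. facet_fun P w x)"

definition weight_sum :: "(real^'n) set \<Rightarrow> real^'n \<Rightarrow> real" where
  "weight_sum P x = (\<Sum>p\<in>vertices P. vertex_weight P p x)"

lemma vertex_weight_cofactor:
  assumes "delzant P" "v \<in> normals P" "v \<notin> normals_at P p"
  shows "vertex_weight P p x = facet_fun P v x * vertex_cofactor P p v x"
  unfolding vertex_weight_def vertex_cofactor_def
  by (rule prod.remove) (use finite_normals[OF assms(1)] assms in auto)

lemma Ck_on_facet_fun: "open U \<Longrightarrow> Ck_on k U (facet_fun P v)"
proof -
  assume U: "open U"
  have "Ck_on k U (\<lambda>x. x \<bullet> v + - offset P v)"
    by (intro Ck_on_add Ck_on_const Ck_on_bounded_linear[OF _ bounded_linear_inner_left] Ck_on_id U)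
  then show ?thesis by (rule Ck_on_cong[OF U, rotated]) (simp add: facet_fun_offset)
qed

lemma Ck_on_vertex_weight: "open U \<Longrightarrow> Ck_on k U (vertex_weight P p)"
  unfolding vertex_weight_def[abs_def] by (intro Ck_on_prod Ck_on_facet_fun)

lemma Ck_on_vertex_cofactor: "open U \<Longrightarrow> Ck_on k U (vertex_cofactor P p v)"
  unfolding vertex_cofactor_def[abs_def] by (intro Ck_on_prod Ck_on_facet_fun)

lemma Ck_on_weight_sum: "open U \<Longrightarrow> Ck_on k U (weight_sum P)"
  unfolding weight_sum_def[abs_def] by (intro Ck_on_sum Ck_on_vertex_weight)

text \<open>Let p be a vertex of the intersection of P with all facets through x. A facet missing p
  also misses x, so the weight of p at x is a product of positive factors.\<close>

lemma weight_sum_pos: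
  fixes P :: "(real^'n) set"
  assumes P: "delzant P" and x: "x \<in> P"
  shows "0 < weight_sum P x"
proof -
  define A where "A = \<Inter> (insert P (facet_at P ` {w \<in> normals P. facet_fun P w x = 0}))"
  have A: "A face_of P" unfolding A_def
  proof (rule face_of_Inter)
    fix T assume "T \<in> insert P (facet_at P ` {w \<in> normals P. facet_fun P w x = 0})"
    then show "T face_of P"
      using facet_at_facet_of facet_of_imp_face_of face_of_refl[OF delzantD(4)[OF P]] by auto
  qed simp
  have "x \<in> A" using x by (auto simp: A_def facet_at_def facet_fun_offset)
  then obtain p where p: "p extreme_point_of P" "p \<in> A"
    using face_has_vertex[OF delzantD(3,4)[OF P] A] by blast
  have pos: "0 < facet_fun P w x" if "w \<in> normals P - normals_at P p" for w
  proof -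
    have w: "w \<in> normals P" "facet_fun P w p \<noteq> 0" using that by (auto simp: normals_at_def)
    have "facet_fun P w x \<noteq> 0"
    proof
      assume "facet_fun P w x = 0"
      then have "p \<in> facet_at P w" using p(2) w(1) by (auto simp: A_def)
      then show False using w(2) by (simp add: facet_at_def facet_fun_offset)
    qed
    then show ?thesis using facet_fun_nonneg[OF w(1) x] by simp
  qed
  show ?thesis unfolding weight_sum_def
  proof (rule sum_pos2[OF finite_vertices[OF P]])
    show "p \<in> vertices P" using p by (simp add: vertices_def)
    show "0 < vertex_weight P p x" unfolding vertex_weight_def by (rule prod_pos) (rule pos)
    show "0 \<le> vertex_weight P q x" for q
      unfolding vertex_weight_def by (rule prod_nonneg) (use facet_fun_nonneg x in auto)
  qed
qed

section \<open>Maps close to the identity\<close>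

text \<open>\<open>Ck_on\<close> controls the derivative in one fixed direction at a time; bounds
  along the finitely many axes combine to one that is uniform in the direction.\<close>

lemma Ck_on_bounded_derivative:
  fixes f :: "real^'n \<Rightarrow> real"
  assumes "compact K" "K \<subseteq> U" "Ck_on 1 U f"
  shows "\<exists>B\<ge>0. \<forall>x\<in>K. \<forall>a. \<bar>frechet_derivative f (at x) a\<bar> \<le> B * norm a"
proof -
  have f: "Ck_on (Suc 0) U f" using assms(3) by simp
  have "\<exists>B. \<forall>x\<in>K. \<bar>frechet_derivative f (at x) (axis j 1)\<bar> \<le> B" for j
  proof -
    have "continuous_on U (\<lambda>x. frechet_derivative f (at x) (axis j 1))"
      using Ck_on_SucD(2)[OF f] by simp
    then have "compact ((\<lambda>x. frechet_derivative f (at x) (axis j 1)) ` K)"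
      by (intro compact_continuous_image assms(1)) (rule continuous_on_subset[OF _ assms(2)])
    then have "bounded ((\<lambda>x. frechet_derivative f (at x) (axis j 1)) ` K)" by (rule compact_imp_bounded)
    then show ?thesis by (auto simp: bounded_iff)
  qed
  then obtain B where B: "\<And>j x. x \<in> K \<Longrightarrow> \<bar>frechet_derivative f (at x) (axis j 1)\<bar> \<le> B j" by metis
  define C where "C = (\<Sum>j\<in>UNIV. \<bar>B j\<bar>)"
  have "\<bar>frechet_derivative f (at x) a\<bar> \<le> C * norm a" if x: "x \<in> K" for x a
  proof -
    let ?f = "frechet_derivative f (at x)"
    have lin: "linear ?f" using Ck_on_SucD(1)[OF f] x assms(2) has_derivative_linear by blast
    have "a = (\<Sum>j\<in>UNIV. a $ j *\<^sub>R axis j 1)"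
      using basis_expansion[of a] by (simp add: scalar_mult_eq_scaleR)
    then have "?f a = ?f (\<Sum>j\<in>UNIV. a $ j *\<^sub>R axis j 1)" by simp
    also have "\<dots> = (\<Sum>j\<in>UNIV. a $ j * ?f (axis j 1))" by (simp add: linear_sum[OF lin] linear_scale[OF lin])
    finally have "\<bar>?f a\<bar> \<le> (\<Sum>j\<in>UNIV. \<bar>a $ j * ?f (axis j 1)\<bar>)" by (metis sum_abs)
    also have "\<dots> \<le> (\<Sum>j\<in>UNIV. norm a * \<bar>B j\<bar>)"
    proof (rule sum_mono)
      fix j
      have "\<bar>?f (axis j 1)\<bar> \<le> \<bar>B j\<bar>" using B[OF x, of j] by linarith
      then show "\<bar>a $ j * ?f (axis j 1)\<bar> \<le> norm a * \<bar>B j\<bar>"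
        unfolding abs_mult by (intro mult_mono component_le_norm_cart) auto
    qed
    finally show ?thesis by (simp add: C_def sum_distrib_left mult.commute)
  qed
  moreover have "0 \<le> C" by (auto simp: C_def intro: sum_nonneg)
  ultimately show ?thesis by blast
qed

text \<open>P is fattened by a small closed ball. Compactness serves the uniform derivative bounds,
  convexity the mean value inequality.\<close>

lemma compact_convex_neighbourhood:
  fixes P :: "'a::euclidean_space set"
  assumes "compact P" "convex P" "P \<noteq> {}" "open U" "P \<subseteq> U"
  obtains K where "compact K" "convex K" "P \<subseteq> interior K" "K \<subseteq> U"
proof -
  obtain e where e: "e > 0" "{x. infdist x P \<le> e} \<subseteq> U"
    using compact_in_open_separated[OF assms(3,1,4,5)] by blast
  let ?K = "{x + y |x y. x \<in> P \<and> y \<in> cball 0 e}"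
  have "P \<subseteq> interior ?K"
  proof
    fix x assume x: "x \<in> P"
    have "ball x e \<subseteq> ?K"
    proof
      fix y assume "y \<in> ball x e"
      then have "y = x + (y - x)" "y - x \<in> cball 0 e" by (auto simp: dist_norm norm_minus_commute)
      then show "y \<in> ?K" using x by blast
    qed
    then show "x \<in> interior ?K" using e(1) by (meson centre_in_ball interiorI open_ball)
  qed
  moreover have "?K \<subseteq> U"
  proof
    fix z assume "z \<in> ?K"
    then obtain x y where z: "z = x + y" "x \<in> P" "norm y \<le> e" by auto
    have "infdist z P \<le> dist z x" by (rule infdist_le[OF z(2)])
    also have "\<dots> \<le> e" using z by (simp add: dist_norm)
    finally show "z \<in> U" using e by blast
  qed
  moreover have "compact ?K" by (rule compact_sums[OF assms(1) compact_cball])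
  moreover have "convex ?K"
  proof -
    have "?K = (\<Union>x\<in>P. \<Union>y\<in>cball 0 e. {x + y})" by blast
    then show ?thesis using convex_sums[OF assms(2) convex_cball[of 0 e]] by simp
  qed
  ultimately show thesis using that by blast
qed

text \<open>By the mean value inequality f minus the identity has Lipschitz constant 1/2, so f
  cannot identify two points.\<close>

lemma expanding_near_identity:
  fixes f :: "real^'n \<Rightarrow> real^'n"
  assumes "convex S"
    and "\<And>x. x \<in> S \<Longrightarrow> (f has_derivative f' x) (at x)"
    and "\<And>x a. x \<in> S \<Longrightarrow> norm (f' x a - a) \<le> norm a / 2"
  shows "inj_on f S" "\<And>x a. x \<in> S \<Longrightarrow> f' x a = 0 \<Longrightarrow> a = 0"
proof -
  show "a = 0" if "x \<in> S" "f' x a = 0" for x a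
    using assms(3)[OF that(1), of a] that(2) by simp
  have lip: "norm ((f x - x) - (f y - y)) \<le> 1 / 2 * norm (x - y)" if "x \<in> S" "y \<in> S" for x y
  proof (rule differentiable_bound[OF assms(1), where f="\<lambda>x. f x - x" and f'="\<lambda>z a. f' z a - a"])
    fix z assume z: "z \<in> S"
    show "((\<lambda>x. f x - x) has_derivative (\<lambda>a. f' z a - a)) (at z within S)"
      by (intro has_derivative_diff has_derivative_at_withinI[OF assms(2)[OF z]] has_derivative_ident)
    show "onorm (\<lambda>a. f' z a - a) \<le> 1 / 2"
      by (rule onorm_le) (use assms(3)[OF z] in \<open>simp add: field_simps\<close>)
  next
    show "x \<in> S" "y \<in> S" by (fact that)+
  qed
  show "inj_on f S"
  proof (rule inj_onI)
    fix x y assume "x \<in> S" "y \<in> S" "f x = f y"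
    then have "norm (y - x) \<le> 1 / 2 * norm (x - y)" using lip[of x y] by simp
    then show "x = y" by (simp add: norm_minus_commute)
  qed
qed

text \<open>The image of the open polytope P0 is open by invariance of domain, and it is the part of
  the compact image of P lying in Q0, hence relatively closed there. By connectedness it is all of
  Q0, and closures give Q.\<close>

lemma polytope_map_onto:
  fixes P Q :: "(real^'n) set"
  assumes P: "delzant P" and Q: "delzant Q" and N: "normals Q = normals P"
    and W: "open W" "P \<subseteq> W" "continuous_on W f" "inj_on f W"
    and G: "\<And>x v. x \<in> P \<Longrightarrow> v \<in> normals P \<Longrightarrow> 0 < G v x"
    and fG: "\<And>x v. x \<in> P \<Longrightarrow> v \<in> normals P \<Longrightarrow> facet_fun Q v (f x) = facet_fun P v x * G v x"
  shows "f ` P = Q"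
proof
  show fPQ: "f ` P \<subseteq> Q"
  proof
    fix y assume "y \<in> f ` P"
    then obtain x where x: "x \<in> P" "y = f x" by blast
    have "0 \<le> facet_fun Q v y" if "v \<in> normals Q" for v
      using facet_fun_nonneg[of v P x] fG[OF x(1), of v] G[OF x(1), of v] x that N by simp
    then show "y \<in> Q" by (subst delzant_eq_halfspaces[OF Q]) simp
  qed
  define P0 where "P0 = {x. \<forall>v\<in>normals P. 0 < facet_fun P v x}"
  define Q0 where "Q0 = {x. \<forall>v\<in>normals P. 0 < facet_fun Q v x}"
  have P0P: "P0 \<subseteq> P"
  proof
    fix x assume "x \<in> P0"
    then have "\<forall>v\<in>normals P. 0 \<le> facet_fun P v x" by (auto simp: P0_def less_imp_le)
    then show "x \<in> P" by (subst delzant_eq_halfspaces[OF P]) simp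
  qed
  have intP: "interior P \<subseteq> P0" using delzant_interior_pos[OF P] by (auto simp: P0_def)
  have intQ: "interior Q \<subseteq> Q0" using delzant_interior_pos[OF Q] N by (auto simp: Q0_def)
  have openP0: "open P0"
  proof -
    have "P0 = (\<Inter>v\<in>normals P. {x. 0 < facet_fun P v x})" by (auto simp: P0_def)
    moreover have "open {x. 0 < facet_fun P v x}" for v
      unfolding facet_fun_offset by (intro open_Collect_less continuous_intros)
    ultimately show ?thesis using finite_normals[OF P] by auto
  qed
  have P0W: "P0 \<subseteq> W" using P0P W(2) by blast
  have op: "open (f ` P0)"
    by (rule invariance_of_domain[OF continuous_on_subset[OF W(3) P0W] openP0 inj_on_subset[OF W(4) P0W]])
  have cl: "compact (f ` P)"
    by (rule compact_continuous_image[OF continuous_on_subset[OF W(3,2)] delzantD(3)[OF P]])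
  have eq: "f ` P0 = f ` P \<inter> Q0"
  proof (intro equalityI subsetI)
    fix y assume "y \<in> f ` P0"
    then obtain x where x: "x \<in> P0" "y = f x" by blast
    then have "x \<in> P" using P0P by blast
    then show "y \<in> f ` P \<inter> Q0" using x fG G by (auto simp: P0_def Q0_def)
  next
    fix y assume "y \<in> f ` P \<inter> Q0"
    then obtain x where x: "x \<in> P" "y = f x" "f x \<in> Q0" by blast
    have "0 < facet_fun P v x" if v: "v \<in> normals P" for v
    proof -
      have "0 < facet_fun Q v (f x)" using x(3) v by (simp add: Q0_def)
      then have "0 < facet_fun P v x * G v x" unfolding fG[OF x(1) v] .
      then show ?thesis using G[OF x(1) v] by (simp add: zero_less_mult_iff)
    qed
    then show "y \<in> f ` P0" using x(2) by (auto simp: P0_def)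
  qed
  have "convex Q0"
  proof -
    have "Q0 = (\<Inter>v\<in>normals P. {x. v \<bullet> x > offset Q v})"
      by (auto simp: Q0_def facet_fun_offset inner_commute)
    then show ?thesis by (auto intro!: convex_INT convex_halfspace_gt)
  qed
  then have "connected Q0" by (rule convex_connected)
  moreover have "openin (top_of_set Q0) (f ` P0)"
    using op eq by (auto simp: openin_open intro!: exI[of _ "f ` P0"])
  moreover have "closedin (top_of_set Q0) (f ` P0)"
    unfolding eq using compact_imp_closed[OF cl] by (auto simp: closedin_closed intro!: exI[of _ "f ` P"])
  moreover have "f ` P0 \<noteq> {}" using intP delzant_interior(2)[OF P] by blast
  ultimately have fP0: "f ` P0 = Q0" by (auto simp: connected_clopen)
  have "Q \<subseteq> closure (interior Q)"
    using convex_closure_interior[OF delzantD(4)[OF Q] delzant_interior(2)[OF Q]] closure_subset by blast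
  also have "\<dots> \<subseteq> closure (f ` P)" using intQ fP0 P0P by (intro closure_mono) blast
  also have "\<dots> = f ` P" using compact_imp_closed[OF cl] by simp
  finally show "Q \<subseteq> f ` P" .
qed

text \<open>The data needed to lift \<psi> to the level sets. The square appears because the facet
  function is the squared modulus of the coordinate that g multiplies; h is the reciprocal factor as
  a function on Q and serves the inverse map.\<close>

definition facet_rescaling ::
  "(real^'n) set \<Rightarrow> (real^'n) set \<Rightarrow> (real^'n \<Rightarrow> real^'n) \<Rightarrow> (real^'n \<Rightarrow> real^'n \<Rightarrow> real) \<Rightarrow> (real^'n \<Rightarrow> real^'n \<Rightarrow> real) \<Rightarrow> bool" where
  "facet_rescaling P Q \<psi> g h \<longleftrightarrow> bij_betw \<psi> P Q \<and>
     (\<forall>v\<in>normals P. smooth_on P (g v) \<and> smooth_on Q (h v)) \<and>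
     (\<forall>x\<in>P. \<forall>v\<in>normals P. 0 < g v x \<and> h v (\<psi> x) * g v x = 1 \<and>
        facet_fun Q v (\<psi> x) = (g v x)\<^sup>2 * facet_fun P v x)"

text \<open>With rational weights \<open>vertex_weight P p x / weight_sum P x\<close>, which are \<open>1\<close> in total and
  vanish on the facets not containing \<open>p\<close>, the polytope \<open>P\<close> is deformed by translating
  it by \<open>\<delta> p\<close> near the vertex \<open>p\<close>, where \<open>\<delta> p\<close> moves the facets at \<open>p\<close> to those of \<open>Q\<close>.\<close>

lemma polytope_deformation:
  fixes P :: "(real^'n) set"
  assumes P: "delzant P"
  obtains e where "0 < e" "\<And>Q. delzant Q \<Longrightarrow> normals Q = normals P \<Longrightarrow>
    (\<And>v. v \<in> normals P \<Longrightarrow> \<bar>offset Q v - offset P v\<bar> < e) \<Longrightarrow> \<exists>\<psi> g h. facet_rescaling P Q \<psi> g h"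
proof -
  let ?V = "vertices P" and ?N = "normals P"
  note fV = finite_vertices[OF P] and fN = finite_normals[OF P]
  have NN: "normals_at P p \<subseteq> ?N" for p by (auto simp: normals_at_def)
  have fNp: "finite (normals_at P p)" for p using finite_subset[OF NN fN] .
  have "\<forall>p\<in>?V. \<exists>E. \<forall>v\<in>normals_at P p. \<forall>w\<in>normals_at P p. E v \<bullet> w = (if v = w then 1 else 0)"
    using dual_edges[OF P] unfolding vertices_def by blast
  then obtain E where E: "\<And>p v w. p \<in> ?V \<Longrightarrow> v \<in> normals_at P p \<Longrightarrow> w \<in> normals_at P p \<Longrightarrow>
      E p v \<bullet> w = (if v = w then 1 else 0)"
    by metis
  define U where "U = {x. 0 < weight_sum P x}"
  have cws: "continuous_on UNIV (weight_sum P)" using Ck_on_weight_sum[of UNIV 0 P] by simp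
  have U: "open U" unfolding U_def using cws by (intro open_Collect_less) auto
  have PU: "P \<subseteq> U" using weight_sum_pos[OF P] by (auto simp: U_def)
  define \<theta> where "\<theta> p x = vertex_weight P p x * inverse (weight_sum P x)" for p x
  \<comment> \<open>The normalized weight with the facet function of v split off.\<close>
  define \<omega> where "\<omega> p v x = vertex_cofactor P p v x * inverse (weight_sum P x)" for p v x
  have Cinv: "Ck_on k U (\<lambda>x. inverse (weight_sum P x))" for k
    by (rule Ck_on_inverse[OF U _ Ck_on_weight_sum[OF U]]) (auto simp: U_def)
  have C\<theta>: "Ck_on k U (\<theta> p)" for k p
    unfolding \<theta>_def[abs_def] by (intro Ck_on_mult U Ck_on_vertex_weight Cinv)
  have C\<omega>: "Ck_on k U (\<omega> p v)" for k p v
    unfolding \<omega>_def[abs_def] by (intro Ck_on_mult U Ck_on_vertex_cofactor Cinv)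
  have \<theta>1: "(\<Sum>p\<in>?V. \<theta> p x) = 1" if "x \<in> U" for x
    using that by (simp add: \<theta>_def sum_distrib_right[symmetric] weight_sum_def[symmetric] U_def)
  have \<theta>\<omega>: "\<theta> p x = facet_fun P v x * \<omega> p v x" if "v \<in> ?N" "v \<notin> normals_at P p" for p v x
    by (simp add: \<theta>_def \<omega>_def vertex_weight_cofactor[OF P that])
  obtain K where K: "compact K" "convex K" "P \<subseteq> interior K" "K \<subseteq> U"
    using compact_convex_neighbourhood[OF delzantD(3,4,7)[OF P] U PU] by blast
  have "\<forall>p. \<exists>B\<ge>0. \<forall>x\<in>K. \<forall>a. \<bar>frechet_derivative (\<theta> p) (at x) a\<bar> \<le> B * norm a"
    by (intro allI Ck_on_bounded_derivative[OF K(1,4)] C\<theta>)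
  then obtain B where B: "\<And>p. B p \<ge> 0"
    "\<And>p x a. x \<in> K \<Longrightarrow> \<bar>frechet_derivative (\<theta> p) (at x) a\<bar> \<le> B p * norm a"
    by metis
  have "\<exists>b\<ge>0. \<forall>x\<in>P. \<bar>\<omega> p v x\<bar> \<le> b" for p v
  proof -
    have "continuous_on P (\<omega> p v)" using C\<omega>[of 0 p v] PU by (auto intro: continuous_on_subset)
    then have "bounded (\<omega> p v ` P)"
      by (intro compact_imp_bounded compact_continuous_image delzantD(3)[OF P])
    then obtain b where "\<forall>x\<in>P. \<bar>\<omega> p v x\<bar> \<le> b" by (auto simp: bounded_iff)
    then have "\<forall>x\<in>P. \<bar>\<omega> p v x\<bar> \<le> \<bar>b\<bar>" by (meson abs_ge_self order_trans)
    then show ?thesis by (meson abs_ge_zero)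
  qed
  then obtain b where b: "\<And>p v. b p v \<ge> 0" "\<And>p v x. x \<in> P \<Longrightarrow> \<bar>\<omega> p v x\<bar> \<le> b p v" by metis
  define C where "C p = (\<Sum>v\<in>normals_at P p. norm (E p v))" for p
  have C0: "0 \<le> C p" for p by (auto simp: C_def intro: sum_nonneg)
  \<comment> \<open>Bounds per unit of offset difference: the first sum for the deviation of the
    derivative of \<psi> from the identity, the second for the deviation of the factors G v from 1.
    The choice of e keeps both below 1/2.\<close>
  define T where "T = (\<Sum>p\<in>?V. B p * C p) + (\<Sum>v\<in>?N. \<Sum>p\<in>?V. b p v * (C p * norm v + 1))"
  have T1: "0 \<le> (\<Sum>p\<in>?V. B p * C p)" using B(1) C0 by (auto intro!: sum_nonneg)
  have T2: "0 \<le> (\<Sum>p\<in>?V. b p v * (C p * norm v + 1))" for v using b(1) C0 by (auto intro!: sum_nonneg)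
  have T3: "(\<Sum>p\<in>?V. B p * C p) \<le> T" 
  proof -
    have "0 \<le> (\<Sum>v\<in>?N. \<Sum>p\<in>?V. b p v * (C p * norm v + 1))" by (rule sum_nonneg) (rule T2)
    then show ?thesis by (simp add: T_def)
  qed
  have T4: "(\<Sum>p\<in>?V. b p v * (C p * norm v + 1)) \<le> T" if "v \<in> ?N" for v
    using member_le_sum[OF that _ fN, of "\<lambda>v. \<Sum>p\<in>?V. b p v * (C p * norm v + 1)"] T1 T2
    by (simp add: T_def)
  have T0: "0 \<le> T" using T1 T3 by linarith
  define e where "e = 1 / (2 * (T + 1))"
  have e: "0 < e" using T0 by (simp add: e_def)
  have eT: "e * T < 1 / 2"
  proof -
    have "e * T < e * (T + 1)" using e by simp
    also have "\<dots> = 1 / 2" using T0 by (simp add: e_def field_simps)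
    finally show ?thesis .
  qed
  show thesis
  proof (rule that[OF e])
    fix Q :: "(real^'n) set"
    assume Q: "delzant Q" and NQ: "normals Q = ?N"
      and off: "\<And>v. v \<in> ?N \<Longrightarrow> \<bar>offset Q v - offset P v\<bar> < e"
    \<comment> \<open>The translation that pairs with each normal v at p to the change of its
      offset, written in the dual edge directions.\<close>
    define \<delta> where "\<delta> p = (\<Sum>v\<in>normals_at P p. (offset Q v - offset P v) *\<^sub>R E p v)" for p
    have \<delta>C: "norm (\<delta> p) \<le> e * C p" for p
    proof -
      have "norm (\<delta> p) \<le> (\<Sum>v\<in>normals_at P p. e * norm (E p v))"
        unfolding \<delta>_def
      proof (rule sum_norm_le)
        fix v assume "v \<in> normals_at P p"
        then have "v \<in> ?N" using NN by blast
        then have "\<bar>offset Q v - offset P v\<bar> \<le> e" using off[of v] by simp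
        then show "norm ((offset Q v - offset P v) *\<^sub>R E p v) \<le> e * norm (E p v)"
          by (simp add: mult_right_mono)
      qed
      then show ?thesis by (simp add: C_def sum_distrib_left)
    qed
    \<comment> \<open>The amount by which translation by \<delta> p misplaces the facet of
      v.\<close>
    define \<kappa> where "\<kappa> p v = \<delta> p \<bullet> v - (offset Q v - offset P v)" for p v
    have \<kappa>0: "\<kappa> p v = 0" if "p \<in> ?V" "v \<in> normals_at P p" for p v
    proof -
      have "\<delta> p \<bullet> v = (\<Sum>w\<in>normals_at P p. if w = v then offset Q w - offset P w else 0)"
        unfolding \<delta>_def inner_sum_left
        by (intro sum.cong refl) (simp add: E[OF that(1) _ that(2)])
      then show ?thesis using fNp that by (simp add: \<kappa>_def)
    qed
    have \<kappa>e: "\<bar>\<kappa> p v\<bar> \<le> e * (C p * norm v + 1)" if "v \<in> ?N" for p v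
    proof -
      have "\<bar>\<delta> p \<bullet> v\<bar> \<le> norm (\<delta> p) * norm v" by (rule Cauchy_Schwarz_ineq2)
      also have "\<dots> \<le> (e * C p) * norm v" using \<delta>C by (intro mult_right_mono) auto
      finally have "\<bar>\<delta> p \<bullet> v\<bar> \<le> (e * C p) * norm v" .
      then have "\<bar>\<kappa> p v\<bar> \<le> (e * C p) * norm v + e" using off[OF that] unfolding \<kappa>_def by linarith
      then show ?thesis by (simp add: algebra_simps)
    qed
    define \<psi> where "\<psi> x = x + (\<Sum>p\<in>?V. \<theta> p x *\<^sub>R \<delta> p)" for x
    define G where "G v x = 1 + (\<Sum>p\<in>?V. if v \<in> normals_at P p then 0 else \<omega> p v x * \<kappa> p v)" for v x
    \<comment> \<open>As the weights sum to 1, the new facet function is the old one plus the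
      weighted mean of the errors \<kappa>. Errors from vertices on the facet vanish, and all other
      weights contain the facet function as a factor.\<close>
    have fG: "facet_fun Q v (\<psi> x) = facet_fun P v x * G v x" if "x \<in> U" "v \<in> ?N" for x v
    proof -
      have "facet_fun Q v (\<psi> x) = facet_fun P v x + (\<Sum>p\<in>?V. \<theta> p x * (\<delta> p \<bullet> v)) - (offset Q v - offset P v) * 1"
        by (simp add: facet_fun_offset \<psi>_def inner_add_left inner_sum_left)
      also have "\<dots> = facet_fun P v x + (\<Sum>p\<in>?V. \<theta> p x * \<kappa> p v)"
        unfolding \<theta>1[OF that(1), symmetric]
        by (simp add: \<kappa>_def right_diff_distrib sum_subtractf sum_distrib_left mult.commute)
      also have "(\<Sum>p\<in>?V. \<theta> p x * \<kappa> p v) = facet_fun P v x * (\<Sum>p\<in>?V. if v \<in> normals_at P p then 0 else \<omega> p v x * \<kappa> p v)"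
        unfolding sum_distrib_left
        by (intro sum.cong refl) (use \<kappa>0 \<theta>\<omega>[OF that(2)] in auto)
      finally show ?thesis by (simp add: G_def algebra_simps)
    qed
    have Gpos: "0 < G v x" if "x \<in> P" "v \<in> ?N" for x v
    proof -
      have "\<bar>\<Sum>p\<in>?V. if v \<in> normals_at P p then 0 else \<omega> p v x * \<kappa> p v\<bar>
          \<le> (\<Sum>p\<in>?V. \<bar>if v \<in> normals_at P p then 0 else \<omega> p v x * \<kappa> p v\<bar>)" by (rule sum_abs)
      also have "\<dots> \<le> (\<Sum>p\<in>?V. e * (b p v * (C p * norm v + 1)))"
      proof (rule sum_mono)
        fix p
        have "\<bar>\<omega> p v x\<bar> * \<bar>\<kappa> p v\<bar> \<le> b p v * (e * (C p * norm v + 1))"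
          by (intro mult_mono b \<kappa>e that) auto
        moreover have "0 \<le> b p v * (e * (C p * norm v + 1))" using b(1) e C0 by auto
        ultimately show "\<bar>if v \<in> normals_at P p then 0 else \<omega> p v x * \<kappa> p v\<bar> \<le> e * (b p v * (C p * norm v + 1))"
          by (auto simp: abs_mult mult_ac)
      qed
      also have "\<dots> = e * (\<Sum>p\<in>?V. b p v * (C p * norm v + 1))" by (simp add: sum_distrib_left)
      also have "\<dots> \<le> e * T" using T4[OF that(2)] e by (intro mult_left_mono) auto
      finally show ?thesis using eT unfolding G_def by linarith
    qed
    have CG: "Ck_on k U (G v)" for k v
    proof -
      have "Ck_on k U (\<lambda>x. if v \<in> normals_at P p then 0 else \<omega> p v x * \<kappa> p v)" for p
        by (cases "v \<in> normals_at P p") (simp_all add: Ck_on_const[OF U] Ck_on_mult[OF U C\<omega> Ck_on_const[OF U]])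
      then show ?thesis unfolding G_def[abs_def] by (intro Ck_on_add Ck_on_const Ck_on_sum U)
    qed
    have C\<psi>: "Ck_on k U \<psi>" for k
      unfolding \<psi>_def[abs_def] by (intro Ck_on_add Ck_on_id Ck_on_sum Ck_on_scaleR Ck_on_const C\<theta> U)
    have KU: "interior K \<subseteq> U" using K(4) interior_subset by blast
    define \<psi>' where "\<psi>' x a = a + (\<Sum>p\<in>?V. frechet_derivative (\<theta> p) (at x) a *\<^sub>R \<delta> p)" for x a
    have D\<psi>: "(\<psi> has_derivative \<psi>' x) (at x)" if "x \<in> interior K" for x
    proof -
      have xU: "x \<in> U" using that KU by blast
      have "(\<theta> p has_derivative frechet_derivative (\<theta> p) (at x)) (at x)" for p
        using Ck_on_SucD(1)[OF C\<theta>[of "Suc 0" p] xU] .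
      then show ?thesis unfolding \<psi>_def[abs_def] \<psi>'_def[abs_def]
        by (intro has_derivative_add has_derivative_ident has_derivative_sum has_derivative_scaleR_left)
    qed
    have close: "norm (\<psi>' x a - a) \<le> norm a / 2" if "x \<in> interior K" for x a
    proof -
      have xK: "x \<in> K" using that interior_subset by blast
      have "norm (\<psi>' x a - a) = norm (\<Sum>p\<in>?V. frechet_derivative (\<theta> p) (at x) a *\<^sub>R \<delta> p)" by (simp add: \<psi>'_def)
      also have "\<dots> \<le> (\<Sum>p\<in>?V. (e * norm a) * (B p * C p))"
      proof (rule sum_norm_le)
        fix p
        have "\<bar>frechet_derivative (\<theta> p) (at x) a\<bar> * norm (\<delta> p) \<le> (B p * norm a) * (e * C p)"
          using B(1)[of p] by (intro mult_mono B(2)[OF xK] \<delta>C) auto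
        then show "norm (frechet_derivative (\<theta> p) (at x) a *\<^sub>R \<delta> p) \<le> (e * norm a) * (B p * C p)"
          by (simp add: mult_ac)
      qed
      also have "\<dots> = norm a * (e * (\<Sum>p\<in>?V. B p * C p))" by (simp add: sum_distrib_left mult_ac)
      also have "\<dots> \<le> norm a * (1 / 2)"
      proof (rule mult_left_mono)
        have "e * (\<Sum>p\<in>?V. B p * C p) \<le> e * T" using T3 e by (intro mult_left_mono) auto
        then show "e * (\<Sum>p\<in>?V. B p * C p) \<le> 1 / 2" using eT by linarith
      qed simp
      finally show ?thesis by simp
    qed
    have cvi: "convex (interior K)" by (rule convex_interior[OF K(2)])
    have inj: "inj_on \<psi> (interior K)" by (rule expanding_near_identity(1)[OF cvi D\<psi> close])
    have ker: "a = 0" if "x \<in> interior K" "frechet_derivative \<psi> (at x) a = 0" for x a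
      using expanding_near_identity(2)[OF cvi D\<psi> close that(1), of a] frechet_derivative_at[OF D\<psi>[OF that(1)]] that(2)
      by simp
    \<comment> \<open>An open neighbourhood of P where \<psi> is injective and the factors are
      positive. Smoothness on the closed sets P and Q is witnessed by extensions to W and its
      image.\<close>
    define W where "W = interior K \<inter> (\<Inter>v\<in>?N. {x \<in> U. 0 < G v x})"
    have openG: "open {x \<in> U. 0 < G v x}" for v
    proof -
      have "continuous_on U (G v)" using CG[of 0 v] by simp
      then have "open (U \<inter> G v -` {0<..})" by (rule continuous_open_preimage[OF _ U open_greaterThan])
      moreover have "U \<inter> G v -` {0<..} = {x \<in> U. 0 < G v x}" by auto
      ultimately show ?thesis by simp
    qed
    have W: "open W" "P \<subseteq> W" "W \<subseteq> U" "W \<subseteq> interior K"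
      unfolding W_def using fN openG KU K(3) PU Gpos by (auto intro!: open_Int open_INT)
    have WG: "0 < G v x" if "x \<in> W" "v \<in> ?N" for x v using that by (auto simp: W_def)
    have injW: "inj_on \<psi> W" by (rule inj_on_subset[OF inj W(4)])
    have C\<psi>W: "Ck_on k W \<psi>" for k by (rule Ck_on_subset[OF C\<psi> W(3)])
    have "continuous_on W \<psi>" using C\<psi>W[of 0] by simp
    then have onto: "\<psi> ` P = Q"
      using polytope_map_onto[OF P Q NQ W(1,2) _ injW, of G] Gpos fG PU by blast
    have inv: "open (\<psi> ` W)" "\<And>k. Ck_on k (\<psi> ` W) (inv_into W \<psi>)"
      using Ck_on_inverse_function[OF W(1) C\<psi>W injW] ker W(4) by blast+
    define g where "g v x = sqrt (G v x)" for v x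
    define h where "h v y = inverse (g v (inv_into W \<psi> y))" for v y
    have Cg: "Ck_on k W (g v)" if "v \<in> ?N" for k v
      unfolding g_def[abs_def] by (rule Ck_on_sqrt[OF W(1) WG[OF _ that] Ck_on_subset[OF CG W(3)]])
    have Cgi: "Ck_on k W (\<lambda>x. inverse (g v x))" if "v \<in> ?N" for k v
    proof (rule Ck_on_inverse[OF W(1) _ Cg[OF that]])
      show "g v x \<noteq> 0" if "x \<in> W" for x using WG[OF that \<open>v \<in> ?N\<close>] by (simp add: g_def)
    qed
    have Ch: "Ck_on k (\<psi> ` W) (h v)" if "v \<in> ?N" for k v
      unfolding h_def[abs_def]
      by (rule Ck_on_compose_euclidean[OF inv(1) W(1) _ inv(2) Cgi[OF that]]) (auto intro: inv_into_into)
    have "facet_rescaling P Q \<psi> g h"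
      unfolding facet_rescaling_def
    proof (intro conjI ballI)
      show "bij_betw \<psi> P Q" using onto inj_on_subset[OF injW W(2)] by (simp add: bij_betw_def)
      show "smooth_on P (g v)" if "v \<in> ?N" for v
        by (rule smooth_onI_global[OF W(1,2) Cg[OF that]]) simp
      show "smooth_on Q (h v)" if "v \<in> ?N" for v
        by (rule smooth_onI_global[OF inv(1) _ Ch[OF that]]) (use onto W(2) in auto)
      fix x v assume x: "x \<in> P" and v: "v \<in> ?N"
      have xW: "x \<in> W" using x W(2) by blast
      show g0: "0 < g v x" using Gpos[OF x v] by (simp add: g_def)
      show "h v (\<psi> x) * g v x = 1" using g0 inv_into_f_f[OF injW xW] by (simp add: h_def)
      show "facet_fun Q v (\<psi> x) = (g v x)\<^sup>2 * facet_fun P v x"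
        using fG[of x v] x PU v Gpos[OF x v] by (auto simp: g_def)
    qed
    then show "\<exists>\<psi> g h. facet_rescaling P Q \<psi> g h" by blast
  qed
qed

section \<open>From polytopes to toric manifolds\<close>

lemma smooth_on_Ck: "(\<And>k. Ck_on k UNIV f) \<Longrightarrow> smooth_on A f"
  by (rule smooth_onI_global[of UNIV]) auto

lemma smooth_on_bilinear:
  assumes B: "bounded_bilinear B" and f: "smooth_on A f" and g: "smooth_on A g"
  shows "smooth_on A (\<lambda>x. B (f x) (g x))"
  unfolding smooth_on_def
proof
  fix x assume x: "x \<in> A"
  obtain U F where U: "open U" "x \<in> U" "\<forall>k. Ck_on k U F" "\<forall>y\<in>U \<inter> A. F y = f y"
    using f x by (rule smooth_onE)
  obtain V G where V: "open V" "x \<in> V" "\<forall>k. Ck_on k V G" "\<forall>y\<in>V \<inter> A. G y = g y"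
    using g x by (rule smooth_onE)
  have "Ck_on k (U \<inter> V) (\<lambda>x. B (F x) (G x))" for k
    using U V by (intro Ck_on_bilinear[OF _ B]) (auto intro: Ck_on_subset)
  then show "\<exists>U F. open U \<and> x \<in> U \<and> (\<forall>k. Ck_on k U F) \<and> (\<forall>y\<in>U \<inter> A. F y = B (f y) (g y))"
    using U V by (intro exI[of _ "U \<inter> V"] exI[of _ "\<lambda>x. B (F x) (G x)"]) auto
qed

lemma smooth_on_add:
  assumes f: "smooth_on A f" and g: "smooth_on A g"
  shows "smooth_on A (\<lambda>x. f x + g x)"
  unfolding smooth_on_def
proof
  fix x assume x: "x \<in> A"
  obtain U F where U: "open U" "x \<in> U" "\<forall>k. Ck_on k U F" "\<forall>y\<in>U \<inter> A. F y = f y"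
    using f x by (rule smooth_onE)
  obtain V G where V: "open V" "x \<in> V" "\<forall>k. Ck_on k V G" "\<forall>y\<in>V \<inter> A. G y = g y"
    using g x by (rule smooth_onE)
  have "Ck_on k (U \<inter> V) (\<lambda>x. F x + G x)" for k
    using U V by (intro Ck_on_add) (auto intro: Ck_on_subset)
  then show "\<exists>U F. open U \<and> x \<in> U \<and> (\<forall>k. Ck_on k U F) \<and> (\<forall>y\<in>U \<inter> A. F y = f y + g y)"
    using U V by (intro exI[of _ "U \<inter> V"] exI[of _ "\<lambda>x. F x + G x"]) auto
qed

lemma smooth_on_sum:
  assumes "\<And>i. i \<in> I \<Longrightarrow> smooth_on A (f i)"
  shows "smooth_on A (\<lambda>x. \<Sum>i\<in>I. f i x)"
  using assms
  by (induction I rule: infinite_finite_induct) (auto intro: smooth_on_add smooth_on_Ck Ck_on_const)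

section \<open>Real coordinates on finitely supported functions\<close>

lemma lookup_scaleR: "Poly_Mapping.lookup (r *\<^sub>R z) v = r *\<^sub>R Poly_Mapping.lookup z v"
proof -
  have "finite {i. r *\<^sub>R Poly_Mapping.lookup z i \<noteq> 0}"
    by (rule finite_subset[OF _ finite_keys[of z]]) (auto simp: in_keys_iff)
  then show ?thesis by (simp add: scaleR_poly_mapping_def)
qed

lemma norm_poly_mapping_sum: "norm z = (\<Sum>v\<in>Poly_Mapping.keys z. norm (Poly_Mapping.lookup z v))"
  by (simp add: norm_poly_mapping_def dist_poly_mapping_def)

lemma norm_lookup_le: "norm (Poly_Mapping.lookup z v) \<le> norm z"
proof (cases "v \<in> Poly_Mapping.keys z")
  case True
  show ?thesis unfolding norm_poly_mapping_sum by (rule member_le_sum[OF True]) auto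
next
  case False
  then show ?thesis by (simp add: in_keys_iff)
qed

lemma bounded_linear_lookup: "bounded_linear (\<lambda>z. Poly_Mapping.lookup z v)"
  by (rule bounded_linear_intro[where K=1]) (auto simp: lookup_add lookup_scaleR norm_lookup_le)

lemma bounded_linear_single: "bounded_linear (\<lambda>c :: 'b::real_normed_vector. Poly_Mapping.single v c)"
proof (rule bounded_linear_intro[where K=1])
  show "norm (Poly_Mapping.single v c) \<le> norm c * 1" for c :: 'b
    by (cases "c = 0") (simp_all add: norm_poly_mapping_sum)
  show "Poly_Mapping.single v (r *\<^sub>R c) = r *\<^sub>R Poly_Mapping.single v c" for r and c :: 'b
    by (rule poly_mapping_eqI) (simp add: lookup_scaleR lookup_single when_def)
qed (simp add: single_add)

text \<open>Real and imaginary parts of the entries in N form the finite coordinate system required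
  by the chain rule.\<close>

lemma coords_expansion:
  fixes z :: "'n coords"
  assumes "finite N" "Poly_Mapping.keys z \<subseteq> N"
  shows "z = (\<Sum>(v, e)\<in>N \<times> Basis. (Poly_Mapping.lookup z v \<bullet> e) *\<^sub>R Poly_Mapping.single v e)"
proof (rule poly_mapping_eqI)
  fix w
  have "Poly_Mapping.lookup (\<Sum>(v, e)\<in>N \<times> Basis. (Poly_Mapping.lookup z v \<bullet> e) *\<^sub>R Poly_Mapping.single v e) w
      = (\<Sum>(v, e)\<in>N \<times> Basis. if v = w then (Poly_Mapping.lookup z v \<bullet> e) *\<^sub>R e else 0)"
    unfolding lookup_sum by (intro sum.cong refl) (auto simp: lookup_scaleR lookup_single when_def)
  also have "\<dots> = (\<Sum>v\<in>N. if v = w then (\<Sum>e\<in>Basis. (Poly_Mapping.lookup z v \<bullet> e) *\<^sub>R e) else 0)"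
    unfolding sum.cartesian_product[symmetric] by (intro sum.cong refl) auto
  also have "\<dots> = (\<Sum>v\<in>N. if v = w then Poly_Mapping.lookup z v else 0)"
    by (simp add: euclidean_representation cong: if_cong)
  also have "\<dots> = Poly_Mapping.lookup z w"
    using assms by (auto simp: in_keys_iff)
  finally show "Poly_Mapping.lookup z w = Poly_Mapping.lookup (\<Sum>(v, e)\<in>N \<times> Basis. (Poly_Mapping.lookup z v \<bullet> e) *\<^sub>R Poly_Mapping.single v e) w"
    by simp
qed

lemma smooth_on_compose_coords:
  fixes f :: "'a::real_normed_vector \<Rightarrow> 'n::finite coords"
  assumes "smooth_on A f" "smooth_on B g" "f ` A \<subseteq> B" "finite N" "\<And>x. x \<in> A \<Longrightarrow> Poly_Mapping.keys (f x) \<subseteq> N"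
  shows "smooth_on A (\<lambda>x. g (f x))"
proof (rule smooth_on_compose[OF assms(1-3), where J="N \<times> Basis"
      and c="\<lambda>j z. Poly_Mapping.lookup z (fst j) \<bullet> snd j" and b="\<lambda>j. Poly_Mapping.single (fst j) (snd j)"])
  show "finite (N \<times> (Basis :: complex set))" using assms(4) by simp
  show "bounded_linear (\<lambda>z. Poly_Mapping.lookup z (fst j) \<bullet> snd j)" for j :: "(real^'n) \<times> complex"
    by (rule bounded_linear_compose[OF bounded_linear_inner_left bounded_linear_lookup])
  show "f x = (\<Sum>j\<in>N \<times> Basis. (Poly_Mapping.lookup (f x) (fst j) \<bullet> snd j) *\<^sub>R Poly_Mapping.single (fst j) (snd j))"
    if "x \<in> A" for x
    using coords_expansion[OF assms(4) assms(5)[OF that]] by (simp add: case_prod_beta')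
  show "Poly_Mapping.lookup (Poly_Mapping.single (fst j) (snd j)) (fst i) \<bullet> snd i = (if i = j then 1 else 0)"
    if "i \<in> N \<times> Basis" "j \<in> N \<times> Basis" for i j :: "(real^'n) \<times> complex"
    using that by (auto simp: lookup_single when_def inner_Basis split: if_splits)
qed

section \<open>Torus orbits and the quotient topology\<close>

lemma lookup_torus_rotate: "Poly_Mapping.lookup (torus_rotate \<theta> z) v = cis (2 * pi * \<theta> v) * Poly_Mapping.lookup z v"
  by (simp add: torus_rotate_def lookup_mapp when_def in_keys_iff)

lemma torus_rotate_compose: "torus_rotate \<theta> (torus_rotate \<theta>' z) = torus_rotate (\<lambda>v. \<theta> v + \<theta>' v) z"
  by (rule poly_mapping_eqI) (simp add: lookup_torus_rotate cis_mult distrib_left flip: mult.assoc)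

lemma torus_rotate_0: "torus_rotate (\<lambda>v. 0) z = z"
  by (rule poly_mapping_eqI) (simp add: lookup_torus_rotate)

lemma normal_map_add: "normal_map P (\<lambda>v. \<theta> v + \<theta>' v) = normal_map P \<theta> + normal_map P \<theta>'"
  by (simp add: normal_map_def scaleR_left_distrib sum.distrib)

lemma normal_map_minus: "normal_map P (\<lambda>v. - \<theta> v) = - normal_map P \<theta>"
  by (simp add: normal_map_def sum_negf)

lemma int_lattice_add: "x \<in> int_lattice \<Longrightarrow> y \<in> int_lattice \<Longrightarrow> x + y \<in> int_lattice"
  and int_lattice_minus: "x \<in> int_lattice \<Longrightarrow> - x \<in> int_lattice"
  and int_lattice_0: "0 \<in> int_lattice"
  by (auto simp: int_lattice_def)

lemma H_orbit_refl: "z \<in> H_orbit P z"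
proof -
  have "normal_map P (\<lambda>v. 0) \<in> int_lattice" by (simp add: normal_map_def int_lattice_0)
  then show ?thesis unfolding H_orbit_def using torus_rotate_0[of z] by force
qed

lemma H_orbit_subset: "w \<in> H_orbit P z \<Longrightarrow> H_orbit P w \<subseteq> H_orbit P z"
proof
  fix y assume "w \<in> H_orbit P z" "y \<in> H_orbit P w"
  then obtain \<theta> \<theta>' where *: "normal_map P \<theta> \<in> int_lattice" "w = torus_rotate \<theta> z"
    "normal_map P \<theta>' \<in> int_lattice" "y = torus_rotate \<theta>' w" by (auto simp: H_orbit_def)
  have "y = torus_rotate (\<lambda>v. \<theta>' v + \<theta> v) z" using * by (simp add: torus_rotate_compose)
  moreover have "normal_map P (\<lambda>v. \<theta>' v + \<theta> v) \<in> int_lattice" using * by (simp add: normal_map_add int_lattice_add)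
  ultimately show "y \<in> H_orbit P z" by (auto simp: H_orbit_def)
qed

lemma H_orbit_sym: "w \<in> H_orbit P z \<Longrightarrow> z \<in> H_orbit P w"
proof -
  assume "w \<in> H_orbit P z"
  then obtain \<theta> where *: "normal_map P \<theta> \<in> int_lattice" "w = torus_rotate \<theta> z" by (auto simp: H_orbit_def)
  have "z = torus_rotate (\<lambda>v. - \<theta> v) w" using * by (simp add: torus_rotate_compose torus_rotate_0)
  moreover have "normal_map P (\<lambda>v. - \<theta> v) \<in> int_lattice" using * by (simp add: normal_map_minus int_lattice_minus)
  ultimately show ?thesis unfolding H_orbit_def by blast
qed

lemma H_orbit_eq: "w \<in> H_orbit P z \<Longrightarrow> H_orbit P w = H_orbit P z"
  using H_orbit_subset H_orbit_sym by blast

lemma toric_manifold_eq_orbit: "m \<in> toric_manifold P \<Longrightarrow> z \<in> m \<Longrightarrow> H_orbit P z = m"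
  unfolding toric_manifold_def using H_orbit_eq by blast

lemma torus_rotate_level_set: "z \<in> level_set P \<Longrightarrow> torus_rotate \<theta> z \<in> level_set P"
  by (auto simp: level_set_def lookup_torus_rotate norm_mult in_keys_iff)

lemma toric_manifold_subset: "m \<in> toric_manifold P \<Longrightarrow> z \<in> m \<Longrightarrow> z \<in> level_set P"
  by (auto simp: toric_manifold_def H_orbit_def torus_rotate_level_set)

lemma orbit_in_toric_manifold: "z \<in> level_set P \<Longrightarrow> H_orbit P z \<in> toric_manifold P"
  by (simp add: toric_manifold_def)

lemma Union_toric_manifold: "V \<subseteq> toric_manifold P \<Longrightarrow> \<Union>V = {z \<in> level_set P. H_orbit P z \<in> V}"
proof (intro equalityI subsetI)
  fix z assume V: "V \<subseteq> toric_manifold P" and "z \<in> \<Union>V"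
  then obtain m where m: "m \<in> V" "z \<in> m" by blast
  then have "m \<in> toric_manifold P" using V by blast
  then show "z \<in> {z \<in> level_set P. H_orbit P z \<in> V}"
    using m toric_manifold_eq_orbit toric_manifold_subset by auto
next
  fix z assume "z \<in> {z \<in> level_set P. H_orbit P z \<in> V}"
  then show "z \<in> \<Union>V" using H_orbit_refl by blast
qed

text \<open>Distinct orbits are disjoint, so passing to unions commutes with intersecting two
  families of orbits. Hence the defining predicate satisfies the axioms and \<open>topology\<close>
  does not alter it.\<close>

lemma openin_toric_topology:
  "openin (toric_topology P) V \<longleftrightarrow> V \<subseteq> toric_manifold P \<and> openin (top_of_set (level_set P)) (\<Union>V)"
proof -
  let ?L = "\<lambda>V. V \<subseteq> toric_manifold P \<and> openin (top_of_set (level_set P)) (\<Union>V)"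
  have Int: "?L (S \<inter> T)" if "?L S" "?L T" for S T
  proof -
    have sub: "S \<subseteq> toric_manifold P" "T \<subseteq> toric_manifold P" "S \<inter> T \<subseteq> toric_manifold P" using that by auto
    have "\<Union>(S \<inter> T) = \<Union>S \<inter> \<Union>T"
      unfolding Union_toric_manifold[OF sub(1)] Union_toric_manifold[OF sub(2)] Union_toric_manifold[OF sub(3)]
      by blast
    then show ?thesis using that by auto
  qed
  have Un: "?L (\<Union>\<K>)" if "\<forall>K\<in>\<K>. ?L K" for \<K>
  proof -
    have "\<Union>(\<Union>\<K>) = \<Union>(Union ` \<K>)" by blast
    moreover have "openin (top_of_set (level_set P)) (\<Union>(Union ` \<K>))"
      by (rule openin_Union) (use that in auto)
    ultimately show ?thesis using that by auto
  qed
  have "istopology ?L"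
    unfolding istopology_def
  proof (rule conjI)
    show "\<forall>S T. ?L S \<longrightarrow> ?L T \<longrightarrow> ?L (S \<inter> T)" using Int by (intro allI impI)
    show "\<forall>\<K>. (\<forall>K\<in>\<K>. ?L K) \<longrightarrow> ?L (\<Union>\<K>)" using Un by (intro allI impI)
  qed
  then show ?thesis unfolding toric_topology_def by (simp add: topology_inverse')
qed

lemma topspace_toric_topology: "topspace (toric_topology P) = toric_manifold P"
proof -
  have "\<Union>(toric_manifold P) = level_set P"
    using Union_toric_manifold[of "toric_manifold P" P] orbit_in_toric_manifold by auto
  then have "openin (toric_topology P) (toric_manifold P)" by (simp add: openin_toric_topology)
  then show ?thesis
    by (metis openin_subset openin_toric_topology openin_topspace subset_antisym)
qed

lemma keys_level_set: "z \<in> level_set P \<Longrightarrow> Poly_Mapping.keys z \<subseteq> normals P"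
  by (simp add: level_set_def)

text \<open>In charts \<phi> is locally the composite of a smooth section s into the level set, the
  lift \<Phi>, and the pullback of the target chart to its level set. Continuity follows by pulling
  back saturated open sets along \<Phi>.\<close>

lemma toric_smoothI:
  fixes P Q :: "(real^'n) set"
  assumes fin: "finite (normals P)" "finite (normals Q)"
    and sm: "smooth_on (level_set P) \<Phi>" and map: "\<And>z. z \<in> level_set P \<Longrightarrow> \<Phi> z \<in> level_set Q"
    and \<phi>: "\<And>z. z \<in> level_set P \<Longrightarrow> \<phi> (H_orbit P z) = H_orbit Q (\<Phi> z)"
  shows "toric_smooth P Q \<phi>"
  unfolding toric_smooth_def
proof (intro conjI allI impI)
  have \<phi>M: "\<phi> m \<in> toric_manifold Q" if "m \<in> toric_manifold P" for m
    using that \<phi> map by (auto simp: toric_manifold_def)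
  show "continuous_map (toric_topology P) (toric_topology Q) \<phi>"
    unfolding continuous_map_def topspace_toric_topology
  proof (intro conjI allI impI)
    show "\<phi> \<in> toric_manifold P \<rightarrow> toric_manifold Q" using \<phi>M by blast
    fix V assume V: "openin (toric_topology Q) V"
    then have VQ: "V \<subseteq> toric_manifold Q" "openin (top_of_set (level_set Q)) (\<Union>V)"
      by (auto simp: openin_toric_topology)
    let ?U = "{m \<in> toric_manifold P. \<phi> m \<in> V}"
    have "\<Union>?U = {z \<in> level_set P. H_orbit P z \<in> ?U}" by (rule Union_toric_manifold) auto
    also have "\<dots> = {z \<in> level_set P. H_orbit Q (\<Phi> z) \<in> V}" using \<phi> orbit_in_toric_manifold by auto
    also have "\<dots> = level_set P \<inter> \<Phi> -` (\<Union>V)" unfolding Union_toric_manifold[OF VQ(1)] using map by auto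
    also have "openin (top_of_set (level_set P)) \<dots>"
      using continuous_openin_preimage[OF smooth_on_continuous_on[OF sm] _ VQ(2)] map by blast
    finally show "openin (toric_topology P) ?U" by (simp add: openin_toric_topology)
  qed
next
  fix U \<kappa> V \<kappa>' assume "toric_chart P U \<kappa> \<and> toric_chart Q V \<kappa>'"
  then have cP: "toric_chart P U \<kappa>" and cQ: "toric_chart Q V \<kappa>'" by auto
  have inj: "inj_on \<kappa> U" using cP by (simp add: toric_chart_def)
  have sm': "smooth_on {z \<in> level_set Q. H_orbit Q z \<in> V} (\<lambda>z. \<kappa>' (H_orbit Q z))"
    using cQ by (simp add: toric_chart_def)
  let ?A = "\<kappa> ` {m \<in> U. \<phi> m \<in> V}"
  show "smooth_on ?A (\<lambda>x. \<kappa>' (\<phi> (inv_into U \<kappa> x)))"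
  proof (rule smooth_on_locally)
    fix x assume "x \<in> ?A"
    then have "x \<in> \<kappa> ` U" by blast
    moreover have "\<forall>y\<in>\<kappa> ` U. \<exists>W s. open W \<and> y \<in> W \<and> smooth_on W s \<and>
        (\<forall>x\<in>W. s x \<in> level_set P \<and> H_orbit P (s x) \<in> U \<and> \<kappa> (H_orbit P (s x)) = x)"
      using cP unfolding toric_chart_def by (elim conjE)
    ultimately have "\<exists>W s. open W \<and> x \<in> W \<and> smooth_on W s \<and>
        (\<forall>x\<in>W. s x \<in> level_set P \<and> H_orbit P (s x) \<in> U \<and> \<kappa> (H_orbit P (s x)) = x)" by (rule bspec[rotated])
    then obtain W s where W0: "open W" "x \<in> W" "smooth_on W s"
      and Ws: "\<forall>x\<in>W. s x \<in> level_set P \<and> H_orbit P (s x) \<in> U \<and> \<kappa> (H_orbit P (s x)) = x" by blast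
    have W1: "s x \<in> level_set P" "H_orbit P (s x) \<in> U" "\<kappa> (H_orbit P (s x)) = x" if "x \<in> W" for x
      using Ws that by auto
    note W = W0 W1
    have inv: "inv_into U \<kappa> y = H_orbit P (s y)" if "y \<in> W" for y
      by (rule inv_into_f_eq[OF inj W(5,6)]) (rule that)+
    have inV: "\<phi> (H_orbit P (s y)) \<in> V" if y: "y \<in> ?A \<inter> W" for y
    proof -
      obtain m where m: "m \<in> U" "\<phi> m \<in> V" "y = \<kappa> m" using y by blast
      have "inv_into U \<kappa> y = m" using m inj by simp
      then show ?thesis using inv[of y] y m(2) by simp
    qed
    have "smooth_on (?A \<inter> W) (\<lambda>x. \<Phi> (s x))"
      by (rule smooth_on_compose_coords[OF smooth_on_subset[OF W(3)] sm _ fin(1)])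
        (use W(4) keys_level_set in auto)
    then have "smooth_on (?A \<inter> W) (\<lambda>x. \<kappa>' (H_orbit Q (\<Phi> (s x))))"
    proof (rule smooth_on_compose_coords[OF _ sm' _ fin(2)])
      show "(\<lambda>x. \<Phi> (s x)) ` (?A \<inter> W) \<subseteq> {z \<in> level_set Q. H_orbit Q z \<in> V}"
        using inV \<phi> W(4) map by auto
      show "Poly_Mapping.keys (\<Phi> (s x)) \<subseteq> normals Q" if "x \<in> ?A \<inter> W" for x
        by (rule keys_level_set[OF map[OF W(4)]]) (use that in simp)
    qed
    then have "smooth_on (?A \<inter> W) (\<lambda>x. \<kappa>' (\<phi> (inv_into U \<kappa> x)))"
      by (rule smooth_on_cong) (simp add: inv \<phi> W(4))
    then show "\<exists>W. open W \<and> x \<in> W \<and> smooth_on (?A \<inter> W) (\<lambda>x. \<kappa>' (\<phi> (inv_into U \<kappa> x)))"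
      using W(1,2) by blast
  qed
qed

text \<open>The moment map, extended to all of \<open>\<complex>\<^sup>N\<close>: the values \<open>l\<^sup>(\<^sup>r\<^sup>)(x) = |z\<^sub>r|\<^sup>2\<close> for the facets at one
  vertex already determine \<open>x\<close>.\<close>

lemma moment_map_exists:
  fixes P :: "(real^'n) set"
  assumes P: "delzant P"
  shows "\<exists>\<mu> :: 'n coords \<Rightarrow> real^'n. (\<forall>k. Ck_on k UNIV \<mu>) \<and>
    (\<forall>z x. (\<forall>v\<in>normals P. (cmod (Poly_Mapping.lookup z v))\<^sup>2 = facet_fun P v x) \<longrightarrow> \<mu> z = x) \<and>
    (\<forall>\<theta> z. \<mu> (torus_rotate \<theta> z) = \<mu> z)"
proof -
  obtain p where p: "p extreme_point_of P"
    using extreme_point_exists_convex[OF delzantD(3,4,7)[OF P]] by blast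
  obtain E where E: "\<And>x. (\<Sum>v\<in>normals_at P p. (x \<bullet> v) *\<^sub>R E v) = x"
    using dual_edges[OF P p] by blast
  define \<mu> :: "'n coords \<Rightarrow> real^'n" where
    "\<mu> z = (\<Sum>v\<in>normals_at P p. (Poly_Mapping.lookup z v \<bullet> Poly_Mapping.lookup z v + offset P v) *\<^sub>R E v)" for z
  have sq: "Poly_Mapping.lookup z v \<bullet> Poly_Mapping.lookup z v = (cmod (Poly_Mapping.lookup z v))\<^sup>2"
    for z :: "'n coords" and v by (simp add: power2_norm_eq_inner)
  show ?thesis
  proof (intro exI[of _ \<mu>] conjI allI impI)
    show "Ck_on k UNIV \<mu>" for k
      unfolding \<mu>_def[abs_def]
      by (intro Ck_on_sum Ck_on_scaleR Ck_on_add Ck_on_const Ck_on_bilinear[OF _ bounded_bilinear_inner]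
          Ck_on_bounded_linear[OF _ bounded_linear_lookup] Ck_on_id open_UNIV)
    show "\<mu> (torus_rotate \<theta> z) = \<mu> z" for \<theta> z
      unfolding \<mu>_def sq by (simp add: lookup_torus_rotate norm_mult)
    fix z x assume z: "\<forall>v\<in>normals P. (cmod (Poly_Mapping.lookup z v))\<^sup>2 = facet_fun P v x"
    have "\<mu> z = (\<Sum>v\<in>normals_at P p. (x \<bullet> v) *\<^sub>R E v)"
      unfolding \<mu>_def sq
      by (intro sum.cong refl) (use z in \<open>auto simp: normals_at_def facet_fun_offset\<close>)
    then show "\<mu> z = x" by (simp add: E)
  qed
qed

section \<open>Lifting the deformation to the level sets\<close>

text \<open>Written as a finite sum of scaled unit coordinates, so that smoothness reduces to linear
  maps and products.\<close>

definition rescale :: "(real^'n) set \<Rightarrow> (real^'n \<Rightarrow> 'n coords \<Rightarrow> real) \<Rightarrow> 'n coords \<Rightarrow> 'n coords" where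
  "rescale N c z = (\<Sum>v\<in>N. c v z *\<^sub>R Poly_Mapping.single v (Poly_Mapping.lookup z v))"

lemma lookup_rescale:
  assumes "finite N"
  shows "Poly_Mapping.lookup (rescale N c z) w = (if w \<in> N then c w z *\<^sub>R Poly_Mapping.lookup z w else 0)"
proof -
  have "Poly_Mapping.lookup (rescale N c z) w = (\<Sum>v\<in>N. if v = w then c w z *\<^sub>R Poly_Mapping.lookup z w else 0)"
    unfolding rescale_def lookup_sum
    by (intro sum.cong refl) (auto simp: lookup_scaleR lookup_single when_def)
  then show ?thesis using assms by simp
qed

lemma smooth_on_rescale:
  assumes "\<And>v. v \<in> N \<Longrightarrow> smooth_on A (c v)"
  shows "smooth_on A (rescale N c)"
  unfolding rescale_def[abs_def]
  by (intro smooth_on_sum smooth_on_bilinear[OF bounded_bilinear_scaleR] assms smooth_on_Ck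
      Ck_on_bounded_linear[OF _ bounded_linear_single] Ck_on_bounded_linear[OF _ bounded_linear_lookup]
      Ck_on_id open_UNIV)

lemma rescale_torus_rotate:
  assumes "finite N" "\<And>v. v \<in> N \<Longrightarrow> c v (torus_rotate \<theta> z) = c v z"
  shows "rescale N c (torus_rotate \<theta> z) = torus_rotate \<theta> (rescale N c z)"
  by (rule poly_mapping_eqI) (simp add: lookup_rescale[OF assms(1)] lookup_torus_rotate assms(2))

text \<open>The group H depends on the normals alone, so it is the same for both polytopes.\<close>

lemma image_H_orbit:
  assumes "normals Q = normals P" "\<And>\<theta>. F (torus_rotate \<theta> z) = torus_rotate \<theta> (F z)"
  shows "F ` H_orbit P z = H_orbit Q (F z)"
proof -
  have "normal_map Q = normal_map P" using assms(1) by (simp add: normal_map_def fun_eq_iff)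
  then have "H_orbit Q (F z) = {F (torus_rotate \<theta> z) |\<theta>. normal_map P \<theta> \<in> int_lattice}"
    by (simp add: H_orbit_def assms(2))
  then show ?thesis by (auto simp: H_orbit_def)
qed

lemma level_set_moment:
  assumes P: "delzant P" and z: "z \<in> level_set P"
    and \<mu>: "\<forall>z x. (\<forall>v\<in>normals P. (cmod (Poly_Mapping.lookup z v))\<^sup>2 = facet_fun P v x) \<longrightarrow> \<mu> z = x"
  shows "\<mu> z \<in> P" "\<And>v. v \<in> normals P \<Longrightarrow> (cmod (Poly_Mapping.lookup z v))\<^sup>2 = facet_fun P v (\<mu> z)"
proof -
  obtain x where x: "\<And>v. v \<in> normals P \<Longrightarrow> (cmod (Poly_Mapping.lookup z v))\<^sup>2 = facet_fun P v x"
    using z by (auto simp: level_set_def)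
  have eq: "\<mu> z = x" using \<mu> x by blast
  have "0 \<le> facet_fun P v x" if "v \<in> normals P" for v using x[OF that] by (metis zero_le_power2)
  then show "\<mu> z \<in> P" unfolding eq by (subst delzant_eq_halfspaces[OF P]) simp
  show "\<And>v. v \<in> normals P \<Longrightarrow> (cmod (Poly_Mapping.lookup z v))\<^sup>2 = facet_fun P v (\<mu> z)"
    unfolding eq by (rule x)
qed

text \<open>\<Phi> multiplies the entry v by g v at the moment map, \<Psi> by h v. The relation
  between the facet functions makes \<psi> intertwine the moment maps, and then h g = 1 shows that
  \<Phi> and \<Psi> are mutually inverse on the level sets. Both commute with all rotations, so they
  pass to orbits; the map induced by \<Psi> leads from Q to P.\<close>

lemma facet_rescaling_imp_diffeomorphic:
  fixes P Q :: "(real^'n) set"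
  assumes P: "delzant P" and Q: "delzant Q" and N: "normals Q = normals P"
    and fr: "facet_rescaling P Q \<psi> g h"
  shows "equivariantly_diffeomorphic Q P"
proof -
  note fN = finite_normals[OF P]
  obtain \<mu>P :: "'n coords \<Rightarrow> real^'n" where cP: "\<And>k. Ck_on k UNIV \<mu>P"
    and uP: "\<forall>z x. (\<forall>v\<in>normals P. (cmod (Poly_Mapping.lookup z v))\<^sup>2 = facet_fun P v x) \<longrightarrow> \<mu>P z = x"
    and rP: "\<And>\<theta> z. \<mu>P (torus_rotate \<theta> z) = \<mu>P z"
    using moment_map_exists[OF P] by blast
  obtain \<mu>Q :: "'n coords \<Rightarrow> real^'n" where cQ: "\<And>k. Ck_on k UNIV \<mu>Q"
    and uQ: "\<forall>z x. (\<forall>v\<in>normals Q. (cmod (Poly_Mapping.lookup z v))\<^sup>2 = facet_fun Q v x) \<longrightarrow> \<mu>Q z = x"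
    and rQ: "\<And>\<theta> z. \<mu>Q (torus_rotate \<theta> z) = \<mu>Q z"
    using moment_map_exists[OF Q] by blast
  note lP = level_set_moment[OF P _ uP] and lQ = level_set_moment[OF Q _ uQ]
  have bij: "bij_betw \<psi> P Q" and sg: "\<And>v. v \<in> normals P \<Longrightarrow> smooth_on P (g v)"
    and sh: "\<And>v. v \<in> normals P \<Longrightarrow> smooth_on Q (h v)"
    and gpos: "\<And>x v. x \<in> P \<Longrightarrow> v \<in> normals P \<Longrightarrow> 0 < g v x"
    and hg: "\<And>x v. x \<in> P \<Longrightarrow> v \<in> normals P \<Longrightarrow> h v (\<psi> x) * g v x = 1"
    and \<psi>g: "\<And>x v. x \<in> P \<Longrightarrow> v \<in> normals P \<Longrightarrow> facet_fun Q v (\<psi> x) = (g v x)\<^sup>2 * facet_fun P v x"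
    using fr by (auto simp: facet_rescaling_def)
  define \<Phi> where "\<Phi> = rescale (normals P) (\<lambda>v z. g v (\<mu>P z))"
  define \<Psi> where "\<Psi> = rescale (normals P) (\<lambda>v z. h v (\<mu>Q z))"
  have l\<Phi>: "Poly_Mapping.lookup (\<Phi> z) w = (if w \<in> normals P then g w (\<mu>P z) *\<^sub>R Poly_Mapping.lookup z w else 0)" for z w
    unfolding \<Phi>_def by (rule lookup_rescale[OF fN])
  have l\<Psi>: "Poly_Mapping.lookup (\<Psi> z) w = (if w \<in> normals P then h w (\<mu>Q z) *\<^sub>R Poly_Mapping.lookup z w else 0)" for z w
    unfolding \<Psi>_def by (rule lookup_rescale[OF fN])
  have s\<Phi>: "smooth_on (level_set P) \<Phi>"
    unfolding \<Phi>_def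
    by (intro smooth_on_rescale smooth_on_compose_euclidean[OF smooth_on_Ck[OF cP] sg])
      (use lP(1) in auto)
  have s\<Psi>: "smooth_on (level_set Q) \<Psi>"
    unfolding \<Psi>_def
    by (intro smooth_on_rescale smooth_on_compose_euclidean[OF smooth_on_Ck[OF cQ] sh])
      (use lQ(1) in auto)
  have rot\<Phi>: "\<Phi> (torus_rotate \<theta> z) = torus_rotate \<theta> (\<Phi> z)" for \<theta> z
    unfolding \<Phi>_def by (rule rescale_torus_rotate[OF fN]) (simp add: rP)
  have rot\<Psi>: "\<Psi> (torus_rotate \<theta> z) = torus_rotate \<theta> (\<Psi> z)" for \<theta> z
    unfolding \<Psi>_def by (rule rescale_torus_rotate[OF fN]) (simp add: rQ)
  have A: "\<Phi> z \<in> level_set Q \<and> \<Psi> (\<Phi> z) = z" if z: "z \<in> level_set P" for z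
  proof
    note x = lP(1)[OF z] and lx = lP(2)[OF z]
    have eq: "(cmod (Poly_Mapping.lookup (\<Phi> z) v))\<^sup>2 = facet_fun Q v (\<psi> (\<mu>P z))" if "v \<in> normals Q" for v
      using that \<psi>g[OF x, of v] lx[of v] N by (simp add: l\<Phi> power_mult_distrib)
    have "Poly_Mapping.keys (\<Phi> z) \<subseteq> normals Q" unfolding N by (auto simp: in_keys_iff l\<Phi> split: if_splits)
    then show "\<Phi> z \<in> level_set Q" using eq by (auto simp: level_set_def)
    have \<mu>: "\<mu>Q (\<Phi> z) = \<psi> (\<mu>P z)" using uQ eq by blast
    show "\<Psi> (\<Phi> z) = z"
    proof (rule poly_mapping_eqI)
      fix v
      show "Poly_Mapping.lookup (\<Psi> (\<Phi> z)) v = Poly_Mapping.lookup z v"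
      proof (cases "v \<in> normals P")
        case True
        then show ?thesis by (simp add: l\<Psi> l\<Phi> \<mu> hg[OF x True])
      next
        case False
        then have "v \<notin> Poly_Mapping.keys z" using keys_level_set[OF z] by blast
        then show ?thesis using False by (simp add: l\<Psi> in_keys_iff)
      qed
    qed
  qed
  have B: "\<Psi> w \<in> level_set P \<and> \<Phi> (\<Psi> w) = w" if w: "w \<in> level_set Q" for w
  proof
    note lw = lQ(2)[OF w]
    obtain x where x: "x \<in> P" "\<mu>Q w = \<psi> x" using lQ(1)[OF w] bij by (auto simp: bij_betw_def)
    have eq: "(cmod (Poly_Mapping.lookup (\<Psi> w) v))\<^sup>2 = facet_fun P v x" if v: "v \<in> normals P" for v
    proof -
      have "(cmod (Poly_Mapping.lookup (\<Psi> w) v))\<^sup>2 = (h v (\<psi> x))\<^sup>2 * facet_fun Q v (\<psi> x)"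
        using v lw[of v] N x(2) by (simp add: l\<Psi> power_mult_distrib)
      also have "\<dots> = (h v (\<psi> x) * g v x)\<^sup>2 * facet_fun P v x"
        by (simp add: \<psi>g[OF x(1) v] power_mult_distrib)
      finally show ?thesis by (simp add: hg[OF x(1) v])
    qed
    have "Poly_Mapping.keys (\<Psi> w) \<subseteq> normals P" by (auto simp: in_keys_iff l\<Psi> split: if_splits)
    then show "\<Psi> w \<in> level_set P" using eq by (auto simp: level_set_def)
    have \<mu>: "\<mu>P (\<Psi> w) = x" using uP eq by blast
    show "\<Phi> (\<Psi> w) = w"
    proof (rule poly_mapping_eqI)
      fix v
      show "Poly_Mapping.lookup (\<Phi> (\<Psi> w)) v = Poly_Mapping.lookup w v"
      proof (cases "v \<in> normals P")
        case True
        then show ?thesis using hg[OF x(1) True] by (simp add: l\<Psi> l\<Phi> \<mu> x(2) mult.commute)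
      next
        case False
        then have "v \<notin> Poly_Mapping.keys w" using keys_level_set[OF w] N by blast
        then show ?thesis using False by (simp add: l\<Phi> in_keys_iff)
      qed
    qed
  qed
  have o\<Phi>: "\<Phi> ` H_orbit P z = H_orbit Q (\<Phi> z)" for z by (rule image_H_orbit[OF N rot\<Phi>])
  have o\<Psi>: "\<Psi> ` H_orbit Q z = H_orbit P (\<Psi> z)" for z by (rule image_H_orbit[OF N[symmetric] rot\<Psi>])
  have inv1: "\<Phi> ` \<Psi> ` m = m" if "m \<in> toric_manifold Q" for m
    using B toric_manifold_subset[OF that] by (simp add: image_image)
  have inv2: "\<Psi> ` \<Phi> ` m = m" if "m \<in> toric_manifold P" for m
    using A toric_manifold_subset[OF that] by (simp add: image_image)
  have m1: "\<Psi> ` m \<in> toric_manifold P" if "m \<in> toric_manifold Q" for m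
    using that B by (auto simp: toric_manifold_def o\<Psi>)
  have m2: "\<Phi> ` m \<in> toric_manifold Q" if "m \<in> toric_manifold P" for m
    using that A by (auto simp: toric_manifold_def o\<Phi>)
  have bij: "bij_betw ((`) \<Psi>) (toric_manifold Q) (toric_manifold P)"
    by (rule bij_betw_byWitness[where f'="(`) \<Phi>"]) (use inv1 inv2 m1 m2 in auto)
  have inv: "inv_into (toric_manifold Q) ((`) \<Psi>) m = \<Phi> ` m" if "m \<in> toric_manifold P" for m
    by (rule inv_into_f_eq[OF bij_betw_imp_inj_on[OF bij] m2 inv2]) (rule that)+
  show ?thesis
    unfolding equivariantly_diffeomorphic_def
  proof (intro exI[of _ "(`) \<Psi>"] conjI ballI)
    show "bij_betw ((`) \<Psi>) (toric_manifold Q) (toric_manifold P)" by (rule bij)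
    show "toric_smooth Q P ((`) \<Psi>)"
    proof (rule toric_smoothI[OF _ fN s\<Psi>])
      show "finite (normals Q)" using fN N by simp
      show "\<Psi> z \<in> level_set P" if "z \<in> level_set Q" for z using B that by blast
      show "\<Psi> ` H_orbit Q z = H_orbit P (\<Psi> z)" for z by (rule o\<Psi>)
    qed
    show "toric_smooth P Q (inv_into (toric_manifold Q) ((`) \<Psi>))"
    proof (rule toric_smoothI[OF fN _ s\<Phi>])
      show "finite (normals Q)" using fN N by simp
      show "\<Phi> z \<in> level_set Q" if "z \<in> level_set P" for z using A that by blast
      show "inv_into (toric_manifold Q) ((`) \<Psi>) (H_orbit P z) = H_orbit Q (\<Phi> z)" if "z \<in> level_set P" for z
        using inv[OF orbit_in_toric_manifold[OF that]] o\<Phi> by simp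
    qed
    fix C :: "(real^'n) set" and m assume "C \<in> carrier torus" "m \<in> toric_manifold Q"
    \<comment> \<open>With equal normals the same rotations lie over the torus element C on both
      sides.\<close>
    have "normal_map Q = normal_map P" using N by (simp add: normal_map_def fun_eq_iff)
    then have "\<Psi> ` torus_action Q C m = \<Psi> ` {torus_rotate \<theta> z |\<theta> z. normal_map P \<theta> \<in> C \<and> z \<in> m}"
      by (simp add: torus_action_def)
    also have "\<dots> = {\<Psi> (torus_rotate \<theta> z) |\<theta> z. normal_map P \<theta> \<in> C \<and> z \<in> m}"
      by blast
    also have "\<dots> = torus_action P C (\<Psi> ` m)"
      unfolding torus_action_def rot\<Psi> by blast
    finally show "\<Psi> ` torus_action Q C m = torus_action P C (\<Psi> ` m)" .
  qed
qed

section \<open>Eventual equivariant diffeomorphism\<close>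

theorem corollary5p2p3:
  fixes Ps :: "nat \<Rightarrow> (real^'n) set" and P :: "(real^'n) set" and \<sigma> :: "nat \<Rightarrow> nat"
  assumes "\<And>i. delzant (Ps i)" and "delzant P"
    and "(\<lambda>i. hausdorff_dist (Ps i) P) \<longlonglongrightarrow> 0"
    and "(\<lambda>i. card {F. F facet_of Ps i}) \<longlonglongrightarrow> card {F. F facet_of P}"
    and "strict_mono \<sigma>"
    and "equivariant_GH_converges torus
           (\<lambda>i. toric_manifold (Ps (\<sigma> i))) (\<lambda>i. guillemin_dist (Ps (\<sigma> i)))
           (\<lambda>i. torus_action (Ps (\<sigma> i)))
           (toric_manifold P) (guillemin_dist P) (torus_action P)"
  shows "\<forall>\<^sub>F i in sequentially. equivariantly_diffeomorphic (Ps (\<sigma> i)) P"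
proof -
  \<comment> \<open>The deformation fixes the tolerance e for the offsets first; the stability of
    the normals then supplies a Hausdorff bound h for this e.\<close>
  obtain e where e: "0 < e" and deform: "\<And>Q. delzant Q \<Longrightarrow> normals Q = normals P \<Longrightarrow>
      (\<And>v. v \<in> normals P \<Longrightarrow> \<bar>offset Q v - offset P v\<bar> < e) \<Longrightarrow> \<exists>\<psi> g h. facet_rescaling P Q \<psi> g h"
    using polytope_deformation[OF assms(2)] by metis
  obtain h where h: "0 < h" and stable: "\<And>Q. delzant Q \<Longrightarrow> hausdorff_close h Q P \<Longrightarrow>
      card (normals Q) = card (normals P) \<Longrightarrow>
      normals Q = normals P \<and> (\<forall>v\<in>normals P. \<bar>offset Q v - offset P v\<bar> < e)"
    using normals_stable[OF assms(2) e] by metis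
  have "\<forall>\<^sub>F i in sequentially. hausdorff_dist (Ps i) P < h"
    using order_tendstoD(2)[OF assms(3) h] .
  \<comment> \<open>A convergent sequence of natural numbers is eventually constant.\<close>
  moreover have "\<forall>\<^sub>F i in sequentially. card {F. F facet_of Ps i} = card {F. F facet_of P}"
    using assms(4) by (simp add: tendsto_discrete)
  ultimately have "\<forall>\<^sub>F i in sequentially. equivariantly_diffeomorphic (Ps i) P"
  proof eventually_elim
    case (elim i)
    have "hausdorff_close h (Ps i) P"
      by (rule hausdorff_dist_less_imp_close[OF delzantD(3)[OF assms(1)] delzantD(3)[OF assms(2)]
            delzantD(7)[OF assms(1)] delzantD(7)[OF assms(2)] elim(1)])
    moreover have "card (normals (Ps i)) = card (normals P)"
      using elim(2) card_normals[OF assms(1)] card_normals[OF assms(2)] by simp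
    ultimately have N: "normals (Ps i) = normals P"
      and off: "\<forall>v\<in>normals P. \<bar>offset (Ps i) v - offset P v\<bar> < e"
      using stable[OF assms(1)] by blast+
    obtain \<psi> g k where "facet_rescaling P (Ps i) \<psi> g k" using deform[OF assms(1) N] off by blast
    then show ?case by (rule facet_rescaling_imp_diffeomorphic[OF assms(2) assms(1) N])
  qed
  then show ?thesis by (rule eventually_subseq[OF assms(5)])
qed

end
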